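(* Let $(G,\rho)$ be a non-crossing framework in the plane, with $G$ $2$-connected, and let $\omega$ be a self-stress of $(G,\rho)$ that is non-zero on every edge. If the reciprocal framework $(G^*,\rho^* )$ determined by $\omega$ is also non-crossing, then the signs of $\omega$ satisfy the following vertex conditions: (1) there is a non-pointed vertex with no sign changes; (2) every other vertex is of one of the following kinds: (a) a pointed vertex with exactly two sign changes, none of them at the big (reflex) angle; (b) a pointed vertex with exactly four sign changes, one of them at the big angle; (c) a non-pointed vertex (including any vertex with a flat angle) with exactly four sign changes. Moreover, vertices of $(G,\rho)$ in cases (1), (2.a), (2.b), (2.c) correspond respectively to the following faces of $(G^*,\rho^* )$, and vice versa: (1) the exterior face, whose complement is a strictly convex polygon with no sign changes on its boundary; (2.a) internal faces that are pseudo-triangles with two sign changes, both at corners; (2.b) internal faces that are pseudo-triangles with four sign changes, three of them at corners; (2.c) internal faces that are pseudo-quadrangles with four sign changes, all at corners.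
   Context: Framework: a finite simple graph $G=(V,E)$ with a map $\rho:V\to\mathbb{R}^2$, $\rho(i)=p_i$, edges drawn as straight segments. It is non-crossing if vertices are distinct points and two edge segments meet at most in a common endpoint (a vertex never lies in the interior of an edge). Vertices with two flat angles (angles equal to $\pi$) are not allowed. Angles: the angles at a vertex are the sectors between cyclically consecutive incident edges. A convex (small) angle is one that is $\le\pi$ (flat angles count as convex); a reflex (big) angle is one that is $>\pi$. A vertex is pointed if one of its angles is reflex, and non-pointed otherwise (so a vertex with a flat angle is non-pointed). A pseudo-triangle (resp. pseudo-quadrangle) is a simple polygon with exactly three (resp. four) convex interior angles; the vertices at these are its corners. Self-stress: $\omega:E\to\mathbb{R}$ with $\sum_{j:ij\in E}\omega_{ij}(p_i-p_j)=0$ for every $i\in V$. A sign change around a vertex (or along the boundary cycle of a face) occurs at an angle whose two consecutive edges have stresses of opposite signs. Reciprocal: $G^*$ is the dual plane graph of the non-crossing drawing $(G,\rho)$ (one vertex per face, including the outer one; one edge $e^*$ per edge $e$). The reciprocal $(G^*,\rho^* )$ of $(G,\rho)$ determined by $\omega$ is the framework, unique up to translation, such that for every directed edge $i\to j$ with face $L$ on its left and $R$ on its right, $\rho^*(L)-\rho^*(R)=\omega_{ij}(p_j-p_i)$. It carries the self-stress $e^*\mapsto 1/\omega_e$; signs on $(G^*,\rho^* )$ refer to this self-stress, so $e^*$ has the same sign as $e$. The reciprocal is called non-crossing if $(G^*,\rho^* )$ is a non-crossing framework and its embedding is dual to that of $(G,\rho)$: face cycles of $(G,\rho)$ become vertex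 cycles (cyclic orders of edges around vertices) of $(G^*,\rho^* )$ and vertex cycles become face cycles, either all with the same orientation or all with reversed orientation (orientation of the outer face being considered from outside). In that case each vertex of $(G,\rho)$ corresponds to a face of $(G^*,\rho^* )$. *)

theory Defs
  imports "HOL-Analysis.Analysis"
begin

text \<open>The plane is \<^typ>\<open>complex\<close>; edges are two-element sets of vertices.\<close>

record 'v framework =
  verts :: "'v set"
  edges :: "'v set set"
  pos :: "'v \<Rightarrow> complex"

definition simple_graph :: "'v framework \<Rightarrow> bool" where
  "simple_graph G \<longleftrightarrow> finite (verts G) \<and> (\<forall>e\<in>edges G. e \<subseteq> verts G \<and> card e = 2)"

definition neighbours :: "'v framework \<Rightarrow> 'v \<Rightarrow> 'v set" where
  "neighbours G v = {w. {v, w} \<in> edges G}"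

definition connected_on :: "'v framework \<Rightarrow> 'v set \<Rightarrow> bool" where
  "connected_on G W \<longleftrightarrow> W \<noteq> {} \<and>
     (\<forall>u\<in>W. \<forall>v\<in>W. (u, v) \<in> {(x, y). x \<in> W \<and> y \<in> W \<and> {x, y} \<in> edges G}\<^sup>*)"

definition two_connected :: "'v framework \<Rightarrow> bool" where
  "two_connected G \<longleftrightarrow> card (verts G) \<ge> 3 \<and> connected_on G (verts G) \<and>
     (\<forall>v\<in>verts G. connected_on G (verts G - {v}))"

text \<open>The counterclockwise angle from \<open>z\<close> to \<open>w\<close>, normalised to the interval from
  \<open>0\<close> (exclusive) to \<open>2\<pi>\<close> (inclusive), so that a direction is at angle \<open>2\<pi>\<close> from itself.\<close>

definition ccw_angle :: "complex \<Rightarrow> complex \<Rightarrow> real" where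
  "ccw_angle z w = (if Arg2pi (w / z) = 0 then 2 * pi else Arg2pi (w / z))"

definition angle_size :: "'v framework \<Rightarrow> 'v \<Rightarrow> 'v \<times> 'v \<Rightarrow> real" where
  "angle_size G v = (\<lambda>(a, b). ccw_angle (pos G a - pos G v) (pos G b - pos G v))"

text \<open>An angle at \<open>v\<close> is a pair \<open>(a, b)\<close> of neighbours such that the edge to \<open>b\<close> is the
  counterclockwise successor of the edge to \<open>a\<close>; it stands for the sector swept from the
  former to the latter.\<close>

definition angles :: "'v framework \<Rightarrow> 'v \<Rightarrow> ('v \<times> 'v) set" where
  "angles G v = {(a, b). a \<in> neighbours G v \<and> b \<in> neighbours G v \<and>
     (\<forall>c\<in>neighbours G v. angle_size G v (a, b) \<le> angle_size G v (a, c))}"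

definition reflex_angles :: "'v framework \<Rightarrow> 'v \<Rightarrow> ('v \<times> 'v) set" where
  "reflex_angles G v = {\<alpha> \<in> angles G v. angle_size G v \<alpha> > pi}"

definition flat_angles :: "'v framework \<Rightarrow> 'v \<Rightarrow> ('v \<times> 'v) set" where
  "flat_angles G v = {\<alpha> \<in> angles G v. angle_size G v \<alpha> = pi}"

definition pointed :: "'v framework \<Rightarrow> 'v \<Rightarrow> bool" where
  "pointed G v \<longleftrightarrow> reflex_angles G v \<noteq> {}"

definition edge_segment :: "'v framework \<Rightarrow> 'v set \<Rightarrow> complex set" where
  "edge_segment G e = convex hull (pos G ` e)"

definition noncrossing :: "'v framework \<Rightarrow> bool" where
  "noncrossing G \<longleftrightarrow> simple_graph G \<and> inj_on (pos G) (verts G) \<and>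
     (\<forall>e\<in>edges G. \<forall>f\<in>edges G. e \<noteq> f \<longrightarrow>
        edge_segment G e \<inter> edge_segment G f \<subseteq> pos G ` (e \<inter> f)) \<and>
     (\<forall>e\<in>edges G. \<forall>v\<in>verts G. pos G v \<in> edge_segment G e \<longrightarrow> v \<in> e) \<and>
     (\<forall>v\<in>verts G. card (flat_angles G v) \<le> 1)"

definition drawing :: "'v framework \<Rightarrow> complex set" where
  "drawing G = pos G ` verts G \<union> (\<Union>e\<in>edges G. edge_segment G e)"

definition faces :: "'v framework \<Rightarrow> complex set set" where
  "faces G = components (- drawing G)"

text \<open>Since \<open>\<i> * (b - a)\<close> points to the left of the direction from \<open>a\<close> to \<open>b\<close>, this says that the
  points immediately to the left of the midpoint belong to \<open>F\<close>.\<close>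

definition on_left :: "complex \<Rightarrow> complex \<Rightarrow> complex set \<Rightarrow> bool" where
  "on_left a b F \<longleftrightarrow>
     (\<forall>\<^sub>F t in at_right (0::real). midpoint a b + of_real t * \<i> * (b - a) \<in> F)"

definition left_face :: "'v framework \<Rightarrow> 'v \<Rightarrow> 'v \<Rightarrow> complex set \<Rightarrow> bool" where
  "left_face G i j F \<longleftrightarrow> {i, j} \<in> edges G \<and> F \<in> faces G \<and> on_left (pos G i) (pos G j) F"

text \<open>Cyclic orders of edges, given by their successor relations. Around a vertex, edges are
  listed counterclockwise. A face is traversed with the face on the left; for the outer face
  this is the counterclockwise orientation as seen from outside. If \<open>(a, b)\<close> is an angle at
  \<open>v\<close>, its sector lies to the left of the directed edges from \<open>v\<close> to \<open>a\<close> and from \<open>b\<close> to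
  \<open>v\<close>, so the traversal of that face enters \<open>v\<close> from \<open>b\<close> and leaves it towards \<open>a\<close>.\<close>

definition vertex_cycle :: "'v framework \<Rightarrow> 'v \<Rightarrow> ('v set \<times> 'v set) set" where
  "vertex_cycle G v = {({v, a}, {v, b}) | a b. (a, b) \<in> angles G v}"

definition face_cycle :: "'v framework \<Rightarrow> complex set \<Rightarrow> ('v set \<times> 'v set) set" where
  "face_cycle G F = {({v, b}, {v, a}) | v a b. v \<in> verts G \<and> (a, b) \<in> angles G v \<and> left_face G v a F}"

definition self_stress :: "'v framework \<Rightarrow> ('v set \<Rightarrow> real) \<Rightarrow> bool" where
  "self_stress G \<omega> \<longleftrightarrow>
     (\<forall>i\<in>verts G. (\<Sum>j\<in>neighbours G i. \<omega> {i, j} *\<^sub>R (pos G i - pos G j)) = 0)"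

definition sign_changes :: "'v framework \<Rightarrow> ('v set \<Rightarrow> real) \<Rightarrow> 'v \<Rightarrow> ('v \<times> 'v) set" where
  "sign_changes G \<omega> v = {(a, b) \<in> angles G v. \<omega> {v, a} * \<omega> {v, b} < 0}"

definition dual_edge :: "'v framework \<Rightarrow> 'v set \<Rightarrow> complex set set" where
  "dual_edge G e = {F. \<exists>i j. e = {i, j} \<and> left_face G i j F}"

definition dual_framework :: "'v framework \<Rightarrow> (complex set \<Rightarrow> complex) \<Rightarrow> complex set framework" where
  "dual_framework G \<rho>' = \<lparr>verts = faces G, edges = dual_edge G ` edges G, pos = \<rho>'\<rparr>"

definition reciprocal :: "'v framework \<Rightarrow> ('v set \<Rightarrow> real) \<Rightarrow> (complex set \<Rightarrow> complex) \<Rightarrow> bool" where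
  "reciprocal G \<omega> \<rho>' \<longleftrightarrow> (\<forall>i j L R. left_face G i j L \<and> left_face G j i R \<longrightarrow>
     \<rho>' L - \<rho>' R = \<omega> {i, j} *\<^sub>R (pos G j - pos G i))"

definition dual_stress :: "'v framework \<Rightarrow> ('v set \<Rightarrow> real) \<Rightarrow> complex set set \<Rightarrow> real" where
  "dual_stress G \<omega> d = 1 / \<omega> (the_inv_into (edges G) (dual_edge G) d)"

text \<open>\<open>\<Phi>\<close> maps the vertices of \<open>G\<close> to the corresponding faces of the reciprocal. The two
  disjuncts are the cases where all orientations are preserved and all are reversed.\<close>

definition dual_embedding ::
    "'v framework \<Rightarrow> (complex set \<Rightarrow> complex) \<Rightarrow> ('v \<Rightarrow> complex set) \<Rightarrow> bool" where
  "dual_embedding G \<rho>' \<Phi> \<longleftrightarrow>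
     (let H = dual_framework G \<rho>'; star = map_prod (dual_edge G) (dual_edge G) in
      bij_betw \<Phi> (verts G) (faces H) \<and>
      ((\<forall>F\<in>faces G. star ` face_cycle G F = vertex_cycle H F) \<and>
       (\<forall>v\<in>verts G. star ` vertex_cycle G v = face_cycle H (\<Phi> v)) \<or>
       (\<forall>F\<in>faces G. star ` face_cycle G F = (vertex_cycle H F)\<inverse>) \<and>
       (\<forall>v\<in>verts G. star ` vertex_cycle G v = (face_cycle H (\<Phi> v))\<inverse>)))"

text \<open>Injectivity of \<^const>\<open>dual_edge\<close> expresses that the dual graph has no parallel edges;
  it has no loops by \<^const>\<open>simple_graph\<close>.\<close>

definition noncrossing_reciprocal ::
    "'v framework \<Rightarrow> (complex set \<Rightarrow> complex) \<Rightarrow> ('v \<Rightarrow> complex set) \<Rightarrow> bool" where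
  "noncrossing_reciprocal G \<rho>' \<Phi> \<longleftrightarrow>
     inj_on (dual_edge G) (edges G) \<and> noncrossing (dual_framework G \<rho>') \<and> dual_embedding G \<rho>' \<Phi>"

definition cyc_next :: "'a list \<Rightarrow> nat \<Rightarrow> 'a" where
  "cyc_next xs i = xs ! (Suc i mod length xs)"

definition cyc_prev :: "'a list \<Rightarrow> nat \<Rightarrow> 'a" where
  "cyc_prev xs i = xs ! ((i + length xs - 1) mod length xs)"

definition polygon_boundary :: "complex list \<Rightarrow> complex set" where
  "polygon_boundary ps = (\<Union>i<length ps. closed_segment (ps ! i) (cyc_next ps i))"

definition polygon_region :: "complex list \<Rightarrow> complex set" where
  "polygon_region ps = polygon_boundary ps \<union> inside (polygon_boundary ps)"

text \<open>Simple polygons, listed counterclockwise, i.e. with the interior to the left of each side.\<close>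

definition simple_polygon :: "complex list \<Rightarrow> bool" where
  "simple_polygon ps \<longleftrightarrow> length ps \<ge> 3 \<and> distinct ps \<and>
     (\<forall>i<length ps. \<forall>j<length ps. i \<noteq> j \<longrightarrow>
        closed_segment (ps ! i) (cyc_next ps i) \<inter> closed_segment (ps ! j) (cyc_next ps j)
          \<subseteq> {ps ! i, cyc_next ps i} \<inter> {ps ! j, cyc_next ps j}) \<and>
     (\<forall>i<length ps. on_left (ps ! i) (cyc_next ps i) (inside (polygon_boundary ps)))"

definition interior_angle :: "complex list \<Rightarrow> nat \<Rightarrow> real" where
  "interior_angle ps i = ccw_angle (cyc_next ps i - ps ! i) (cyc_prev ps i - ps ! i)"

definition corners :: "complex list \<Rightarrow> nat set" where
  "corners ps = {i. i < length ps \<and> interior_angle ps i \<le> pi}"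

definition pseudo_triangle :: "complex list \<Rightarrow> bool" where
  "pseudo_triangle ps \<longleftrightarrow> simple_polygon ps \<and> card (corners ps) = 3"

definition pseudo_quadrangle :: "complex list \<Rightarrow> bool" where
  "pseudo_quadrangle ps \<longleftrightarrow> simple_polygon ps \<and> card (corners ps) = 4"

definition strictly_convex_polygon :: "complex list \<Rightarrow> bool" where
  "strictly_convex_polygon ps \<longleftrightarrow> simple_polygon ps \<and> convex (polygon_region ps) \<and>
     (\<forall>i<length ps. interior_angle ps i < pi)"

definition vertex_1 :: "'v framework \<Rightarrow> ('v set \<Rightarrow> real) \<Rightarrow> 'v \<Rightarrow> bool" where
  "vertex_1 G \<omega> v \<longleftrightarrow> \<not> pointed G v \<and> sign_changes G \<omega> v = {}"

definition vertex_2a :: "'v framework \<Rightarrow> ('v set \<Rightarrow> real) \<Rightarrow> 'v \<Rightarrow> bool" where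
  "vertex_2a G \<omega> v \<longleftrightarrow> pointed G v \<and> card (sign_changes G \<omega> v) = 2 \<and>
     sign_changes G \<omega> v \<inter> reflex_angles G v = {}"

definition vertex_2b :: "'v framework \<Rightarrow> ('v set \<Rightarrow> real) \<Rightarrow> 'v \<Rightarrow> bool" where
  "vertex_2b G \<omega> v \<longleftrightarrow> pointed G v \<and> card (sign_changes G \<omega> v) = 4 \<and>
     card (sign_changes G \<omega> v \<inter> reflex_angles G v) = 1"

definition vertex_2c :: "'v framework \<Rightarrow> ('v set \<Rightarrow> real) \<Rightarrow> 'v \<Rightarrow> bool" where
  "vertex_2c G \<omega> v \<longleftrightarrow> \<not> pointed G v \<and> card (sign_changes G \<omega> v) = 4"

text \<open>In a non-crossing framework no vertex lies in the interior
  of an edge, so a closed walk whose polygon bounds a face consists of all the vertices on the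
  boundary of that face.\<close>

definition closed_walk :: "'v framework \<Rightarrow> 'v list \<Rightarrow> bool" where
  "closed_walk G vs \<longleftrightarrow> set vs \<subseteq> verts G \<and> (\<forall>i<length vs. {vs ! i, cyc_next vs i} \<in> edges G)"

definition cycle_sign_changes :: "('v set \<Rightarrow> real) \<Rightarrow> 'v list \<Rightarrow> nat set" where
  "cycle_sign_changes \<omega> vs =
     {i. i < length vs \<and> \<omega> {cyc_prev vs i, vs ! i} * \<omega> {vs ! i, cyc_next vs i} < 0}"

definition internal_face_cycle :: "'v framework \<Rightarrow> complex set \<Rightarrow> 'v list \<Rightarrow> bool" where
  "internal_face_cycle G F vs \<longleftrightarrow> F \<in> faces G \<and> bounded F \<and> closed_walk G vs \<and>
     F = inside (polygon_boundary (map (pos G) vs))"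

definition exterior_face_cycle :: "'v framework \<Rightarrow> complex set \<Rightarrow> 'v list \<Rightarrow> bool" where
  "exterior_face_cycle G F vs \<longleftrightarrow> F \<in> faces G \<and> \<not> bounded F \<and> closed_walk G vs \<and>
     - F = polygon_region (map (pos G) vs)"

definition face_1 :: "'v framework \<Rightarrow> ('v set \<Rightarrow> real) \<Rightarrow> complex set \<Rightarrow> bool" where
  "face_1 G \<omega> F \<longleftrightarrow> (\<exists>vs. exterior_face_cycle G F vs \<and>
     strictly_convex_polygon (map (pos G) vs) \<and> cycle_sign_changes \<omega> vs = {})"

definition face_2a :: "'v framework \<Rightarrow> ('v set \<Rightarrow> real) \<Rightarrow> complex set \<Rightarrow> bool" where
  "face_2a G \<omega> F \<longleftrightarrow> (\<exists>vs. internal_face_cycle G F vs \<and> pseudo_triangle (map (pos G) vs) \<and>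
     card (cycle_sign_changes \<omega> vs) = 2 \<and> cycle_sign_changes \<omega> vs \<subseteq> corners (map (pos G) vs))"

definition face_2b :: "'v framework \<Rightarrow> ('v set \<Rightarrow> real) \<Rightarrow> complex set \<Rightarrow> bool" where
  "face_2b G \<omega> F \<longleftrightarrow> (\<exists>vs. internal_face_cycle G F vs \<and> pseudo_triangle (map (pos G) vs) \<and>
     card (cycle_sign_changes \<omega> vs) = 4 \<and>
     card (cycle_sign_changes \<omega> vs \<inter> corners (map (pos G) vs)) = 3)"

definition face_2c :: "'v framework \<Rightarrow> ('v set \<Rightarrow> real) \<Rightarrow> complex set \<Rightarrow> bool" where
  "face_2c G \<omega> F \<longleftrightarrow> (\<exists>vs. internal_face_cycle G F vs \<and> pseudo_quadrangle (map (pos G) vs) \<and>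
     card (cycle_sign_changes \<omega> vs) = 4 \<and> cycle_sign_changes \<omega> vs \<subseteq> corners (map (pos G) vs))"

end

theory Submission
  imports Defs
begin

text \<open>The edges of the reciprocal around the face that corresponds to a vertex \<open>v\<close> are parallel to the
edges at \<open>v\<close> and come in the same cyclic order; those with negative stress are reversed. Hence the
interior angle of this face at the corner belonging to an angle \<open>\<alpha>\<close> at \<open>v\<close> is determined by \<open>\<alpha>\<close>
and by the presence of a sign change: it is \<open>\<alpha>\<close> at a sign change, and otherwise \<open>\<alpha> + \<pi>\<close> or
\<open>\<alpha> - \<pi>\<close>, depending on whether \<open>\<alpha>\<close> is convex or reflex (\<open>dual_angle_eq\<close>). Let \<open>s\<close> be the number of
sign changes at \<open>v\<close>, and let \<open>r\<close> be the number, zero or one, of reflex angles without sign change.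
Then the angles of the dual face add up to \<open>\<pi> * (deg v + 2 - 2 * r - s)\<close> (\<open>dual_angle_sum\<close>). The
types of vertices express that \<open>2 * r + s\<close> is zero for one vertex and four for all others.

For a single polygon this would follow from its total turning. Instead, two inequalities for all
faces together are played off against each other. Around each vertex of the reciprocal the angles
add up to \<open>2\<pi>\<close>, and with Euler's inequality \<open>|V| - |E| + |F| \<ge> 2\<close> (\<open>euler_inequality\<close>) the sum of
\<open>2 * r + s\<close> over all vertices is at most \<open>4 * (|V| - 1)\<close>. On the other hand a bounded face has at
least three strictly convex corners, among the extreme points of its convex hull; since \<open>s\<close> is
even, this implies \<open>2 * r + s \<ge> 4\<close> (\<open>turning_lower_bound\<close>). Exactly one face is unbounded, so
equality holds throughout (\<open>vertex_turning\<close>).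

This presumes that duality reverses orientations. If it preserved them, the interior angles would be
the complements to \<open>2\<pi>\<close> of those above. For a vertex that is extreme in some direction, the highest
and the lowest corner of the dual face would then come from two different reflex angles at this
vertex, which is absurd (\<open>reversed\<close>).

It remains to see the faces as polygons. By \<open>2\<close>-connectedness the faces around a vertex are
distinct (\<open>lface_inj_around_vertex\<close>), so the dual face of \<open>v\<close> is one side of a simple polygon
(\<open>dual_polygon\<close>, \<open>dual_face_inside_outside\<close>), whose corners and sign changes are read off from the
angles. Around the exterior face all stresses have the same sign, so that the edges of its boundary
are ordered by direction; therefore each of them spans a supporting line (\<open>supporting_line\<close>), and
the polygon is convex.\<close>

section \<open>Counterclockwise angles\<close>

lemma ccw_angle_pos: "0 < ccw_angle z w"
  using Arg2pi_ge_0[of "w / z"] unfolding ccw_angle_def by (auto simp: less_le)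

lemma ccw_angle_le: "ccw_angle z w \<le> 2 * pi"
  using Arg2pi_lt_2pi[of "w / z"] unfolding ccw_angle_def by (auto intro: less_imp_le)

lemma ccw_angle_eqI:
  assumes "z \<noteq> 0" "0 < r" "0 < \<phi>" "\<phi> \<le> 2 * pi" "w = of_real r * cis \<phi> * z"
  shows "ccw_angle z w = \<phi>"
proof -
  have q: "w / z = of_real r * cis \<phi>" using assms by simp
  show ?thesis
  proof (cases "\<phi> = 2 * pi")
    case True
    then have "Arg2pi (w / z) = 0" using q assms(2) Arg2pi_of_real[of r] by simp
    then show ?thesis using True by (simp add: ccw_angle_def)
  next
    case False
    have "Arg2pi (w / z) = \<phi>"
      by (rule Arg2pi_unique[of r]) (use assms q False in \<open>auto simp: cis_conv_exp\<close>)
    then show ?thesis using assms by (simp add: ccw_angle_def)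
  qed
qed

lemma ccw_angle_polar:
  assumes "z \<noteq> 0" "w \<noteq> 0"
  shows "w = of_real (norm w / norm z) * cis (ccw_angle z w) * z"
proof -
  have c: "cis (ccw_angle z w) = cis (Arg2pi (w / z))" by (simp add: ccw_angle_def)
  have "w / z = of_real (norm (w / z)) * cis (Arg2pi (w / z))"
    using Arg2pi_eq[of "w / z"] by (simp add: cis_conv_exp)
  then show ?thesis using assms unfolding c by (simp add: norm_divide field_simps)
qed

lemma ccw_angle_polarE:
  assumes "z \<noteq> 0" "w \<noteq> 0"
  obtains r where "0 < r" "w = of_real r * cis (ccw_angle z w) * z"
  using ccw_angle_polar[OF assms] assms by (metis divide_pos_pos zero_less_norm_iff)

lemma ccw_angle_diff:
  assumes "z \<noteq> 0" "w \<noteq> 0" "y \<noteq> 0"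
  shows "ccw_angle w y = (if ccw_angle z w < ccw_angle z y then ccw_angle z y - ccw_angle z w
                          else ccw_angle z y - ccw_angle z w + 2 * pi)"
proof -
  obtain r where r: "0 < r" "w = of_real r * cis (ccw_angle z w) * z"
    using ccw_angle_polarE[OF assms(1,2)] .
  obtain q where q: "0 < q" "y = of_real q * cis (ccw_angle z y) * z"
    using ccw_angle_polarE[OF assms(1,3)] .
  have y: "y = of_real (q / r) * cis (ccw_angle z y - ccw_angle z w) * w"
  proof -
    have "of_real (q / r) * cis (ccw_angle z y - ccw_angle z w) * w =
        of_real (q / r) * cis (ccw_angle z y - ccw_angle z w) * (of_real r * cis (ccw_angle z w) * z)"
      using r(2) by simp
    also have "\<dots> = of_real q * cis (ccw_angle z y) * z"
      using r(1) by (simp add: cis_divide[symmetric])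
    finally show ?thesis using q(2) by simp
  qed
  have y': "y = of_real (q / r) * cis (ccw_angle z y - ccw_angle z w + 2 * pi) * w"
    using y by (simp add: cis_mult[symmetric])
  note b = ccw_angle_pos[of z w] ccw_angle_le[of z w] ccw_angle_pos[of z y] ccw_angle_le[of z y]
  show ?thesis
  proof (cases "ccw_angle z w < ccw_angle z y")
    case True
    have "ccw_angle w y = ccw_angle z y - ccw_angle z w"
      by (rule ccw_angle_eqI[OF assms(2) _ _ _ y]) (use True r q b in auto)
    then show ?thesis using True by simp
  next
    case False
    have "ccw_angle w y = ccw_angle z y - ccw_angle z w + 2 * pi"
      by (rule ccw_angle_eqI[OF assms(2) _ _ _ y']) (use False r q b in auto)
    then show ?thesis using False by simp
  qed
qed

lemma ccw_angle_self: "z \<noteq> 0 \<Longrightarrow> ccw_angle z z = 2 * pi"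
  by (rule ccw_angle_eqI[of z 1]) auto

lemma ccw_angle_swap:
  assumes "z \<noteq> 0" "w \<noteq> 0" "ccw_angle z w < 2 * pi"
  shows "ccw_angle w z = 2 * pi - ccw_angle z w"
  using ccw_angle_diff[OF assms(1,2,1)] assms by (simp add: ccw_angle_self)

text \<open>Reversing one of two directions shifts the angle between them by \<open>\<pi>\<close>, modulo \<open>2\<pi>\<close>. The two
edges of the reciprocal at a corner have the directions of a multiple of \<open>- z\<close> and a multiple of
\<open>w\<close>, where \<open>z\<close> and \<open>w\<close> are consecutive edges of the given framework, so every relation between
angles of the two drawings is an instance of this one.\<close>

lemma ccw_angle_scaled:
  assumes "z \<noteq> 0" "w \<noteq> 0" "a \<noteq> 0" "b \<noteq> 0"
  shows "ccw_angle (- (a *\<^sub>R z)) (b *\<^sub>R w) =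
    (if a * b < 0 then ccw_angle z w
     else if ccw_angle z w > pi then ccw_angle z w - pi else ccw_angle z w + pi)"
proof -
  define \<phi> where "\<phi> = ccw_angle z w"
  have b: "0 < \<phi>" "\<phi> \<le> 2 * pi" by (simp_all add: \<phi>_def ccw_angle_pos ccw_angle_le)
  obtain r where r: "0 < r" "w = of_real r * cis \<phi> * z"
    using ccw_angle_polarE[OF assms(1,2)] unfolding \<phi>_def .
  have nz: "- (a *\<^sub>R z) \<noteq> 0" using assms by simp
  have e1: "b *\<^sub>R w = of_real (- (b * r / a)) * cis \<phi> * (- (a *\<^sub>R z))"
    using assms by (simp add: r(2) scaleR_conv_of_real)
  have e2: "b *\<^sub>R w = of_real (b * r / a) * cis (\<phi> + pi) * (- (a *\<^sub>R z))"
    using assms by (simp add: r(2) scaleR_conv_of_real cis_mult[symmetric])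
  have e3: "b *\<^sub>R w = of_real (b * r / a) * cis (\<phi> - pi) * (- (a *\<^sub>R z))"
    using assms by (simp add: r(2) scaleR_conv_of_real cis_divide[symmetric])
  have neg: "a * b < 0 \<Longrightarrow> 0 < - (b * r / a)" using r(1)
    by (auto simp: mult_less_0_iff divide_less_0_iff)
  have pos: "\<not> a * b < 0 \<Longrightarrow> 0 < b * r / a" using r(1) assms(3,4)
    by (auto simp: mult_less_0_iff zero_less_divide_iff zero_less_mult_iff)
  consider "a * b < 0" | "\<not> a * b < 0" "\<phi> > pi" | "\<not> a * b < 0" "\<not> \<phi> > pi" by blast
  then have "ccw_angle (- (a *\<^sub>R z)) (b *\<^sub>R w) =
    (if a * b < 0 then \<phi> else if \<phi> > pi then \<phi> - pi else \<phi> + pi)"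
  proof cases
    case 1
    then show ?thesis using ccw_angle_eqI[OF nz neg _ _ e1] b by simp
  next
    case 2
    then show ?thesis using ccw_angle_eqI[OF nz pos _ _ e3] b by simp
  next
    case 3
    then show ?thesis using ccw_angle_eqI[OF nz pos _ _ e2] b by simp
  qed
  then show ?thesis by (simp add: \<phi>_def)
qed

section \<open>Straight-line drawings and the rotation at a vertex\<close>

text \<open>The part of \<^const>\<open>noncrossing\<close> that subgraphs inherit; deleting edges can create a vertex with
two flat angles. Subgraphs are the means of comparing faces below.\<close>

locale plane_drawing =
  fixes G :: "'v framework"
  assumes simple: "simple_graph G"
    and inj_pos: "inj_on (pos G) (verts G)"
    and edges_meet: "\<And>e f. e \<in> edges G \<Longrightarrow> f \<in> edges G \<Longrightarrow> e \<noteq> f \<Longrightarrow>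
          edge_segment G e \<inter> edge_segment G f \<subseteq> pos G ` (e \<inter> f)"
    and vertex_on_edge: "\<And>e v. e \<in> edges G \<Longrightarrow> v \<in> verts G \<Longrightarrow> pos G v \<in> edge_segment G e \<Longrightarrow> v \<in> e"

lemma noncrossing_imp_plane_drawing: "noncrossing G \<Longrightarrow> plane_drawing G"
  unfolding noncrossing_def by unfold_locales (blast+)

lemma edge_segment_pair: "edge_segment G {i, j} = closed_segment (pos G i) (pos G j)"
  by (simp add: edge_segment_def segment_convex_hull)

context plane_drawing begin

lemma finite_verts: "finite (verts G)"
  using simple by (simp add: simple_graph_def)

lemma edgeD:
  assumes "{i, j} \<in> edges G"
  shows "i \<in> verts G" "j \<in> verts G" "i \<noteq> j" "pos G i \<noteq> pos G j"
proof -
  have "{i, j} \<subseteq> verts G \<and> card {i, j} = 2" using simple assms by (auto simp: simple_graph_def)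
  then show a: "i \<in> verts G" "j \<in> verts G" "i \<noteq> j" by (auto simp: card_insert_if split: if_splits)
  then show "pos G i \<noteq> pos G j" using inj_pos by (auto simp: inj_on_def)
qed

lemma edgeE:
  assumes "e \<in> edges G" obtains i j where "e = {i, j}" "i \<noteq> j"
  using assms simple by (auto simp: simple_graph_def card_2_iff)

lemma finite_edges: "finite (edges G)"
proof (rule finite_subset)
  show "edges G \<subseteq> Pow (verts G)" using simple by (auto simp: simple_graph_def)
qed (simp add: finite_verts)

lemma neighbour_iff: "c \<in> neighbours G v \<longleftrightarrow> {v, c} \<in> edges G"
  by (simp add: neighbours_def)

lemma neighboursD:
  assumes "c \<in> neighbours G v"
  shows "{v, c} \<in> edges G" "{c, v} \<in> edges G" "v \<in> verts G" "c \<in> verts G" "c \<noteq> v" "pos G c - pos G v \<noteq> 0"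
  using assms edgeD[of v c] by (auto simp: neighbours_def insert_commute)

lemma finite_neighbours: "finite (neighbours G v)"
  by (rule finite_subset[OF _ finite_verts]) (auto dest: neighboursD)

text \<open>Otherwise the nearer of the two neighbours would lie on the edge to the farther one.\<close>

lemma distinct_directions:
  assumes "c \<in> neighbours G v" "d \<in> neighbours G v" "0 < r"
    and "pos G c - pos G v = of_real r * (pos G d - pos G v)"
  shows "c = d"
proof -
  have *: "c = d" if c: "c \<in> neighbours G v" and d: "d \<in> neighbours G v" and r: "0 < r" "r \<le> 1"
    and e: "pos G c - pos G v = of_real r * (pos G d - pos G v)" for c d r
  proof -
    have "pos G c = (1 - r) *\<^sub>R pos G v + r *\<^sub>R pos G d"
      using e by (simp add: scaleR_conv_of_real algebra_simps)
    then have "pos G c \<in> edge_segment G {v, d}"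
      unfolding edge_segment_pair in_segment using r by (intro exI[of _ r]) simp
    then have "c \<in> {v, d}" using vertex_on_edge neighboursD[OF d] neighboursD[OF c] by blast
    then show ?thesis using neighboursD[OF c] by auto
  qed
  show ?thesis
  proof (cases "r \<le> 1")
    case True
    then show ?thesis using * assms by blast
  next
    case False
    have "pos G d - pos G v = of_real (1 / r) * (pos G c - pos G v)"
      using assms(3,4) by simp
    then show ?thesis using *[OF assms(2,1), of "1 / r"] False by simp
  qed
qed

lemma ccw_angle_eq_imp_eq:
  assumes "a \<in> neighbours G v" "c \<in> neighbours G v" "d \<in> neighbours G v"
    and "angle_size G v (a, c) = angle_size G v (a, d)"
  shows "c = d"
proof -
  let ?u = "\<lambda>x. pos G x - pos G v"
  obtain r where r: "0 < r" "?u c = of_real r * cis (ccw_angle (?u a) (?u c)) * ?u a"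
    using ccw_angle_polarE neighboursD assms by metis
  obtain q where q: "0 < q" "?u d = of_real q * cis (ccw_angle (?u a) (?u d)) * ?u a"
    using ccw_angle_polarE neighboursD assms by metis
  have "?u c = of_real (r / q) * ?u d"
    apply (subst r(2), subst q(2))
    using assms(4) q(1) by (simp add: angle_size_def)
  then show ?thesis using distinct_directions[OF assms(2,3), of "r / q"] r q by simp
qed

text \<open>The neighbours are sorted by their angle from a fixed neighbour, which itself comes last, at angle
\<open>2\<pi>\<close>. The angle between successive neighbours is the difference of these values, and the sum
telescopes.\<close>

lemma rotation_list:
  assumes "neighbours G v \<noteq> {}"
  obtains cs where "distinct cs" "set cs = neighbours G v"
    "angles G v = (\<lambda>i. (cs ! i, cyc_next cs i)) ` {..<length cs}"
    "(\<Sum>i<length cs. angle_size G v (cs ! i, cyc_next cs i)) = 2 * pi"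
proof -
  define N where "N = neighbours G v"
  have finN: "finite N" by (simp add: N_def finite_neighbours)
  obtain c0 where c0: "c0 \<in> N" using assms N_def by blast
  define \<kappa> where "\<kappa> c = angle_size G v (c0, c)" for c
  have inj: "inj_on \<kappa> N"
    using ccw_angle_eq_imp_eq c0 unfolding \<kappa>_def N_def inj_on_def by blast
  have k: "0 < \<kappa> c" "\<kappa> c \<le> 2 * pi" for c
    by (simp_all add: \<kappa>_def angle_size_def ccw_angle_pos ccw_angle_le)
  have diff: "angle_size G v (a, b) = (if \<kappa> a < \<kappa> b then \<kappa> b - \<kappa> a else \<kappa> b - \<kappa> a + 2 * pi)"
    if "a \<in> N" "b \<in> N" for a b
    using ccw_angle_diff[of "pos G c0 - pos G v" "pos G a - pos G v" "pos G b - pos G v"]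
      neighboursD(6) that c0 unfolding N_def \<kappa>_def angle_size_def by simp
  define xs where "xs = sorted_list_of_set (\<kappa> ` N)"
  define cs where "cs = map (inv_into N \<kappa>) xs"
  define n where "n = length cs"
  have sxs: "set xs = \<kappa> ` N" "sorted xs" "distinct xs" using finN by (simp_all add: xs_def)
  have setcs: "set cs = N" by (simp add: cs_def sxs image_image inv_into_f_f[OF inj])
  have dcs: "distinct cs"
    unfolding cs_def distinct_map using sxs inj_on_inv_into[of "\<kappa> ` N" \<kappa> N] by simp
  have kcs: "\<kappa> (cs ! i) = xs ! i" if "i < n" for i
    using that sxs(1) by (simp add: cs_def n_def f_inv_into_f nth_mem flip: sxs(1))
  have sorted: "\<kappa> (cs ! i) < \<kappa> (cs ! j)" if "i < j" "j < n" for i j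
    using sorted_wrt_nth_less[of "(<)" xs i j] sxs that kcs
    by (simp add: strict_sorted_iff n_def cs_def)
  have n0: "n > 0" using setcs c0 by (auto simp: n_def)
  have inN: "cs ! i \<in> N" if "i < n" for i using that setcs by (auto simp: n_def)
  have nxt: "cyc_next cs i = (if i = n - 1 then cs ! 0 else cs ! Suc i)" if "i < n" for i
  proof (cases "i = n - 1")
    case True
    then have "Suc i = n" using n0 by simp
    then show ?thesis using True by (simp add: cyc_next_def flip: n_def)
  next
    case False
    then have "Suc i < n" using that by simp
    then show ?thesis using False by (simp add: cyc_next_def flip: n_def)
  qed
  have min: "angle_size G v (cs ! i, cyc_next cs i) \<le> angle_size G v (cs ! i, cs ! j)"
    if i: "i < n" and j: "j < n" for i j
  proof (cases "i = n - 1")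
    case True
    have a: "\<not> \<kappa> (cs ! i) < \<kappa> (cs ! m)" if "m < n" for m
    proof (cases "m = i")
      case False
      then have "m < i" using True that by linarith
      then show ?thesis using sorted[of m i] i by simp
    qed simp
    have "\<kappa> (cs ! 0) \<le> \<kappa> (cs ! j)" using sorted[of 0 j] j by (cases j) auto
    then show ?thesis using a[OF j] a[OF n0] True i j n0 inN by (simp add: nxt diff)
  next
    case False
    then have lt: "\<kappa> (cs ! i) < \<kappa> (cs ! Suc i)" and si: "Suc i < n" using sorted[of i "Suc i"] i by auto
    consider "j \<le> i" | "j = Suc i" | "Suc i < j" by linarith
    then show ?thesis
    proof cases
      case 1
      then have "\<kappa> (cs ! j) \<le> \<kappa> (cs ! i)" using sorted[of j i] i by (cases "j = i") auto
      then show ?thesis using False lt si i j k[of "cs ! j"] k[of "cs ! Suc i"] inN by (simp add: nxt diff)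
    next
      case 2
      then show ?thesis using False i by (simp add: nxt)
    next
      case 3
      then show ?thesis using False lt si i j sorted[of "Suc i" j] sorted[of i j] inN by (simp add: nxt diff)
    qed
  qed
  have nxt_in: "cyc_next cs i \<in> N" if "i < n" for i using inN n0 that by (auto simp: nxt)
  have ang: "angles G v = (\<lambda>i. (cs ! i, cyc_next cs i)) ` {..<n}"
  proof (intro set_eqI iffI)
    fix ab assume "ab \<in> angles G v"
    then obtain a b where ab: "ab = (a, b)" "a \<in> N" "b \<in> N"
      "\<forall>c\<in>N. angle_size G v (a, b) \<le> angle_size G v (a, c)"
      by (auto simp: angles_def N_def)
    obtain i where i: "i < n" "a = cs ! i" using ab(2) setcs by (metis in_set_conv_nth n_def)
    obtain j where j: "j < n" "b = cs ! j" using ab(3) setcs by (metis in_set_conv_nth n_def)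
    have "angle_size G v (a, b) = angle_size G v (a, cyc_next cs i)"
      using min[OF i(1) j(1)] ab nxt_in[OF i(1)] i j by (metis antisym)
    then have "b = cyc_next cs i" using ccw_angle_eq_imp_eq ab(2,3) nxt_in[OF i(1)] unfolding N_def by blast
    then show "ab \<in> (\<lambda>i. (cs ! i, cyc_next cs i)) ` {..<n}" using ab i by auto
  next
    fix ab assume "ab \<in> (\<lambda>i. (cs ! i, cyc_next cs i)) ` {..<n}"
    then obtain i where i: "i < n" "ab = (cs ! i, cyc_next cs i)" by auto
    have "angle_size G v (cs ! i, cyc_next cs i) \<le> angle_size G v (cs ! i, c)" if "c \<in> N" for c
      using min[OF i(1)] that setcs by (metis in_set_conv_nth n_def)
    then show "ab \<in> angles G v" using i inN nxt_in by (auto simp: angles_def N_def)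
  qed
  obtain m where m: "n = Suc m" using n0 gr0_implies_Suc by blast
  have "(\<Sum>i<n. angle_size G v (cs ! i, cyc_next cs i)) =
     (\<Sum>i<m. angle_size G v (cs ! i, cyc_next cs i)) + angle_size G v (cs ! m, cyc_next cs m)"
    by (simp add: m)
  also have "(\<Sum>i<m. angle_size G v (cs ! i, cyc_next cs i)) = (\<Sum>i<m. \<kappa> (cs ! Suc i) - \<kappa> (cs ! i))"
    by (rule sum.cong) (use sorted inN in \<open>auto simp: m nxt diff\<close>)
  also have "\<dots> = \<kappa> (cs ! m) - \<kappa> (cs ! 0)" by (rule sum_lessThan_telescope)
  also have "angle_size G v (cs ! m, cyc_next cs m) = \<kappa> (cs ! 0) - \<kappa> (cs ! m) + 2 * pi"
    using sorted[of 0 m] inN by (cases "m = 0") (auto simp: m nxt diff)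
  finally have "(\<Sum>i<n. angle_size G v (cs ! i, cyc_next cs i)) = 2 * pi" by simp
  then show thesis using that[of cs] dcs setcs ang by (simp add: n_def N_def)
qed

end

section \<open>Faces beside edges and angles\<close>

text \<open>Coordinates in which the edge from \<open>a\<close> to \<open>b\<close> is the segment from \<open>(0, 0)\<close> to \<open>(1, 0)\<close>; the points
with positive second coordinate are those to its left.\<close>

definition edge_coord :: "complex \<Rightarrow> complex \<Rightarrow> real \<Rightarrow> real \<Rightarrow> complex" where
  "edge_coord a b s t = a + Complex s t * (b - a)"

lemma edge_coord_eq_iff:
  "a \<noteq> b \<Longrightarrow> edge_coord a b s t = edge_coord a b s' t' \<longleftrightarrow> s = s' \<and> t = t'"
  by (auto simp: edge_coord_def)

lemma edge_coord_swap: "edge_coord b a s t = edge_coord a b (1 - s) (- t)"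
proof -
  have "Complex (1 - s) (- t) = 1 - Complex s t" by (simp add: complex_eq_iff)
  then show ?thesis unfolding edge_coord_def by (simp only:) (simp add: algebra_simps)
qed

lemma edge_coord_0: "edge_coord a b s 0 = (1 - s) *\<^sub>R a + s *\<^sub>R b"
proof -
  have "Complex s 0 = of_real s" by (simp add: complex_eq_iff)
  then show ?thesis by (simp add: edge_coord_def scaleR_conv_of_real algebra_simps)
qed

lemma closed_segment_edge_coord: "closed_segment a b = (\<lambda>s. edge_coord a b s 0) ` {0..1}"
  unfolding edge_coord_0 by (auto simp: in_segment)

lemma on_left_edge_coord: "on_left a b F \<longleftrightarrow> (\<forall>\<^sub>F t in at_right 0. edge_coord a b (1/2) t \<in> F)"
proof -
  have "edge_coord a b (1/2) t = midpoint a b + of_real t * \<i> * (b - a)" for t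
    by (simp add: edge_coord_def midpoint_def complex_eq_iff algebra_simps)
  then show ?thesis by (simp add: on_left_def)
qed

lemma edge_coord_exists:
  assumes "a \<noteq> b" obtains s t where "z = edge_coord a b s t"
proof -
  define q where "q = (z - a) / (b - a)"
  have "Complex (Re q) (Im q) * (b - a) = z - a" using assms by (simp add: q_def)
  then show thesis using that[of "Re q" "Im q"] by (simp add: edge_coord_def)
qed

lemma edge_coord_diff: "edge_coord a b s t - edge_coord a b s' t' = Complex (s - s') (t - t') * (b - a)"
  by (simp add: edge_coord_def complex_eq_iff algebra_simps)

lemma continuous_on_edge_coord:
  "continuous_on UNIV (\<lambda>z. edge_coord a b (fst z) (snd z))"
  unfolding edge_coord_def Complex_eq by (intro continuous_intros)

lemma edge_coord_box_connected:
  assumes "connected A" "connected B"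
  shows "connected ((\<lambda>z. edge_coord a b (fst z) (snd z)) ` (A \<times> B))"
  by (intro connected_continuous_image continuous_on_subset[OF continuous_on_edge_coord]
      connected_Times assms subset_UNIV)


context plane_drawing begin

lemma drawing_compact: "compact (drawing G)"
proof -
  have "compact (edge_segment G e)" if "e \<in> edges G" for e
    using that by (auto elim!: edgeE simp: edge_segment_pair)
  then have "compact (\<Union>e\<in>edges G. edge_segment G e)" using finite_edges by blast
  moreover have "compact (pos G ` verts G)" by (simp add: finite_imp_compact finite_verts)
  ultimately show ?thesis unfolding drawing_def by (rule compact_Un[rotated])
qed

lemma edge_segment_closed: "e \<in> edges G \<Longrightarrow> closed (edge_segment G e)"
  by (auto elim!: edgeE simp: edge_segment_pair)

lemma edge_segment_subset: "e \<in> edges G \<Longrightarrow> edge_segment G e \<subseteq> drawing G"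
  by (auto simp: drawing_def)

lemma face_open: "F \<in> faces G \<Longrightarrow> open F"
  unfolding faces_def using open_components compact_imp_closed[OF drawing_compact] by blast

lemma face_disjoint: "F \<in> faces G \<Longrightarrow> F \<inter> drawing G = {}"
  unfolding faces_def using in_components_subset by blast

lemma face_connected: "F \<in> faces G \<Longrightarrow> connected F"
  unfolding faces_def by (rule in_components_connected)

lemma face_nonempty: "F \<in> faces G \<Longrightarrow> F \<noteq> {}"
  unfolding faces_def by (rule in_components_nonempty)

lemma face_superset:
  assumes "connected T" "T \<inter> drawing G = {}" "T \<noteq> {}"
  obtains F where "F \<in> faces G" "T \<subseteq> F"
  using exists_component_superset[of T "- drawing G"] assms unfolding faces_def by blast

lemma faces_eq: "F \<in> faces G \<Longrightarrow> F' \<in> faces G \<Longrightarrow> F \<inter> F' \<noteq> {} \<Longrightarrow> F = F'"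
  unfolding faces_def using components_eq by blast

lemma edge_meets_rest:
  assumes e: "{i, j} \<in> edges G"
  shows "edge_segment G {i, j} \<inter> (pos G ` verts G \<union> (\<Union>f\<in>edges G - {{i, j}}. edge_segment G f))
    \<subseteq> {pos G i, pos G j}"
proof
  fix x assume x: "x \<in> edge_segment G {i, j} \<inter> (pos G ` verts G \<union> (\<Union>f\<in>edges G - {{i, j}}. edge_segment G f))"
  show "x \<in> {pos G i, pos G j}"
  proof (cases "x \<in> pos G ` verts G")
    case True
    then show ?thesis using vertex_on_edge[OF e] x by auto
  next
    case False
    then obtain f where "f \<in> edges G" "f \<noteq> {i, j}" "x \<in> edge_segment G f" using x by auto
    then have "x \<in> pos G ` ({i, j} \<inter> f)" using edges_meet[OF e, of f] x by blast
    then show ?thesis by auto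
  qed
qed

text \<open>A compact part of the open edge has a positive distance from the rest of the drawing.\<close>

lemma edge_strip:
  assumes e: "{i, j} \<in> edges G" and s: "0 < s1" "s1 \<le> s2" "s2 < 1"
  obtains \<epsilon> where "0 < \<epsilon>"
    "\<And>s t. s1 \<le> s \<Longrightarrow> s \<le> s2 \<Longrightarrow> \<bar>t\<bar> < \<epsilon> \<Longrightarrow> t \<noteq> 0 \<Longrightarrow> edge_coord (pos G i) (pos G j) s t \<notin> drawing G"
    "\<And>s t. s1 \<le> s \<Longrightarrow> s \<le> s2 \<Longrightarrow> \<bar>t\<bar> < \<epsilon> \<Longrightarrow>
       edge_coord (pos G i) (pos G j) s t \<notin> pos G ` verts G \<union> (\<Union>f\<in>edges G - {{i, j}}. edge_segment G f)"
proof -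
  let ?a = "pos G i" and ?b = "pos G j"
  let ?Q = "edge_coord ?a ?b"
  define K where "K = (\<lambda>s. ?Q s 0) ` {s1..s2}"
  define rest where "rest = pos G ` verts G \<union> (\<Union>f\<in>edges G - {{i, j}}. edge_segment G f)"
  have ab: "?a \<noteq> ?b" using edgeD[OF e] by simp
  have K: "compact K" unfolding K_def edge_coord_0
    by (rule compact_continuous_image) (auto intro!: continuous_intros)
  have rest: "closed rest" unfolding rest_def
    by (intro closed_Un finite_imp_closed closed_UN) (auto simp: finite_verts finite_edges edge_segment_closed)
  have Kseg: "K \<subseteq> edge_segment G {i, j}"
    using s unfolding K_def edge_segment_pair closed_segment_edge_coord by force
  have Kends: "?a \<notin> K" "?b \<notin> K"
  proof -
    have "?Q u 0 \<notin> K" if "u \<le> 0 \<or> 1 \<le> u" for u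
      using that s edge_coord_eq_iff[OF ab] by (auto simp: K_def)
    from this[of 0] this[of 1] show "?a \<notin> K" "?b \<notin> K" by (simp_all add: edge_coord_0)
  qed
  have disj: "K \<inter> rest = {}"
  proof -
    have "K \<inter> rest \<subseteq> {?a, ?b}"
      using Int_mono[OF Kseg order_refl[of rest]] edge_meets_rest[OF e] unfolding rest_def by (rule order_trans)
    then show ?thesis using Kends by blast
  qed
  obtain d where d: "0 < d" "\<And>x y. x \<in> K \<Longrightarrow> y \<in> rest \<Longrightarrow> d \<le> dist x y"
    using separate_compact_closed[OF K rest disj] by auto
  define \<epsilon> where "\<epsilon> = d / norm (?b - ?a)"
  have e0: "\<epsilon> > 0" using d ab by (simp add: \<epsilon>_def)
  have away: "?Q s t \<notin> rest" if "s1 \<le> s" "s \<le> s2" "\<bar>t\<bar> < \<epsilon>" for s t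
  proof
    assume "?Q s t \<in> rest"
    moreover have "?Q s 0 \<in> K" using that by (auto simp: K_def)
    ultimately have "d \<le> dist (?Q s 0) (?Q s t)" using d by blast
    also have "\<dots> = norm (Complex 0 t * (?b - ?a))"
      by (metis diff_self diff_zero dist_commute dist_norm edge_coord_diff)
    also have "\<dots> = \<bar>t\<bar> * norm (?b - ?a)" by (simp add: norm_mult complex_norm)
    also have "\<dots> < d" using that ab by (simp add: \<epsilon>_def pos_less_divide_eq)
    finally show False by simp
  qed
  moreover have "?Q s t \<notin> drawing G" if "s1 \<le> s" "s \<le> s2" "\<bar>t\<bar> < \<epsilon>" "t \<noteq> 0" for s t
  proof -
    have "?Q s t \<notin> edge_segment G {i, j}"
      unfolding edge_segment_pair closed_segment_edge_coord using edge_coord_eq_iff[OF ab] that by auto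
    then show ?thesis using away[OF that(1-3)] unfolding drawing_def rest_def by auto
  qed
  ultimately show thesis using that e0 rest_def by blast
qed

text \<open>One face lies to the left of the edge along its whole length: a compact part of the open edge can
be enlarged to contain the midpoint, and the strip above it is connected.\<close>

lemma left_face_strip:
  assumes e: "{i, j} \<in> edges G"
  shows "\<exists>F\<in>faces G. \<forall>s1 s2. 0 < s1 \<and> s1 \<le> s2 \<and> s2 < 1 \<longrightarrow>
       (\<exists>\<epsilon>>0. \<forall>s\<in>{s1..s2}. \<forall>t. 0 < t \<and> t < \<epsilon> \<longrightarrow> edge_coord (pos G i) (pos G j) s t \<in> F)"
proof -
  let ?Q = "edge_coord (pos G i) (pos G j)"
  have box: "\<exists>F\<in>faces G. \<exists>\<epsilon>>0. \<forall>s\<in>{s1..s2}. \<forall>t. 0 < t \<and> t < \<epsilon> \<longrightarrow> ?Q s t \<in> F"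
    if s: "0 < s1" "s1 \<le> s2" "s2 < 1" for s1 s2
  proof -
    obtain \<epsilon> where \<epsilon>: "0 < \<epsilon>"
      "\<And>s t. s1 \<le> s \<Longrightarrow> s \<le> s2 \<Longrightarrow> \<bar>t\<bar> < \<epsilon> \<Longrightarrow> t \<noteq> 0 \<Longrightarrow> ?Q s t \<notin> drawing G"
      using edge_strip[OF e s] by metis
    define T where "T = (\<lambda>z. ?Q (fst z) (snd z)) ` ({s1..s2} \<times> {0<..<\<epsilon>})"
    have T: "connected T" unfolding T_def by (intro edge_coord_box_connected) auto
    moreover have "T \<inter> drawing G = {}" unfolding T_def using \<epsilon>(2) by force
    moreover have "T \<noteq> {}" unfolding T_def using \<epsilon>(1) s by simp
    ultimately obtain F where F: "F \<in> faces G" "T \<subseteq> F" by (rule face_superset)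
    have "?Q s t \<in> T" if "s \<in> {s1..s2}" "0 < t" "t < \<epsilon>" for s t
      unfolding T_def using that by (intro image_eqI[of _ _ "(s, t)"]) auto
    then show ?thesis using F \<epsilon>(1) by blast
  qed
  obtain F \<epsilon> where F: "F \<in> faces G" "0 < \<epsilon>" "\<And>t. 0 < t \<Longrightarrow> t < \<epsilon> \<Longrightarrow> ?Q (1/2) t \<in> F"
    using box[of "1/2" "1/2"] by auto
  show ?thesis
  proof (intro bexI[OF _ F(1)] allI impI)
    fix s1 s2 :: real assume s: "0 < s1 \<and> s1 \<le> s2 \<and> s2 < 1"
    have "0 < min s1 (1/2)" "min s1 (1/2) \<le> max s2 (1/2)" "max s2 (1/2) < 1" using s by auto
    then obtain F' \<epsilon>' where F': "F' \<in> faces G" "0 < \<epsilon>'"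
      "\<forall>s\<in>{min s1 (1/2)..max s2 (1/2)}. \<forall>t. 0 < t \<and> t < \<epsilon>' \<longrightarrow> ?Q s t \<in> F'"
      using box by blast
    have "?Q (1/2) (min \<epsilon> \<epsilon>' / 2) \<in> F" "?Q (1/2) (min \<epsilon> \<epsilon>' / 2) \<in> F'" using F(2,3) F'(2,3) by auto
    then have "F = F'" using faces_eq F(1) F'(1) by blast
    then show "\<exists>\<epsilon>>0. \<forall>s\<in>{s1..s2}. \<forall>t. 0 < t \<and> t < \<epsilon> \<longrightarrow> ?Q s t \<in> F"
    proof -
      have "{s1..s2} \<subseteq> {min s1 (1/2)..max s2 (1/2)}" by auto
      then show ?thesis using F'(2,3) \<open>F = F'\<close> by blast
    qed
  qed
qed

lemma left_face_unique:
  assumes "left_face G i j F" "left_face G i j F'" shows "F = F'"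
proof -
  have "\<forall>\<^sub>F t in at_right 0. edge_coord (pos G i) (pos G j) (1/2) t \<in> F \<and> edge_coord (pos G i) (pos G j) (1/2) t \<in> F'"
    using assms unfolding left_face_def on_left_edge_coord by (auto intro: eventually_conj)
  then obtain \<epsilon> where "0 < \<epsilon>" "\<And>t. 0 < t \<Longrightarrow> t < \<epsilon> \<Longrightarrow>
    edge_coord (pos G i) (pos G j) (1/2) t \<in> F \<and> edge_coord (pos G i) (pos G j) (1/2) t \<in> F'"
    unfolding eventually_at_right_field by auto
  then have "F \<inter> F' \<noteq> {}" using dense[of 0 \<epsilon>] by blast
  then show ?thesis using faces_eq assms by (auto simp: left_face_def)
qed

definition lface :: "'v \<Rightarrow> 'v \<Rightarrow> complex set" where
  "lface i j = (THE F. left_face G i j F)"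

lemma lface_props:
  assumes e: "{i, j} \<in> edges G"
  shows left_face_lface: "left_face G i j (lface i j)"
    and lface_strip: "\<And>s1 s2. 0 < s1 \<Longrightarrow> s1 \<le> s2 \<Longrightarrow> s2 < 1 \<Longrightarrow>
       \<exists>\<epsilon>>0. \<forall>s\<in>{s1..s2}. \<forall>t. 0 < t \<and> t < \<epsilon> \<longrightarrow> edge_coord (pos G i) (pos G j) s t \<in> lface i j"
proof -
  obtain F where F: "F \<in> faces G" "\<forall>s1 s2. 0 < s1 \<and> s1 \<le> s2 \<and> s2 < 1 \<longrightarrow>
       (\<exists>\<epsilon>>0. \<forall>s\<in>{s1..s2}. \<forall>t. 0 < t \<and> t < \<epsilon> \<longrightarrow> edge_coord (pos G i) (pos G j) s t \<in> F)"
    using left_face_strip[OF e] by (rule bexE)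
  have "\<exists>\<epsilon>>0. \<forall>s\<in>{1/2..1/2}. \<forall>t. 0 < t \<and> t < \<epsilon> \<longrightarrow> edge_coord (pos G i) (pos G j) s t \<in> F"
    using F(2)[rule_format, of "1/2" "1/2"] by simp
  then have "on_left (pos G i) (pos G j) F"
    unfolding on_left_edge_coord eventually_at_right_field by auto
  then have l: "left_face G i j F" using e F by (simp add: left_face_def)
  then have L: "lface i j = F" unfolding lface_def     using the_equality[of "left_face G i j" F] l left_face_unique by blast
  show "left_face G i j (lface i j)"
    "\<And>s1 s2. 0 < s1 \<Longrightarrow> s1 \<le> s2 \<Longrightarrow> s2 < 1 \<Longrightarrow>
       \<exists>\<epsilon>>0. \<forall>s\<in>{s1..s2}. \<forall>t. 0 < t \<and> t < \<epsilon> \<longrightarrow> edge_coord (pos G i) (pos G j) s t \<in> lface i j"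
    unfolding L using l F(2) by blast+
qed

lemma left_face_iff: "left_face G i j F \<longleftrightarrow> {i, j} \<in> edges G \<and> F = lface i j"
proof
  assume l: "left_face G i j F"
  then have "{i, j} \<in> edges G" by (simp add: left_face_def)
  then show "{i, j} \<in> edges G \<and> F = lface i j" using left_face_unique[OF l left_face_lface] by blast
qed (use left_face_lface in blast)

lemma lface_in_faces: "{i, j} \<in> edges G \<Longrightarrow> lface i j \<in> faces G"
  using left_face_lface by (auto simp: left_face_def)

text \<open>Near an interior point of an edge there are only the edge and the two faces beside it. This reduces
questions about the frontier of a face to questions about single edges.\<close>

lemma edge_neighbourhood:
  assumes e: "{i, j} \<in> edges G" and s: "0 < s" "s < 1"
  obtains r where "0 < r"
    "ball (edge_coord (pos G i) (pos G j) s 0) r - edge_segment G {i, j} \<subseteq> lface i j \<union> lface j i"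
    "ball (edge_coord (pos G i) (pos G j) s 0) r \<inter> drawing G \<subseteq> edge_segment G {i, j}"
    "ball (edge_coord (pos G i) (pos G j) s 0) r \<inter> (pos G ` verts G \<union> (\<Union>f\<in>edges G - {{i, j}}. edge_segment G f)) = {}"
proof -
  let ?a = "pos G i" and ?b = "pos G j"
  let ?Q = "edge_coord ?a ?b"
  have ab: "?a \<noteq> ?b" using edgeD[OF e] by simp
  \<comment> \<open>any compact part of the open edge with \<open>s\<close> in its interior will do\<close>
  define s1 s2 where "s1 = s / 2" and "s2 = (s + 1) / 2"
  have s12: "0 < s1" "s1 \<le> s2" "s2 < 1" "s1 < s" "s < s2" using s by (auto simp: s1_def s2_def)
  have e': "{j, i} \<in> edges G" using e by (simp add: insert_commute)
  obtain \<epsilon>1 where \<epsilon>1: "0 < \<epsilon>1" "\<And>u t. u \<in> {s1..s2} \<Longrightarrow> 0 < t \<Longrightarrow> t < \<epsilon>1 \<Longrightarrow> ?Q u t \<in> lface i j"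
    using lface_strip[OF e s12(1-3)] by blast
  obtain \<epsilon>2 where \<epsilon>2: "0 < \<epsilon>2"
    "\<And>u t. u \<in> {1 - s2..1 - s1} \<Longrightarrow> 0 < t \<Longrightarrow> t < \<epsilon>2 \<Longrightarrow> edge_coord ?b ?a u t \<in> lface j i"
    using lface_strip[OF e', of "1 - s2" "1 - s1"] s12 by auto
  obtain \<epsilon>3 where \<epsilon>3: "0 < \<epsilon>3"
    "\<And>u t. s1 \<le> u \<Longrightarrow> u \<le> s2 \<Longrightarrow> \<bar>t\<bar> < \<epsilon>3 \<Longrightarrow>
       ?Q u t \<notin> pos G ` verts G \<union> (\<Union>f\<in>edges G - {{i, j}}. edge_segment G f)"
    using edge_strip[OF e s12(1-3)] by metis
  define \<epsilon> where "\<epsilon> = Min {\<epsilon>1, \<epsilon>2, \<epsilon>3, s - s1, s2 - s}"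
  have \<epsilon>: "0 < \<epsilon>" "\<epsilon> \<le> \<epsilon>1" "\<epsilon> \<le> \<epsilon>2" "\<epsilon> \<le> \<epsilon>3" "\<epsilon> \<le> s - s1" "\<epsilon> \<le> s2 - s"
  proof -
    have "\<epsilon> \<in> {\<epsilon>1, \<epsilon>2, \<epsilon>3, s - s1, s2 - s}" unfolding \<epsilon>_def by (rule Min_in) simp_all
    then show "0 < \<epsilon>" using \<epsilon>1(1) \<epsilon>2(1) \<epsilon>3(1) s12(4,5) by auto
    have "\<epsilon> \<le> x" if "x \<in> {\<epsilon>1, \<epsilon>2, \<epsilon>3, s - s1, s2 - s}" for x
      unfolding \<epsilon>_def by (rule Min_le[OF _ that]) simp
    then show "\<epsilon> \<le> \<epsilon>1" "\<epsilon> \<le> \<epsilon>2" "\<epsilon> \<le> \<epsilon>3" "\<epsilon> \<le> s - s1" "\<epsilon> \<le> s2 - s" by simp_all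
  qed
  define r where "r = \<epsilon> * norm (?b - ?a)"
  have near: "s1 \<le> u \<and> u \<le> s2 \<and> \<bar>t\<bar> < \<epsilon>" if "?Q u t \<in> ball (?Q s 0) r" for u t
  proof -
    have "norm (Complex (u - s) (t - 0)) * norm (?b - ?a) < \<epsilon> * norm (?b - ?a)"
      using that unfolding mem_ball dist_norm r_def norm_minus_commute[of "?Q s 0"]
      by (simp only: edge_coord_diff norm_mult)
    then have "norm (Complex (u - s) t) < \<epsilon>" using ab by simp
    then have "\<bar>u - s\<bar> < \<epsilon>" "\<bar>t\<bar> < \<epsilon>"
      using abs_Re_le_cmod[of "Complex (u - s) t"] abs_Im_le_cmod[of "Complex (u - s) t"] by auto
    then show ?thesis using \<epsilon> by auto
  qed
  have off: "y \<notin> pos G ` verts G \<union> (\<Union>f\<in>edges G - {{i, j}}. edge_segment G f)" if "y \<in> ball (?Q s 0) r" for y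
  proof -
    obtain u t where y: "y = ?Q u t" using edge_coord_exists[OF ab] .
    have "s1 \<le> u" "u \<le> s2" "\<bar>t\<bar> < \<epsilon>" using near[of u t] that unfolding y by blast+
    then have "\<bar>t\<bar> < \<epsilon>3" using \<epsilon>(4) by simp
    then show ?thesis unfolding y using \<epsilon>3(2) \<open>s1 \<le> u\<close> \<open>u \<le> s2\<close> by blast
  qed
  show thesis
  proof (rule that[of r])
    show "r > 0" using \<epsilon> ab by (simp add: r_def)
    show "ball (?Q s 0) r \<inter> (pos G ` verts G \<union> (\<Union>f\<in>edges G - {{i, j}}. edge_segment G f)) = {}"
      using off by blast
    then show "ball (?Q s 0) r \<inter> drawing G \<subseteq> edge_segment G {i, j}"
      unfolding drawing_def by blast
    show "ball (?Q s 0) r - edge_segment G {i, j} \<subseteq> lface i j \<union> lface j i"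
    proof
      fix y assume y: "y \<in> ball (?Q s 0) r - edge_segment G {i, j}"
      obtain u t where yy: "y = ?Q u t" using edge_coord_exists[OF ab] .
      have n: "s1 \<le> u" "u \<le> s2" "\<bar>t\<bar> < \<epsilon>" using near y yy by auto
      have "t \<noteq> 0" using y n s12 unfolding yy edge_segment_pair closed_segment_edge_coord by force
      then consider "t > 0" | "t < 0" by linarith
      then show "y \<in> lface i j \<union> lface j i"
      proof cases
        case 1
        then show ?thesis using \<epsilon>1(2)[of u t] n \<epsilon> yy by auto
      next
        case 2
        then show ?thesis using \<epsilon>2(2)[of "1 - u" "- t"] n \<epsilon> unfolding yy edge_coord_swap[of ?b ?a] by auto
      qed
    qed
  qed
qed

lemma edge_in_closure_lface:
  assumes e: "{i, j} \<in> edges G"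
  shows "edge_segment G {i, j} \<subseteq> closure (lface i j)"
proof -
  let ?Q = "edge_coord (pos G i) (pos G j)"
  have ab: "pos G i \<noteq> pos G j" using edgeD[OF e] by simp
  have "?Q s 0 \<in> closure (lface i j)" if s: "0 < s" "s < 1" for s
  proof -
    obtain \<epsilon> where \<epsilon>: "0 < \<epsilon>" "\<And>t. 0 < t \<Longrightarrow> t < \<epsilon> \<Longrightarrow> ?Q s t \<in> lface i j"
      using lface_strip[OF e, of s s] s by auto
    have lim: "((\<lambda>t. ?Q s t) \<longlongrightarrow> ?Q s 0) (at_right 0)"
    proof -
      have "((\<lambda>t. Complex s t) \<longlongrightarrow> Complex s 0) (at_right 0)"
        by (intro tendsto_Complex tendsto_const tendsto_ident_at)
      then show ?thesis unfolding edge_coord_def by (intro tendsto_add tendsto_mult tendsto_const)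
    qed
    have "\<forall>\<^sub>F t in at_right 0. ?Q s t \<in> closure (lface i j)"
      unfolding eventually_at_right_field
    proof (intro exI conjI allI impI)
      show "?Q s t \<in> closure (lface i j)" if "0 < t" "t < \<epsilon>" for t
        using \<epsilon>(2)[OF that] closure_subset[of "lface i j"] by (rule rev_subsetD)
    qed (rule \<epsilon>(1))
    then show ?thesis by (rule Lim_in_closed_set[OF closed_closure _ _ lim]) simp
  qed
  then have "open_segment (pos G i) (pos G j) \<subseteq> closure (lface i j)"
    unfolding edge_coord_0 by (auto simp: in_segment)
  then have "closure (open_segment (pos G i) (pos G j)) \<subseteq> closure (lface i j)"
    by (rule closure_minimal) simp
  then show ?thesis using ab by (simp add: edge_segment_pair)
qed

lemma face_meets_edge:
  assumes e: "{i, j} \<in> edges G" and s: "0 < s" "s < 1" and F: "F \<in> faces G"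
    and x: "edge_coord (pos G i) (pos G j) s 0 \<in> closure F"
  shows "F = lface i j \<or> F = lface j i"
proof -
  obtain r where r: "0 < r"
    "ball (edge_coord (pos G i) (pos G j) s 0) r - edge_segment G {i, j} \<subseteq> lface i j \<union> lface j i"
    using edge_neighbourhood[OF e s] by metis
  have "ball (edge_coord (pos G i) (pos G j) s 0) r \<inter> F \<noteq> {}"
    using x r(1) centre_in_ball open_Int_closure_eq_empty[OF open_ball, of _ r F] by blast
  then obtain y where y: "y \<in> ball (edge_coord (pos G i) (pos G j) s 0) r" "y \<in> F" by auto
  have "y \<notin> edge_segment G {i, j}" using y(2) face_disjoint[OF F] edge_segment_subset[OF e] by blast
  then have "y \<in> lface i j \<union> lface j i" using r y by auto
  moreover have "lface i j \<in> faces G" "lface j i \<in> faces G"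
    using lface_in_faces e by (auto simp: insert_commute)
  ultimately show ?thesis using faces_eq[OF F] y(2) by blast
qed

text \<open>The frontier of \<open>F\<close> consists of points of \<open>P\<close> and of vertices. A component \<open>C\<close> of the complement of
\<open>P\<close> stays connected if finitely many points are removed, so \<open>F\<close> is the component containing it up
to vertices. A vertex inside \<open>C\<close> is impossible, because it would bring a piece of an edge with it.\<close>

lemma face_is_component:
  assumes F: "F \<in> faces G" and P: "P \<subseteq> drawing G" "closed P"
    and darts: "\<And>i j. {i, j} \<in> edges G \<Longrightarrow> lface i j = F \<Longrightarrow> edge_segment G {i, j} \<subseteq> P"
    and nbr: "\<And>w. w \<in> verts G \<Longrightarrow> neighbours G w \<noteq> {}"
  shows "F \<in> components (- P)"
proof -
  have FP: "F \<subseteq> - P" using face_disjoint[OF F] P by blast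
  have "- P \<noteq> {}" using FP face_nonempty[OF F] by blast
  then obtain C where C: "C \<in> components (- P)" "F \<subseteq> C"
    using exists_component_superset[OF FP _ face_connected[OF F]] by blast
  have Copen: "open C" by (rule open_components[OF _ C(1)]) (simp add: P(2) open_Compl)
  define Z where "Z = pos G ` verts G"
  have finZ: "finite Z" by (simp add: Z_def finite_verts)
  have CZ: "connected (C - Z)"
    by (rule connected_open_delete_finite[OF Copen in_components_connected[OF C(1)] _ finZ]) simp
  have CP: "C \<inter> P = {}" using in_components_subset[OF C(1)] by blast
  have edge_cl: "F = lface i j \<or> F = lface j i" if e: "{i, j} \<in> edges G" and x: "x \<in> edge_segment G {i, j}"
      "x \<notin> Z" "x \<in> closure F" for i j x
  proof -
    obtain s where s: "x = edge_coord (pos G i) (pos G j) s 0" "0 \<le> s" "s \<le> 1"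
      using x(1) unfolding edge_segment_pair closed_segment_edge_coord by auto
    have "pos G i \<in> Z" "pos G j \<in> Z" using edgeD[OF e] by (simp_all add: Z_def)
    then have "s \<noteq> 0" "s \<noteq> 1" using x(2) s(1) by (metis edge_coord_0 add.right_neutral add_0 diff_self diff_zero scaleR_one scaleR_zero_left)+
    then have "0 < s" "s < 1" using s by auto
    then show ?thesis using face_meets_edge[OF e _ _ F] s(1) x(3) by blast
  qed
  have fr: "closure F \<inter> (C - Z) \<subseteq> F"
  proof
    fix x assume x: "x \<in> closure F \<inter> (C - Z)"
    show "x \<in> F"
    proof (cases "x \<in> drawing G")
      case True
      then obtain e where e: "e \<in> edges G" "x \<in> edge_segment G e" using x by (auto simp: drawing_def Z_def)
      then obtain i j where ij: "e = {i, j}" by (auto elim: edgeE)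
      have ij': "{j, i} = e" using ij by (simp add: insert_commute)
      have "F = lface i j \<or> F = lface j i" using edge_cl[of i j x] e x ij by blast
      then have "edge_segment G e \<subseteq> P"
        using e(1) darts[of i j] darts[of j i] unfolding ij' ij[symmetric] by blast
      then show ?thesis using x e CP by blast
    next
      case False
      obtain F' where F': "F' \<in> faces G" "{x} \<subseteq> F'" using face_superset[of "{x}"] False by auto
      then have "F' \<inter> F \<noteq> {}" using x open_Int_closure_eq_empty[OF face_open[OF F'(1)]] by blast
      then show ?thesis using F' faces_eq[OF F'(1) F] by blast
    qed
  qed
  have FC: "F \<subseteq> C - Z" using C(2) face_disjoint[OF F] by (auto simp: Z_def drawing_def)
  have "openin (top_of_set (C - Z)) F" using FC face_open[OF F] by (meson open_subset)
  moreover have "closedin (top_of_set (C - Z)) F"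
    unfolding closedin_closed using fr FC closure_subset[of F] by (intro exI[of _ "closure F"]) blast
  ultimately have FCZ: "F = C - Z"
    using CZ face_nonempty[OF F] unfolding connected_clopen by blast
  have "C \<inter> Z = {}"
  proof (rule equals0I)
    fix z assume z: "z \<in> C \<inter> Z"
    then obtain w where w: "w \<in> verts G" "z = pos G w" by (auto simp: Z_def)
    then obtain c where "c \<in> neighbours G w" using nbr by blast
    then have e: "{w, c} \<in> edges G" by (simp add: neighbour_iff)
    obtain r where r: "r > 0" "ball z r \<subseteq> C" using Copen z by (meson IntD1 open_contains_ball)
    let ?I = "open_segment (pos G w) (pos G c) \<inter> ball z r"
    have "pos G w \<in> closure (open_segment (pos G w) (pos G c))" using edgeD[OF e] by simp
    moreover have "pos G w \<notin> open_segment (pos G w) (pos G c)" by (simp add: open_segment_def)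
    ultimately have "pos G w islimpt open_segment (pos G w) (pos G c)" by (simp add: closure_def)
    then have "infinite ?I"
      unfolding islimpt_eq_infinite_ball using r w by blast
    then obtain y where y: "y \<in> ?I" "y \<notin> Z" using finZ by (meson finite_subset subsetI)
    have "y \<in> drawing G" using y edge_segment_subset[OF e]
      unfolding edge_segment_pair by (auto simp: open_segment_def)
    moreover have "y \<in> F" using y r FCZ by auto
    ultimately show False using face_disjoint[OF F] by blast
  qed
  then show ?thesis using FCZ C(1) by (simp add: Diff_triv)
qed

text \<open>If no edge had the face on its left, it would be a component of the complement of the empty set.\<close>

lemma face_has_left_edge:
  assumes F: "F \<in> faces G" and ne: "drawing G \<noteq> {}"
    and nbr: "\<And>w. w \<in> verts G \<Longrightarrow> neighbours G w \<noteq> {}"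
  obtains i j where "{i, j} \<in> edges G" "lface i j = F"
proof (rule ccontr)
  assume "\<not> thesis"
  then have "F \<in> components (- {})"
    using that by (intro face_is_component[OF F _ _ _ nbr]) auto
  then have "F = UNIV" by simp
  then show False using face_disjoint[OF F] ne by auto
qed

text \<open>No edge enters the open sector of an angle, so a small sector is connected and avoids the drawing.
Close to either of its two sides it meets the strip beside the corresponding edge. So the angle
sees a single face, which is to the left of the edge to \<open>a\<close> and of the edge from \<open>b\<close>.\<close>

lemma angle_sector:
  assumes ab: "(a, b) \<in> angles G v"
  shows angle_sector_face: "\<exists>\<delta>>0. \<forall>t \<phi>. 0 < t \<and> t < \<delta> \<and> 0 < \<phi> \<and> \<phi> < angle_size G v (a, b) \<longrightarrow>
          pos G v + of_real t * cis \<phi> * (pos G a - pos G v) \<in> lface v a"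
    and angle_lface: "lface v a = lface b v"
proof -
  let ?u = "pos G a - pos G v"
  define \<theta> where "\<theta> = angle_size G v (a, b)"
  have nb: "a \<in> neighbours G v" "b \<in> neighbours G v"
    and min: "\<And>c. c \<in> neighbours G v \<Longrightarrow> \<theta> \<le> angle_size G v (a, c)"
    using ab by (auto simp: angles_def \<theta>_def)
  have \<theta>: "0 < \<theta>" "\<theta> \<le> 2 * pi" by (simp_all add: \<theta>_def angle_size_def ccw_angle_pos ccw_angle_le)
  have u0: "?u \<noteq> 0" and va: "{v, a} \<in> edges G" and bv: "{b, v} \<in> edges G" and vb: "{v, b} \<in> edges G"
    using neighboursD nb by auto
  define rest where "rest = pos G ` (verts G - {v}) \<union> (\<Union>e\<in>{e \<in> edges G. v \<notin> e}. edge_segment G e)"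
  have rest: "closed rest" unfolding rest_def
    by (intro closed_Un finite_imp_closed closed_UN) (auto simp: finite_verts finite_edges edge_segment_closed)
  have vV: "v \<in> verts G" using neighboursD nb by blast
  have "pos G v \<notin> rest" unfolding rest_def using vertex_on_edge vV inj_pos by (auto simp: inj_on_def)
  then obtain d where d: "d > 0" "ball (pos G v) d \<inter> rest = {}"
    using rest by (metis Compl_iff disjoint_eq_subset_Compl open_Compl open_contains_ball)
  define \<delta> where "\<delta> = min 1 (d / norm ?u)"
  have \<delta>: "0 < \<delta>" "\<delta> \<le> 1" "\<delta> * norm ?u \<le> d"
    using d u0 by (auto simp: \<delta>_def min_def field_simps)
  define g where "g = (\<lambda>p. pos G v + of_real (fst p) * cis (snd p) * ?u)"
  define S where "S = g ` ({0<..<\<delta>} \<times> {0<..<\<theta>})"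
  have off: "g (t, \<phi>) \<notin> drawing G" if t: "0 < t" "t < \<delta>" and \<phi>: "0 < \<phi>" "\<phi> < \<theta>" for t \<phi>
  proof
    assume dr: "g (t, \<phi>) \<in> drawing G"
    have gne: "g (t, \<phi>) \<noteq> pos G v" using t u0 by (simp add: g_def)
    have "norm (g (t, \<phi>) - pos G v) = t * norm ?u" using t by (simp add: g_def norm_mult)
    also have "\<dots> < \<delta> * norm ?u" using t u0 by simp
    finally have "g (t, \<phi>) \<in> ball (pos G v) d" using \<delta> by (simp add: dist_norm norm_minus_commute)
    then have "g (t, \<phi>) \<notin> rest" using d by blast
    then obtain e where e: "e \<in> edges G" "v \<in> e" "g (t, \<phi>) \<in> edge_segment G e"
      using dr gne unfolding drawing_def rest_def by blast
    obtain i j where "e = {i, j}" "i \<noteq> j" using edgeE[OF e(1)] by blast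
    then obtain c where c: "e = {v, c}" using e(2) by auto
    then have cn: "c \<in> neighbours G v" using e by (simp add: neighbour_iff)
    obtain s where s: "g (t, \<phi>) = edge_coord (pos G v) (pos G c) s 0" "0 \<le> s" "s \<le> 1"
      using e(3) unfolding c edge_segment_pair closed_segment_edge_coord by auto
    have s0: "s > 0" using s gne by (cases "s = 0") (auto simp: edge_coord_0)
    have "of_real t * cis \<phi> * ?u = of_real s * (pos G c - pos G v)"
      using s(1) by (simp add: g_def edge_coord_0 scaleR_conv_of_real algebra_simps)
    then have "pos G c - pos G v = of_real (t / s) * cis \<phi> * ?u" using s0 by (simp add: field_simps)
    then have "ccw_angle ?u (pos G c - pos G v) = \<phi>"
      by (intro ccw_angle_eqI[of _ "t / s"]) (use u0 t s0 \<phi> \<theta> in auto)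
    then show False using min[OF cn] \<phi> by (simp add: angle_size_def)
  qed
  have "connected S" unfolding S_def g_def
    by (intro connected_continuous_image connected_Times continuous_intros) auto
  moreover have "S \<inter> drawing G = {}" using off by (auto simp: S_def)
  moreover have "S \<noteq> {}" using \<delta> \<theta> by (simp add: S_def)
  ultimately obtain F where F: "F \<in> faces G" "S \<subseteq> F" by (rule face_superset)
  have SI: "g (t, \<phi>) \<in> F" if "0 < t" "t < \<delta>" "0 < \<phi>" "\<phi> < \<theta>" for t \<phi>
    using that F(2) unfolding S_def by force
  \<comment> \<open>the radius at which the sector is compared with the strips\<close>
  define s0 where "s0 = \<delta> / 2"
  have s0: "0 < s0" "s0 < 1" "s0 < \<delta>" using \<delta> by (auto simp: s0_def)
  \<comment> \<open>a ray turning towards an edge ends up in the strip beside that edge\<close>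
  have turn: "\<forall>\<^sub>F \<phi> in at_right 0. p / 2 \<le> p * cos \<phi> \<and> p * cos \<phi> \<le> p \<and> 0 < p * sin \<phi> \<and> p * sin \<phi> < \<epsilon>"
    if "0 < p" "0 < \<epsilon>" for p \<epsilon> :: real
  proof -
    have "((\<lambda>\<phi>. p * cos \<phi>) \<longlongrightarrow> p * cos 0) (at_right 0)"
      by (intro tendsto_mult tendsto_const tendsto_cos tendsto_ident_at)
    moreover have "((\<lambda>\<phi>. p * sin \<phi>) \<longlongrightarrow> p * sin 0) (at_right 0)"
      by (intro tendsto_mult tendsto_const tendsto_sin tendsto_ident_at)
    ultimately have "\<forall>\<^sub>F \<phi> in at_right 0. p / 2 < p * cos \<phi>" "\<forall>\<^sub>F \<phi> in at_right 0. p * sin \<phi> < \<epsilon>"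
      using that by (auto dest: order_tendstoD(1)[where a = "p / 2"] order_tendstoD(2)[where a = \<epsilon>] simp del: mult_less_cancel_left_pos)
    moreover have "\<forall>\<^sub>F \<phi> in at_right (0::real). 0 < \<phi> \<and> \<phi> < pi"
      unfolding eventually_at_right_field by (intro exI[of _ pi]) auto
    ultimately show ?thesis
      by eventually_elim (use that sin_gt_zero in auto)
  qed
  have near_a: "\<forall>\<^sub>F \<phi> in at_right (0::real). 0 < \<phi> \<and> \<phi> < \<theta>"
    unfolding eventually_at_right_field using \<theta> by (intro exI[of _ \<theta>]) auto
  have "F = lface v a"
  proof -
    obtain \<epsilon> where \<epsilon>: "0 < \<epsilon>" "\<And>s t. s \<in> {s0 / 2..s0} \<Longrightarrow> 0 < t \<Longrightarrow> t < \<epsilon> \<Longrightarrow>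
        edge_coord (pos G v) (pos G a) s t \<in> lface v a"
      using lface_strip[OF va, of "s0 / 2" s0] s0 by auto
    have "\<forall>\<^sub>F \<phi> in at_right 0. 0 < \<phi> \<and> \<phi> < \<theta> \<and> s0 / 2 \<le> s0 * cos \<phi> \<and> s0 * cos \<phi> \<le> s0 \<and> 0 < s0 * sin \<phi> \<and> s0 * sin \<phi> < \<epsilon>"
      using eventually_conj[OF near_a turn[OF s0(1) \<epsilon>(1)]] by simp
    then obtain \<phi> where \<phi>: "0 < \<phi>" "\<phi> < \<theta>" "s0 / 2 \<le> s0 * cos \<phi>" "s0 * cos \<phi> \<le> s0" "0 < s0 * sin \<phi>" "s0 * sin \<phi> < \<epsilon>"
      using eventually_happens'[OF trivial_limit_at_right_real] by blast
    have "Complex (s0 * cos \<phi>) (s0 * sin \<phi>) = of_real s0 * cis \<phi>" by (simp add: complex_eq_iff)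
    then have "g (s0, \<phi>) = edge_coord (pos G v) (pos G a) (s0 * cos \<phi>) (s0 * sin \<phi>)"
      by (simp add: g_def edge_coord_def)
    then have "g (s0, \<phi>) \<in> lface v a" using \<epsilon>(2) \<phi> by auto
    moreover have "g (s0, \<phi>) \<in> F" using SI s0 \<phi> by auto
    ultimately show ?thesis using faces_eq[OF F(1) lface_in_faces[OF va]] by blast
  qed
  moreover have "F = lface b v"
  proof -
    obtain \<rho> where \<rho>: "0 < \<rho>" "pos G b - pos G v = of_real \<rho> * cis \<theta> * ?u"
      using ccw_angle_polarE[OF u0 neighboursD(6)[OF nb(2)]] unfolding \<theta>_def angle_size_def prod.case .
    define p where "p = min s0 (s0 / \<rho>)"
    have "p * \<rho> \<le> s0 / \<rho> * \<rho>" using \<rho>(1) by (intro mult_right_mono) (auto simp: p_def)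
    then have p: "0 < p" "p < 1" "p * \<rho> < \<delta>"
      using s0 \<rho>(1) by (auto simp: p_def)
    obtain \<epsilon> where \<epsilon>: "0 < \<epsilon>" "\<And>s t. s \<in> {1 - p..1 - p / 2} \<Longrightarrow> 0 < t \<Longrightarrow> t < \<epsilon> \<Longrightarrow>
        edge_coord (pos G b) (pos G v) s t \<in> lface b v"
      using lface_strip[OF bv, of "1 - p" "1 - p / 2"] p by auto
    have "\<forall>\<^sub>F \<phi> in at_right 0. 0 < \<phi> \<and> \<phi> < \<theta> \<and> p / 2 \<le> p * cos \<phi> \<and> p * cos \<phi> \<le> p \<and> 0 < p * sin \<phi> \<and> p * sin \<phi> < \<epsilon>"
      using eventually_conj[OF near_a turn[OF p(1) \<epsilon>(1)]] by simp
    then obtain \<phi> where \<phi>: "0 < \<phi>" "\<phi> < \<theta>" "p / 2 \<le> p * cos \<phi>" "p * cos \<phi> \<le> p" "0 < p * sin \<phi>" "p * sin \<phi> < \<epsilon>"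
      using eventually_happens'[OF trivial_limit_at_right_real] by blast
    have "Complex (p * cos \<phi>) (- (p * sin \<phi>)) = of_real p * cis (- \<phi>)" by (simp add: complex_eq_iff)
    then have "edge_coord (pos G v) (pos G b) (p * cos \<phi>) (- (p * sin \<phi>)) = g (p * \<rho>, \<theta> - \<phi>)"
      by (simp add: g_def edge_coord_def \<rho>(2) cis_mult[of _ "- \<phi>", simplified, symmetric])
    then have "g (p * \<rho>, \<theta> - \<phi>) = edge_coord (pos G b) (pos G v) (1 - p * cos \<phi>) (p * sin \<phi>)"
      by (simp add: edge_coord_swap[of "pos G b"])
    then have "g (p * \<rho>, \<theta> - \<phi>) \<in> lface b v" using \<epsilon>(2) \<phi> by auto
    moreover have "g (p * \<rho>, \<theta> - \<phi>) \<in> F" using SI p \<rho> \<phi> by auto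
    ultimately show ?thesis using faces_eq[OF F(1) lface_in_faces[OF bv]] by blast
  qed
  ultimately show "lface v a = lface b v"
    "\<exists>\<delta>>0. \<forall>t \<phi>. 0 < t \<and> t < \<delta> \<and> 0 < \<phi> \<and> \<phi> < angle_size G v (a, b) \<longrightarrow>
          pos G v + of_real t * cis \<phi> * (pos G a - pos G v) \<in> lface v a"
    using SI \<delta>(1) by (auto simp: g_def \<theta>_def)
qed

text \<open>The closure of a sector of at least a half turn contains a segment that has the vertex in its
interior. So the vertex is not an extreme point of a closed convex set that contains the face.\<close>

lemma wide_angle_closure:
  assumes ab: "(a, b) \<in> angles G v" and wide: "pi \<le> angle_size G v (a, b)"
  obtains t where "0 < t" "pos G v + of_real t * (pos G a - pos G v) \<in> closure (lface v a)"
    "pos G v - of_real t * (pos G a - pos G v) \<in> closure (lface v a)"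
proof -
  let ?u = "pos G a - pos G v"
  obtain \<delta> where \<delta>: "0 < \<delta>" "\<And>t \<phi>. 0 < t \<Longrightarrow> t < \<delta> \<Longrightarrow> 0 < \<phi> \<Longrightarrow> \<phi> < pi \<Longrightarrow>
      pos G v + of_real t * cis \<phi> * ?u \<in> lface v a"
    using angle_sector_face[OF ab] wide by (metis order_less_le_trans)
  define t where "t = \<delta> / 2"
  define g where "g \<phi> = pos G v + of_real t * cis \<phi> * ?u" for \<phi>
  have t: "0 < t" "t < \<delta>" using \<delta>(1) by (auto simp: t_def)
  have "g ` {0<..<pi} \<subseteq> lface v a" using \<delta>(2) t by (auto simp: g_def)
  then have "g ` closure {0<..<pi} \<subseteq> closure (lface v a)"
    by (intro image_closure_subset closed_closure)
      (use closure_subset in \<open>auto simp: g_def intro!: continuous_intros\<close>)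
  moreover have "0 \<in> closure {0<..<pi}" "pi \<in> closure {0<..<pi}" by auto
  ultimately have "g 0 \<in> closure (lface v a)" "g pi \<in> closure (lface v a)" by blast+
  then show thesis using that[of t] t(1) by (simp add: g_def)
qed

end

section \<open>Jordan curves and Euler's inequality\<close>

lemma card_image_less:
  assumes "finite A" "a \<in> A" "b \<in> A" "a \<noteq> b" "f a = f b"
  shows "card (f ` A) < card A"
proof -
  have "\<not> inj_on f A" using assms by (auto simp: inj_on_def)
  then show ?thesis using assms(1) card_image_le[of A f] eq_card_imp_inj_on[of A f] by linarith
qed

text \<open>A simple polygon without a prescribed orientation.\<close>

definition jordan_polygon :: "complex list \<Rightarrow> bool" where
  "jordan_polygon ps \<longleftrightarrow> length ps \<ge> 3 \<and> distinct ps \<and>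
     (\<forall>i<length ps. \<forall>j<length ps. i \<noteq> j \<longrightarrow>
        closed_segment (ps ! i) (cyc_next ps i) \<inter> closed_segment (ps ! j) (cyc_next ps j)
          \<subseteq> {ps ! i, cyc_next ps i} \<inter> {ps ! j, cyc_next ps j})"

text \<open>The sides but the last are joined one by one to an arc, which the last side closes. This makes the
Jordan curve theorem available for polygons.\<close>

lemma jordan_polygon_path:
  assumes "jordan_polygon ps"
  obtains c where "simple_path c" "pathfinish c = pathstart c" "path_image c = polygon_boundary ps"
proof -
  define n where "n = length ps"
  have n: "3 \<le> n" and d: "distinct ps" using assms by (auto simp: jordan_polygon_def n_def)
  have meet: "closed_segment (ps ! i) (cyc_next ps i) \<inter> closed_segment (ps ! j) (cyc_next ps j)
      \<subseteq> {ps ! i, cyc_next ps i} \<inter> {ps ! j, cyc_next ps j}" if "i < n" "j < n" "i \<noteq> j" for i j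
    using assms that by (auto simp: jordan_polygon_def n_def)
  have nxt: "cyc_next ps i = ps ! Suc i" if "Suc i < n" for i using that by (simp add: cyc_next_def n_def)
  have last: "cyc_next ps (n - 1) = ps ! 0" using n by (simp add: cyc_next_def flip: n_def)
  have eq: "ps ! i = ps ! j \<longleftrightarrow> i = j" if "i < n" "j < n" for i j
    using that d by (simp add: nth_eq_iff_index_eq n_def)
  have ex: "\<exists>g. arc g \<and> pathstart g = ps ! 0 \<and> pathfinish g = ps ! Suc k \<and>
      path_image g = (\<Union>i\<le>k. closed_segment (ps ! i) (ps ! Suc i))" if "Suc k < n" for k
    using that
  proof (induction k)
    case 0
    then show ?case using eq[of 0 1] by (intro exI[of _ "linepath (ps ! 0) (ps ! 1)"]) simp
  next
    case (Suc k)
    then obtain g where g: "arc g" "pathstart g = ps ! 0" "pathfinish g = ps ! Suc k"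
      "path_image g = (\<Union>i\<le>k. closed_segment (ps ! i) (ps ! Suc i))" by auto
    let ?l = "linepath (ps ! Suc k) (ps ! Suc (Suc k))"
    have "path_image g \<inter> path_image ?l \<subseteq> {ps ! Suc k}"
    proof
      fix x assume x: "x \<in> path_image g \<inter> path_image ?l"
      then obtain i where i: "i \<le> k" "x \<in> closed_segment (ps ! i) (ps ! Suc i)" using g(4) by auto
      have "x \<in> {ps ! i, ps ! Suc i} \<inter> {ps ! Suc k, ps ! Suc (Suc k)}"
      proof -
        have k: "i < n" "Suc k < n" "i \<noteq> Suc k" "cyc_next ps i = ps ! Suc i"
          "cyc_next ps (Suc k) = ps ! Suc (Suc k)"
          using i Suc.prems by (auto intro!: nxt)
        have "x \<in> closed_segment (ps ! Suc k) (ps ! Suc (Suc k))" using x by simp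
        then show ?thesis using meet[OF k(1-3)] i(2) unfolding k(4,5) by blast
      qed
      moreover have "ps ! i \<noteq> ps ! Suc k" "ps ! i \<noteq> ps ! Suc (Suc k)" "ps ! Suc i \<noteq> ps ! Suc (Suc k)"
      proof -
        have b: "i < n" "Suc i < n" "Suc k < n" "Suc (Suc k) < n" using i(1) Suc.prems by linarith+
        have ne: "i \<noteq> Suc k" "i \<noteq> Suc (Suc k)" "Suc i \<noteq> Suc (Suc k)" using i(1) by linarith+
        show "ps ! i \<noteq> ps ! Suc k" "ps ! i \<noteq> ps ! Suc (Suc k)" "ps ! Suc i \<noteq> ps ! Suc (Suc k)"
          using eq[OF b(1,3)] eq[OF b(1,4)] eq[OF b(2,4)] ne by blast+
      qed
      ultimately show "x \<in> {ps ! Suc k}" by (elim IntE insertE emptyE) simp_all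
    qed
    then have "arc (g +++ ?l)" using eq[of "Suc k" "Suc (Suc k)"] Suc.prems g by (intro arc_join) auto
    moreover have "path_image (g +++ ?l) = (\<Union>i\<le>Suc k. closed_segment (ps ! i) (ps ! Suc i))"
      using g by (simp add: path_image_join atMost_Suc Un_commute)
    ultimately show ?case using g by (intro exI[of _ "g +++ ?l"]) simp
  qed
  define m where "m = n - 2"
  have m: "n = Suc (Suc m)" using n by (simp add: m_def)
  obtain g where g: "arc g" "pathstart g = ps ! 0" "pathfinish g = ps ! Suc m"
      "path_image g = (\<Union>i\<le>m. closed_segment (ps ! i) (ps ! Suc i))"
    using ex[of m] m by auto
  let ?l = "linepath (ps ! Suc m) (ps ! 0)"
  have lastm: "cyc_next ps (Suc m) = ps ! 0" using last m by simp
  have int: "path_image g \<inter> path_image ?l \<subseteq> {ps ! 0, ps ! Suc m}"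
  proof
    fix x assume x: "x \<in> path_image g \<inter> path_image ?l"
    then obtain i where i: "i \<le> m" "x \<in> closed_segment (ps ! i) (ps ! Suc i)" using g(4) by auto
    have "i < n" "Suc m < n" "i \<noteq> Suc m" using i m by auto
    then have sub: "closed_segment (ps ! i) (cyc_next ps i) \<inter> closed_segment (ps ! Suc m) (ps ! 0) \<subseteq> {ps ! Suc m, ps ! 0}"
      using meet[of i "Suc m", unfolded lastm] by (meson Int_lower2 order_trans)
    have xm: "x \<in> closed_segment (ps ! Suc m) (ps ! 0)" using x by simp
    have nx: "cyc_next ps i = ps ! Suc i" using i m by (intro nxt) simp
    have "x \<in> {ps ! Suc m, ps ! 0}"
      using subsetD[OF sub[unfolded nx] IntI[OF i(2) xm]] .
    then show "x \<in> {ps ! 0, ps ! Suc m}" by (simp only: insert_commute)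
  qed
  have "simple_path (g +++ ?l)"
  proof (rule simple_path_join_loop)
    show "arc ?l" using eq[of "Suc m" 0] m by simp
    show "path_image g \<inter> path_image ?l \<subseteq> {pathstart g, pathstart ?l}" using int g(2) by simp
  qed (use g in simp_all)
  moreover have "path_image (g +++ ?l) = polygon_boundary ps"
  proof -
    have "polygon_boundary ps = (\<Union>i\<le>Suc m. closed_segment (ps ! i) (cyc_next ps i))"
      unfolding polygon_boundary_def by (simp add: m lessThan_Suc_atMost flip: n_def)
    also have "\<dots> = (\<Union>i\<le>m. closed_segment (ps ! i) (ps ! Suc i)) \<union> closed_segment (ps ! Suc m) (ps ! 0)"
      by (simp add: atMost_Suc lastm nxt m Un_commute)
    also have "\<dots> = path_image (g +++ ?l)"
      using g by (simp add: path_image_join)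
    finally show ?thesis by simp
  qed
  ultimately show thesis using that[of "g +++ ?l"] g by simp
qed

lemma connected_inside_or_outside:
  fixes S :: "complex set"
  assumes F: "connected F" "F \<inter> S = {}" and S: "closed S"
  shows "F \<subseteq> inside S \<or> F \<subseteq> outside S"
proof -
  have sub: "F \<subseteq> inside S \<union> outside S" using F(2) by (simp add: disjoint_eq_subset_Compl)
  have "inside S \<inter> outside S \<inter> F = {}" by simp
  then have "inside S \<inter> F = {} \<or> outside S \<inter> F = {}"
    using connectedD[OF F(1) open_inside[OF S] open_outside[OF S] _ sub] by simp
  then show ?thesis using sub by blast
qed

abbreviation adjacency :: "'v set set \<Rightarrow> ('v \<times> 'v) set" where
  "adjacency E \<equiv> {(x, y). {x, y} \<in> E}"

context plane_drawing begin

lemma subframework: "E \<subseteq> edges G \<Longrightarrow> plane_drawing (G\<lparr>edges := E\<rparr>)"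
proof (unfold_locales)
  assume E: "E \<subseteq> edges G"
  have seg: "edge_segment (G\<lparr>edges := E\<rparr>) e = edge_segment G e" for e by (simp add: edge_segment_def)
  show "simple_graph (G\<lparr>edges := E\<rparr>)" using simple E by (auto simp: simple_graph_def)
  show "inj_on (pos (G\<lparr>edges := E\<rparr>)) (verts (G\<lparr>edges := E\<rparr>))" using inj_pos by simp
  fix e assume "e \<in> edges (G\<lparr>edges := E\<rparr>)"
  then have e: "e \<in> edges G" using E by auto
  {
    fix f assume "f \<in> edges (G\<lparr>edges := E\<rparr>)" "e \<noteq> f"
    then show "edge_segment (G\<lparr>edges := E\<rparr>) e \<inter> edge_segment (G\<lparr>edges := E\<rparr>) f \<subseteq> pos (G\<lparr>edges := E\<rparr>) ` (e \<inter> f)"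
      using edges_meet[OF e, of f] E unfolding seg by auto
  next
    fix v assume "v \<in> verts (G\<lparr>edges := E\<rparr>)" "pos (G\<lparr>edges := E\<rparr>) v \<in> edge_segment (G\<lparr>edges := E\<rparr>) e"
    then show "v \<in> e" using vertex_on_edge[OF e] unfolding seg by simp
  }
qed

text \<open>Both sides of the curve accumulate at the midpoint of the edge, and only the two faces beside the
edge are present there.\<close>

lemma jordan_edge_sides:
  assumes e: "{i, j} \<in> edges G" and c: "simple_path c" "pathfinish c = pathstart c"
    and S: "edge_segment G {i, j} \<subseteq> path_image c" "path_image c \<subseteq> drawing G"
  shows "lface i j \<subseteq> inside (path_image c) \<and> lface j i \<subseteq> outside (path_image c) \<or>
         lface i j \<subseteq> outside (path_image c) \<and> lface j i \<subseteq> inside (path_image c)"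
proof -
  let ?S = "path_image c"
  let ?x = "edge_coord (pos G i) (pos G j) (1/2) 0"
  note J = Jordan_inside_outside[OF c]
  have e': "{j, i} \<in> edges G" using e by (simp add: insert_commute)
  have side: "F \<subseteq> inside ?S \<or> F \<subseteq> outside ?S" if F: "F \<in> faces G" for F
  proof -
    have "F \<inter> ?S = {}" using face_disjoint[OF F] S(2) by blast
    then show ?thesis
      by (rule connected_inside_or_outside[OF face_connected[OF F]])
        (simp add: closed_path_image simple_path_imp_path c(1))
  qed
  obtain r where r: "0 < r" "ball ?x r - edge_segment G {i, j} \<subseteq> lface i j \<union> lface j i"
    by (rule edge_neighbourhood[OF e, of "1/2"]) simp_all
  have "?x \<in> edge_segment G {i, j}"
    unfolding edge_segment_pair closed_segment_edge_coord by (rule image_eqI[OF refl]) simp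
  then have xS: "?x \<in> ?S" using S(1) by blast
  have meets: "U \<inter> (lface i j \<union> lface j i) \<noteq> {}" if U: "frontier U = ?S" "U \<inter> ?S = {}" for U
  proof -
    have "?x \<in> closure U" using xS U(1) by (auto simp: frontier_def)
    then have "ball ?x r \<inter> U \<noteq> {}" using open_Int_closure_eq_empty[OF open_ball, of ?x r U] r(1) centre_in_ball by blast
    then obtain y where "y \<in> ball ?x r" "y \<in> U" by blast
    then show ?thesis using r(2) S(1) U(2) by blast
  qed
  have "inside ?S \<inter> (lface i j \<union> lface j i) \<noteq> {}" using J by (intro meets) simp_all
  moreover have "outside ?S \<inter> (lface i j \<union> lface j i) \<noteq> {}" using J by (intro meets) simp_all
  moreover have "inside ?S \<inter> outside ?S = {}" by simp
  ultimately show ?thesis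
    using side[OF lface_in_faces[OF e]] side[OF lface_in_faces[OF e']] by blast
qed

lemma reachable_path_component:
  assumes "(i, j) \<in> (adjacency (edges G))\<^sup>*" "i \<in> verts G"
  shows "path_component (drawing G) (pos G i) (pos G j)"
  using assms(1)
proof (induction rule: rtrancl_induct)
  case base
  then show ?case using assms(2) by (simp add: path_component_refl drawing_def)
next
  case (step y z)
  then have yz: "{y, z} \<in> edges G" by simp
  have "path_component (drawing G) (pos G y) (pos G z)"
    unfolding path_component_def
    using edge_segment_subset[OF yz] by (intro exI[of _ "linepath (pos G y) (pos G z)"]) (simp add: edge_segment_pair)
  then show ?case using step.IH path_component_trans by blast
qed

text \<open>An arc inside the rest of the drawing that joins the two ends of the edge forms a Jordan curve
together with the edge.\<close>

lemma cycle_edge_separates: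
  assumes e: "{i, j} \<in> edges G" and cyc: "(i, j) \<in> (adjacency (edges G - {{i, j}}))\<^sup>*"
  shows "lface i j \<noteq> lface j i"
proof -
  let ?G = "G\<lparr>edges := edges G - {{i, j}}\<rparr>"
  interpret G': plane_drawing ?G by (rule subframework) auto
  note ij = edgeD[OF e]
  have "path_component (drawing ?G) (pos G i) (pos G j)"
    using G'.reachable_path_component[of i j] cyc ij by simp
  then obtain p where p: "path p" "path_image p \<subseteq> drawing ?G" "pathstart p = pos G i" "pathfinish p = pos G j"
    unfolding path_component_def by blast
  obtain g where g: "arc g" "path_image g \<subseteq> path_image p" "pathstart g = pos G i" "pathfinish g = pos G j"
    using path_contains_arc[OF p(1) p(3,4) ij(4)] by blast
  define c where "c = g +++ linepath (pos G j) (pos G i)"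
  have img: "path_image c = path_image g \<union> edge_segment G {i, j}"
    using g by (simp add: c_def path_image_join edge_segment_pair closed_segment_commute)
  have dr: "drawing ?G = pos G ` verts G \<union> (\<Union>f\<in>edges G - {{i, j}}. edge_segment G f)"
    by (simp add: drawing_def edge_segment_def)
  have gdr: "path_image g \<subseteq> drawing ?G" using g p by blast
  have "simple_path c" unfolding c_def
  proof (rule simple_path_join_loop)
    show "path_image g \<inter> path_image (linepath (pos G j) (pos G i)) \<subseteq> {pathstart g, pathstart (linepath (pos G j) (pos G i))}"
      using edge_meets_rest[OF e] gdr g unfolding dr
      by (auto simp: edge_segment_pair closed_segment_commute)
  qed (use g ij in auto)
  moreover have "pathfinish c = pathstart c" using g by (simp add: c_def)
  moreover have "path_image c \<subseteq> drawing G"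
    using img gdr edge_segment_subset[OF e] by (auto simp: drawing_def edge_segment_def)
  ultimately have "lface i j \<subseteq> inside (path_image c) \<and> lface j i \<subseteq> outside (path_image c) \<or>
         lface i j \<subseteq> outside (path_image c) \<and> lface j i \<subseteq> inside (path_image c)"
    using jordan_edge_sides[OF e, of c] img by blast
  then show ?thesis
    using face_nonempty[OF lface_in_faces[OF e]] inside_Int_outside[of "path_image c"] by blast
qed

text \<open>Mapping a face to the face that contains it after the deletion is surjective, since an edge has
empty interior. If the edge lies on a cycle, the map is not injective: the two distinct faces
beside the edge merge.\<close>

lemma faces_delete_edge:
  assumes e: "{i, j} \<in> edges G" and fin: "finite (faces G)"
  defines "E' \<equiv> edges G - {{i, j}}"
  defines "G' \<equiv> G\<lparr>edges := E'\<rparr>"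
  shows "finite (faces G')" and "card (faces G') \<le> card (faces G)"
    and "(i, j) \<in> (adjacency E')\<^sup>* \<Longrightarrow> card (faces G') < card (faces G)"
proof -
  interpret G': plane_drawing G' unfolding G'_def by (rule subframework) (auto simp: E'_def)
  have dr: "drawing G = drawing G' \<union> edge_segment G {i, j}"
    using e by (auto simp: drawing_def G'_def E'_def edge_segment_def)
  have "\<exists>K\<in>faces G'. F \<subseteq> K" if F: "F \<in> faces G" for F
  proof -
    have "F \<inter> drawing G' = {}" using face_disjoint[OF F] unfolding dr by blast
    then obtain K where "K \<in> faces G'" "F \<subseteq> K"
      by (rule G'.face_superset[OF face_connected[OF F] _ face_nonempty[OF F]])
    then show ?thesis by blast
  qed
  then obtain \<phi> where \<phi>: "\<And>F. F \<in> faces G \<Longrightarrow> \<phi> F \<in> faces G' \<and> F \<subseteq> \<phi> F" by metis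
  have img: "faces G' = \<phi> ` faces G"
  proof (intro equalityI subsetI)
    fix K assume K: "K \<in> faces G'"
    have "\<not> K \<subseteq> edge_segment G {i, j}"
    proof
      assume "K \<subseteq> edge_segment G {i, j}"
      then have "K \<subseteq> interior (closed_segment (pos G i) (pos G j))"
        using G'.face_open[OF K] by (simp add: edge_segment_pair interior_maximal)
      then show False using G'.face_nonempty[OF K] by (simp add: interior_closed_segment_ge2)
    qed
    then obtain x where x: "x \<in> K" "x \<notin> drawing G" using G'.face_disjoint[OF K] unfolding dr by blast
    obtain F where F: "F \<in> faces G" "{x} \<subseteq> F" by (rule face_superset[of "{x}"]) (use x in auto)
    have "\<phi> F = K" using \<phi>[OF F(1)] F(2) x(1) G'.faces_eq[OF _ K, of "\<phi> F"] by blast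
    then show "K \<in> \<phi> ` faces G" using F by blast
  qed (use \<phi> in blast)
  show "finite (faces G')" "card (faces G') \<le> card (faces G)"
    using fin card_image_le by (simp_all add: img)
  assume cyc: "(i, j) \<in> (adjacency E')\<^sup>*"
  have e': "{j, i} \<in> edges G" using e by (simp add: insert_commute)
  let ?x = "edge_coord (pos G i) (pos G j) (1/2) 0"
  obtain r where r: "0 < r"
    "ball ?x r - edge_segment G {i, j} \<subseteq> lface i j \<union> lface j i"
    "ball ?x r \<inter> (pos G ` verts G \<union> (\<Union>f\<in>edges G - {{i, j}}. edge_segment G f)) = {}"
    by (rule edge_neighbourhood[OF e, of "1/2"]) simp_all
  then have "ball ?x r \<inter> drawing G' = {}" by (simp add: drawing_def G'_def E'_def edge_segment_def)
  then obtain K where K: "K \<in> faces G'" "ball ?x r \<subseteq> K"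
    by (rule G'.face_superset[OF connected_ball]) (use r(1) in simp)
  have "\<phi> F = K" if "F \<in> faces G" "?x \<in> closure F" for F
  proof -
    have "ball ?x r \<inter> F \<noteq> {}" using that(2) open_Int_closure_eq_empty[OF open_ball, of ?x r F] r(1) centre_in_ball by blast
    then show ?thesis using \<phi>[OF that(1)] K(2) G'.faces_eq[OF _ K(1), of "\<phi> F"] by blast
  qed
  moreover have "?x \<in> edge_segment G {i, j}"
    unfolding edge_segment_pair closed_segment_edge_coord by (rule image_eqI[OF refl]) simp
  then have "?x \<in> closure (lface i j)" "?x \<in> closure (lface j i)"
    using edge_in_closure_lface[OF e] edge_in_closure_lface[OF e'] by (auto simp: insert_commute)
  ultimately have "\<phi> (lface i j) = \<phi> (lface j i)" using lface_in_faces e e' by simp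
  then show "card (faces G') < card (faces G)"
    unfolding img using card_image_less[OF fin] lface_in_faces e e' cycle_edge_separates[OF e cyc[unfolded E'_def]] by blast
qed

text \<open>Induction on the set of edges, carrying the number of connected components of the graph along: a
new edge either joins two components or increases the number of faces.\<close>

lemma euler_inequality:
  assumes fin: "finite (faces G)" and ne: "verts G \<noteq> {}"
  shows "card (edges G) + 2 \<le> card (verts G) + card (faces G)"
proof -
  \<comment> \<open>the connected components, as sets of vertices\<close>
  define classes where "classes E = (\<lambda>v. (adjacency E)\<^sup>* `` {v}) ` verts G" for E
  have "card E + 1 + card (classes E) \<le> card (verts G) + card (faces (G\<lparr>edges := E\<rparr>))"
    if "E \<subseteq> edges G" "finite (faces (G\<lparr>edges := E\<rparr>))" for E
    using finite_subset[OF that(1) finite_edges] that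
  proof (induction E)
    case empty
    interpret G': plane_drawing "G\<lparr>edges := {}\<rparr>" by (rule subframework) auto
    have "faces (G\<lparr>edges := {}\<rparr>) \<noteq> {}"
    proof -
      have "drawing (G\<lparr>edges := {}\<rparr>) \<noteq> UNIV" using compact_imp_bounded[OF G'.drawing_compact] not_bounded_UNIV by metis
      then show ?thesis by (auto simp: faces_def)
    qed
    then have "1 \<le> card (faces (G\<lparr>edges := {}\<rparr>))" using empty by (simp add: Suc_leI card_gt_0_iff)
    moreover have "card (classes {}) \<le> card (verts G)" unfolding classes_def by (rule card_image_le[OF finite_verts])
    ultimately show ?case by simp
  next
    case (insert e E)
    let ?H = "G\<lparr>edges := insert e E\<rparr>"
    interpret H: plane_drawing ?H by (rule subframework) (use insert in auto)
    have "e \<in> edges G" using insert.prems by auto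
    then obtain i j where ij: "e = {i, j}" "i \<noteq> j" using edgeE[of e] by blast
    have e: "{i, j} \<in> edges ?H" using ij by simp
    have iV: "i \<in> verts G" "j \<in> verts G" using H.edgeD[OF e] by auto
    have E: "insert e E - {{i, j}} = E" using insert ij by auto
    have sub: "adjacency E \<subseteq> adjacency (insert e E)" by auto
    have merge: "(adjacency (insert e E))\<^sup>* `` ((adjacency E)\<^sup>* `` {v}) = (adjacency (insert e E))\<^sup>* `` {v}" for v
      using rtrancl_mono[OF sub] by (auto intro: rtrancl_trans)
    have cl: "classes (insert e E) = (\<lambda>X. (adjacency (insert e E))\<^sup>* `` X) ` classes E"
      unfolding classes_def image_image merge ..
    have fincl: "finite (classes E)" by (simp add: classes_def finite_verts)
    have le: "card (classes (insert e E)) \<le> card (classes E)" unfolding cl by (rule card_image_le[OF fincl])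
    have fin': "finite (faces (G\<lparr>edges := E\<rparr>))" "card (faces (G\<lparr>edges := E\<rparr>)) \<le> card (faces ?H)"
      using H.faces_delete_edge(1,2)[OF e insert.prems(2)] E by simp_all
    have IH: "card E + 1 + card (classes E) \<le> card (verts G) + card (faces (G\<lparr>edges := E\<rparr>))"
      using insert.IH insert.prems fin' by auto
    show ?case
    proof (cases "(i, j) \<in> (adjacency E)\<^sup>*")
      case True
      then have "card (faces (G\<lparr>edges := E\<rparr>)) < card (faces ?H)"
        using H.faces_delete_edge(3)[OF e insert.prems(2)] E by simp
      then show ?thesis using IH le insert by simp
    next
      case False
      have "(i, j) \<in> adjacency (insert e E)" "(j, i) \<in> adjacency (insert e E)" using ij by auto
      then have same: "(adjacency (insert e E))\<^sup>* `` {i} = (adjacency (insert e E))\<^sup>* `` {j}"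
        by (auto intro: converse_rtrancl_into_rtrancl)
      have diff: "(adjacency E)\<^sup>* `` {i} \<noteq> (adjacency E)\<^sup>* `` {j}" using False by auto
      have "card (classes (insert e E)) < card (classes E)"
        unfolding cl
      proof (intro card_image_less[OF fincl, of "(adjacency E)\<^sup>* `` {i}" "(adjacency E)\<^sup>* `` {j}"])
        show "(adjacency E)\<^sup>* `` {i} \<in> classes E" "(adjacency E)\<^sup>* `` {j} \<in> classes E"
          using iV by (simp_all add: classes_def)
      qed (use same diff in \<open>simp_all only: merge not_False_eq_True\<close>)
      then show ?thesis using IH fin'(2) insert by simp
    qed
  qed
  from this[of "edges G"] have "card (edges G) + 1 + card (classes (edges G)) \<le> card (verts G) + card (faces G)"
    using fin by simp
  moreover have "1 \<le> card (classes (edges G))"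
    using ne finite_verts by (simp add: classes_def Suc_leI card_gt_0_iff)
  ultimately show ?thesis by linarith
qed

text \<open>Delete all edges at \<open>v\<close> except those to \<open>c\<close> and \<open>c'\<close>. In the remaining drawing the face left of
\<open>v\<close> to \<open>c\<close> is, across the angle at \<open>v\<close>, the one left of \<open>c'\<close> to \<open>v\<close>. It differs from the one on
the other side of that edge, because the edge lies on a cycle that returns to it outside \<open>v\<close>. So
the two faces are different in the subgraph, and all the more in the drawing itself.\<close>

lemma lface_inj_around_vertex:
  assumes conn: "connected_on G (verts G - {v})"
    and c: "c \<in> neighbours G v" and c': "c' \<in> neighbours G v" and eq: "lface v c = lface v c'"
  shows "c = c'"
proof (rule ccontr)
  assume ne: "c \<noteq> c'"
  note cD = neighboursD[OF c] and c'D = neighboursD[OF c']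
  define E where "E = {e \<in> edges G. v \<notin> e} \<union> {{v, c}, {v, c'}}"
  define K where "K = G\<lparr>edges := E\<rparr>"
  have EG: "E \<subseteq> edges G" using cD c'D by (auto simp: E_def)
  interpret K: plane_drawing K unfolding K_def by (rule subframework[OF EG])
  have dr: "drawing K \<subseteq> drawing G" using EG by (auto simp: K_def drawing_def edge_segment_def)
  have nK: "neighbours K v = {c, c'}"
    by (auto simp: neighbours_def K_def E_def doubleton_eq_iff)
  have "ccw_angle (pos G c - pos G v) (pos G c' - pos G v) \<le> 2 * pi" by (rule ccw_angle_le)
  then have "(c, c') \<in> angles K v"
    using nK cD(6) by (simp add: angles_def angle_size_def K_def ccw_angle_self)
  then have 1: "K.lface v c = K.lface c' v" by (rule K.angle_lface)
  have eK: "{c', v} \<in> edges K" "{v, c'} \<in> edges K" "{v, c} \<in> edges K" by (auto simp: K_def E_def insert_commute)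
  have "(c', c) \<in> {(x, y). x \<in> verts G - {v} \<and> y \<in> verts G - {v} \<and> {x, y} \<in> edges G}\<^sup>*"
    using conn cD c'D by (auto simp: connected_on_def)
  moreover have "{(x, y). x \<in> verts G - {v} \<and> y \<in> verts G - {v} \<and> {x, y} \<in> edges G} \<subseteq> adjacency (edges K - {{c', v}})"
    by (auto simp: K_def E_def doubleton_eq_iff)
  ultimately have "(c', c) \<in> (adjacency (edges K - {{c', v}}))\<^sup>*" using rtrancl_mono by blast
  moreover have "(c, v) \<in> adjacency (edges K - {{c', v}})"
    using ne cD(5) by (auto simp: K_def E_def doubleton_eq_iff)
  ultimately have "(c', v) \<in> (adjacency (edges K - {{c', v}}))\<^sup>*" by (rule rtrancl_into_rtrancl)
  then have 2: "K.lface c' v \<noteq> K.lface v c'" using K.cycle_edge_separates eK by blast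
  obtain F where F: "F \<in> faces K" "lface v c \<subseteq> F"
  proof (rule K.face_superset)
    show "connected (lface v c)" "lface v c \<noteq> {}" "lface v c \<inter> drawing K = {}"
      using face_connected face_nonempty face_disjoint lface_in_faces[OF cD(1)] dr by blast+
  qed
  have sup: "K.lface v x = F" if "{v, x} \<in> edges K" "{v, x} \<in> edges G" "lface v x \<subseteq> F" for x
  proof -
    have "on_left (pos G v) (pos G x) (lface v x)"
      using left_face_lface[OF that(2)] by (simp add: left_face_def)
    then have "on_left (pos K v) (pos K x) F"
      unfolding on_left_def K_def using that(3) by (auto elim: eventually_mono)
    then show ?thesis using K.left_face_iff[of v x F] F that by (simp add: left_face_def)
  qed
  show False using 1 2 sup[of c] sup[of c'] eK F(2) eq cD c'D by simp
qed

end

section \<open>The angles around a vertex\<close>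

lemma cyc_next_bij:
  assumes "distinct cs"
  shows "bij_betw (cyc_next cs) {..<length cs} (set cs)"
proof -
  define n where "n = length cs"
  have "inj_on (\<lambda>i. Suc i mod n) {..<n}"
  proof (rule inj_onI)
    fix i j assume ij: "i \<in> {..<n}" "j \<in> {..<n}" "Suc i mod n = Suc j mod n"
    have "Suc k mod n = (if Suc k = n then 0 else Suc k)" if "k < n" for k using that by auto
    then show "i = j" using ij by (auto split: if_splits)
  qed
  moreover have "(\<lambda>i. Suc i mod n) ` {..<n} \<subseteq> {..<n}" by auto
  ultimately have "bij_betw (\<lambda>i. Suc i mod n) {..<n} {..<n}"
    by (simp add: bij_betw_def endo_inj_surj)
  moreover have "bij_betw ((!) cs) {..<n} (set cs)"
    using bij_betw_nth[OF assms, of "{..<n}" "set cs"] by (simp add: n_def)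
  ultimately have "bij_betw ((!) cs \<circ> (\<lambda>i. Suc i mod n)) {..<n} (set cs)" by (rule bij_betw_trans)
  then show ?thesis by (simp add: n_def cyc_next_def[abs_def] comp_def)
qed

lemma cyc_next_map: "cs \<noteq> [] \<Longrightarrow> cyc_next (map f cs) i = f (cyc_next cs i)"
  by (simp add: cyc_next_def)

lemma inside_subset_convex_hull:
  fixes S :: "complex set"
  shows "inside S \<subseteq> convex hull S"
proof -
  have "outside (convex hull S) \<subseteq> outside S" by (rule outside_mono) (rule hull_subset)
  then have "- (convex hull S) \<subseteq> outside S" by (simp add: outside_convex)
  then show ?thesis using inside_Int_outside[of S] by blast
qed

context plane_drawing begin

lemma angles_bij:
  assumes "neighbours G v \<noteq> {}"
  shows angles_bij_fst: "bij_betw fst (angles G v) (neighbours G v)"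
    and angles_bij_snd: "bij_betw snd (angles G v) (neighbours G v)"
    and angles_sum: "(\<Sum>\<alpha>\<in>angles G v. angle_size G v \<alpha>) = 2 * pi"
proof -
  obtain cs where cs: "distinct cs" "set cs = neighbours G v"
    "angles G v = (\<lambda>i. (cs ! i, cyc_next cs i)) ` {..<length cs}"
    "(\<Sum>i<length cs. angle_size G v (cs ! i, cyc_next cs i)) = 2 * pi"
    using rotation_list[OF assms] .
  let ?f = "\<lambda>i. (cs ! i, cyc_next cs i)"
  have nth: "bij_betw ((!) cs) {..<length cs} (set cs)"
    using bij_betw_nth[OF cs(1), of "{..<length cs}" "set cs"] by simp
  have inj: "inj_on ?f {..<length cs}"
    using nth by (auto simp: bij_betw_def inj_on_def)
  then have f: "bij_betw ?f {..<length cs} (angles G v)" by (simp add: bij_betw_def cs(3))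
  show "bij_betw fst (angles G v) (neighbours G v)"
    using bij_betw_comp_iff[OF f, of fst "neighbours G v"] nth cs(2) by (simp add: comp_def)
  show "bij_betw snd (angles G v) (neighbours G v)"
    using bij_betw_comp_iff[OF f, of snd "neighbours G v"] cyc_next_bij[OF cs(1)] cs(2) by (simp add: comp_def)
  show "(\<Sum>\<alpha>\<in>angles G v. angle_size G v \<alpha>) = 2 * pi"
    unfolding cs(3) sum.reindex[OF inj] using cs(4) by simp
qed

lemma angleD: "(a, b) \<in> angles G v \<Longrightarrow> a \<in> neighbours G v \<and> b \<in> neighbours G v"
  by (simp add: angles_def)

lemma finite_angles: "finite (angles G v)"
  by (rule finite_subset[of _ "neighbours G v \<times> neighbours G v"])
    (auto simp: finite_neighbours dest: angleD)

lemma angle_from: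
  assumes "a \<in> neighbours G v" obtains b where "(a, b) \<in> angles G v"
proof -
  have "a \<in> fst ` angles G v" using angles_bij_fst[of v] assms by (auto simp: bij_betw_def)
  then show thesis using that by auto
qed

lemma angle_to:
  assumes "b \<in> neighbours G v" obtains a where "(a, b) \<in> angles G v"
proof -
  have "b \<in> snd ` angles G v" using angles_bij_snd[of v] assms by (auto simp: bij_betw_def)
  then show thesis using that by auto
qed

lemma angle_from_unique: "(a, b) \<in> angles G v \<Longrightarrow> (a, b') \<in> angles G v \<Longrightarrow> b = b'"
  using angles_bij_fst[of v] angleD[of a b v] unfolding bij_betw_def inj_on_def by fastforce

lemma angle_pos: "0 < angle_size G v \<alpha>"
  by (cases \<alpha>) (simp add: angle_size_def ccw_angle_pos)

lemma angle_size_lt_2pi: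
  assumes "c \<in> neighbours G v" "d \<in> neighbours G v" "c \<noteq> d"
  shows "angle_size G v (c, d) < 2 * pi"
proof -
  have "angle_size G v (c, c) = 2 * pi"
    using neighboursD(6)[OF assms(1)] by (simp add: angle_size_def ccw_angle_self)
  then have "angle_size G v (c, d) \<noteq> 2 * pi"
    using ccw_angle_eq_imp_eq[OF assms(1,1,2)] assms(3) by metis
  moreover have "angle_size G v (c, d) \<le> 2 * pi" by (simp add: angle_size_def ccw_angle_le)
  ultimately show ?thesis by simp
qed

lemma angle_distinct:
  assumes "(c, d) \<in> angles G v" "x \<in> neighbours G v" "x \<noteq> c"
  shows "c \<noteq> d"
proof
  assume "c = d"
  then have "angle_size G v (c, c) \<le> angle_size G v (c, x)" using assms by (auto simp: angles_def)
  moreover have "angle_size G v (c, c) = 2 * pi"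
    using neighboursD(6) angleD[OF assms(1)] by (simp add: angle_size_def ccw_angle_self)
  ultimately show False using angle_size_lt_2pi[of c v x] angleD[OF assms(1)] assms(2,3) by force
qed

lemma reflex_angle_unique:
  assumes "\<alpha> \<in> reflex_angles G v" "\<beta> \<in> reflex_angles G v" shows "\<alpha> = \<beta>"
proof (rule ccontr)
  assume ne: "\<alpha> \<noteq> \<beta>"
  have \<alpha>: "\<alpha> \<in> angles G v" "angle_size G v \<alpha> > pi" and \<beta>: "\<beta> \<in> angles G v" "angle_size G v \<beta> > pi"
    using assms by (auto simp: reflex_angles_def)
  have ne_nb: "neighbours G v \<noteq> {}" using angleD[of "fst \<alpha>" "snd \<alpha>" v] \<alpha> by auto
  have "(\<Sum>x\<in>{\<alpha>, \<beta>}. angle_size G v x) \<le> (\<Sum>x\<in>angles G v. angle_size G v x)"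
    using \<alpha> \<beta> by (intro sum_mono2 finite_angles) (auto intro: less_imp_le angle_pos)
  then show False using ne \<alpha>(2) \<beta>(2) angles_sum[OF ne_nb] by simp
qed

lemma sum_degrees: "(\<Sum>v\<in>verts G. card (neighbours G v)) = 2 * card (edges G)"
proof -
  have "card (neighbours G v) = card {e \<in> edges G. v \<in> e}" for v
  proof (rule bij_betw_same_card)
    show "bij_betw (\<lambda>c. {v, c}) (neighbours G v) {e \<in> edges G. v \<in> e}"
    proof (rule bij_betw_imageI)
      show "inj_on (\<lambda>c. {v, c}) (neighbours G v)" by (auto simp: inj_on_def doubleton_eq_iff)
      show "(\<lambda>c. {v, c}) ` neighbours G v = {e \<in> edges G. v \<in> e}"
      proof (intro equalityI subsetI)
        fix e assume "e \<in> {e \<in> edges G. v \<in> e}"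
        then have e: "e \<in> edges G" "v \<in> e" by auto
        obtain i j where "e = {i, j}" using edgeE[OF e(1)] by blast
        then obtain c where "e = {v, c}" using e(2) by auto
        then show "e \<in> (\<lambda>c. {v, c}) ` neighbours G v" using e(1) by (auto simp: neighbours_def)
      qed (auto simp: neighbours_def)
    qed
  qed
  then have "(\<Sum>v\<in>verts G. card (neighbours G v)) = (\<Sum>v\<in>verts G. card {e \<in> edges G. v \<in> e})" by simp
  also have "\<dots> = 2 * card (edges G)"
  proof (rule sum_multicount[OF finite_verts finite_edges], rule ballI)
    fix e assume e: "e \<in> edges G"
    then have "{v \<in> verts G. v \<in> e} = e" "card e = 2" using simple by (auto simp: simple_graph_def)
    then show "card {v \<in> verts G. v \<in> e} = 2" by simp
  qed
  finally show ?thesis .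
qed

lemma two_neighbours:
  assumes two: "two_connected G" and v: "v \<in> verts G" and x: "x \<noteq> v"
  obtains c where "c \<in> neighbours G v" "c \<noteq> x"
proof -
  have "\<exists>w\<in>verts G. w \<noteq> v \<and> w \<noteq> x"
  proof (rule ccontr)
    assume "\<not> ?thesis"
    then have "verts G \<subseteq> {v, x}" by blast
    then have "card (verts G) \<le> card {v, x}" by (rule card_mono[rotated]) simp
    also have "\<dots> \<le> 2" by (simp add: card_insert_if)
    finally show False using two by (simp add: two_connected_def)
  qed
  then obtain w where w: "w \<in> verts G" "w \<noteq> v" "w \<noteq> x" by blast
  have conn: "connected_on G (verts G - {x})"
  proof (cases "x \<in> verts G")
    case True
    then show ?thesis using two by (simp add: two_connected_def)
  next
    case False
    then show ?thesis using two by (simp add: two_connected_def)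
  qed
  let ?r = "{(a, b). a \<in> verts G - {x} \<and> b \<in> verts G - {x} \<and> {a, b} \<in> edges G}"
  have "(v, w) \<in> ?r\<^sup>*" using conn v w x by (simp add: connected_on_def)
  then show thesis
  proof (cases rule: converse_rtranclE)
    case base
    then show ?thesis using w by simp
  next
    case (step c)
    then show ?thesis using that[of c] by (simp add: neighbours_def)
  qed
qed

end

section \<open>The faces of the reciprocal\<close>

locale reciprocal_pair = plane_drawing G for G :: "'v framework" +
  fixes \<omega> :: "'v set \<Rightarrow> real" and \<rho>' :: "complex set \<Rightarrow> complex" and \<Phi> :: "'v \<Rightarrow> complex set"
  assumes two_conn: "two_connected G"
    and stress_nz: "\<And>e. e \<in> edges G \<Longrightarrow> \<omega> e \<noteq> 0"
    and recip: "reciprocal G \<omega> \<rho>'"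
    and nonx: "noncrossing_reciprocal G \<rho>' \<Phi>"
begin

abbreviation "H \<equiv> dual_framework G \<rho>'"

lemma H_simps [simp]: "verts H = faces G" "edges H = dual_edge G ` edges G" "pos H = \<rho>'"
  by (simp_all add: dual_framework_def)

end

sublocale reciprocal_pair \<subseteq> H: plane_drawing "dual_framework G \<rho>'"
  using nonx by (intro noncrossing_imp_plane_drawing) (simp add: noncrossing_reciprocal_def)

context reciprocal_pair begin

lemma dual_edge_inj: "inj_on (dual_edge G) (edges G)"
  using nonx by (simp add: noncrossing_reciprocal_def)

lemma finite_faces: "finite (faces G)"
  using H.finite_verts by simp

lemma \<Phi>_bij: "bij_betw \<Phi> (verts G) (faces H)"
  using nonx by (simp add: noncrossing_reciprocal_def dual_embedding_def Let_def)

lemma \<Phi>_face: "v \<in> verts G \<Longrightarrow> \<Phi> v \<in> faces H"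
  using \<Phi>_bij by (auto simp: bij_betw_def)

lemma dual_edge_eq:
  assumes e: "{v, c} \<in> edges G"
  shows "dual_edge G {v, c} = {lface v c, lface c v}"
proof -
  have e': "{c, v} \<in> edges G" using e by (simp add: insert_commute)
  show ?thesis
    unfolding dual_edge_def left_face_iff
  proof (intro equalityI subsetI)
    fix F assume "F \<in> {F. \<exists>i j. {v, c} = {i, j} \<and> {i, j} \<in> edges G \<and> F = lface i j}"
    then obtain i j where "{v, c} = {i, j}" "F = lface i j" by blast
    then show "F \<in> {lface v c, lface c v}" unfolding doubleton_eq_iff by auto
  next
    fix F assume "F \<in> {lface v c, lface c v}"
    then have "F = lface v c \<or> F = lface c v" by simp
    moreover have "{v, c} = {c, v}" by (rule insert_commute)
    ultimately have "\<exists>i j. {v, c} = {i, j} \<and> {i, j} \<in> edges G \<and> F = lface i j"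
      using e e' by metis
    then show "F \<in> {F. \<exists>i j. {v, c} = {i, j} \<and> {i, j} \<in> edges G \<and> F = lface i j}" by (rule CollectI)
  qed
qed

lemma dual_edge_in: "{v, c} \<in> edges G \<Longrightarrow> {lface v c, lface c v} \<in> edges H"
  using dual_edge_eq[of v c] by (metis H_simps(2) imageI)

lemma lface_sides_distinct: "{v, c} \<in> edges G \<Longrightarrow> lface v c \<noteq> lface c v"
  using H.edgeD[OF dual_edge_in] by simp

lemma reciprocal_vector:
  assumes e: "{v, c} \<in> edges G"
  shows "\<rho>' (lface v c) - \<rho>' (lface c v) = \<omega> {v, c} *\<^sub>R (pos G c - pos G v)"
proof -
  have e': "{c, v} \<in> edges G" using e by (simp add: insert_commute)
  show ?thesis using recip left_face_lface[OF e] left_face_lface[OF e'] by (simp add: reciprocal_def)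
qed

lemma neighbours_ne: "v \<in> verts G \<Longrightarrow> neighbours G v \<noteq> {}"
proof -
  assume v: "v \<in> verts G"
  have "card (verts G) \<ge> 3" using two_conn by (simp add: two_connected_def)
  then have "\<not> verts G \<subseteq> {v}" using card_mono[of "{v}" "verts G"] by auto
  then obtain x where "x \<noteq> v" by blast
  then show ?thesis using two_neighbours[OF two_conn v] by blast
qed

lemma other_neighbour:
  assumes "c \<in> neighbours G v" obtains d where "d \<in> neighbours G v" "d \<noteq> c"
  using two_neighbours[OF two_conn, of v c] neighboursD[OF assms] by blast

lemma angle_ne: "(c, d) \<in> angles G v \<Longrightarrow> c \<noteq> d"
  using angle_distinct other_neighbour angleD by metis

lemma drawing_ne: "drawing G \<noteq> {}"
proof -
  have "verts G \<noteq> {}" using two_conn by (auto simp: two_connected_def)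
  then show ?thesis by (auto simp: drawing_def)
qed

lemma dual_neighbours_ne:
  assumes "F \<in> faces G" shows "neighbours H F \<noteq> {}"
proof -
  obtain i j where "{i, j} \<in> edges G" "lface i j = F"
    using face_has_left_edge[OF assms drawing_ne neighbours_ne] by blast
  then show ?thesis using dual_edge_in[of i j] by (auto simp: neighbours_def simp del: H_simps)
qed

lemma dual_edges_distinct:
  assumes "c \<in> neighbours G v" "d \<in> neighbours G v" "c \<noteq> d"
  shows "dual_edge G {v, c} \<noteq> dual_edge G {v, d}"
  using inj_onD[OF dual_edge_inj, of "{v, c}" "{v, d}"] assms by (auto simp: neighbours_def doubleton_eq_iff)

lemma lface_inj: "c \<in> neighbours G v \<Longrightarrow> d \<in> neighbours G v \<Longrightarrow> lface v c = lface v d \<Longrightarrow> c = d"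
  using lface_inj_around_vertex[of v c d] two_conn neighboursD(3) by (auto simp: two_connected_def)

lemma orientation:
  obtains (reversed) "\<And>v. v \<in> verts G \<Longrightarrow> map_prod (dual_edge G) (dual_edge G) ` vertex_cycle G v = (face_cycle H (\<Phi> v))\<inverse>"
  | (preserved) "\<And>v. v \<in> verts G \<Longrightarrow> map_prod (dual_edge G) (dual_edge G) ` vertex_cycle G v = face_cycle H (\<Phi> v)"
  using nonx unfolding noncrossing_reciprocal_def dual_embedding_def Let_def by metis

lemma doubleton_common:
  assumes "{w, a} = {x, y}" "{w, b} = {x, z}" "{x, y} \<noteq> {x, z}" "x \<noteq> y"
  shows "w = x \<and> a = y \<and> b = z"
  using assms by (auto simp: doubleton_eq_iff)

lemma face_cycleE:
  assumes "(e, f) \<in> face_cycle K F"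
  obtains w a b where "e = {w, b}" "f = {w, a}" "w \<in> verts K" "(a, b) \<in> angles K w" "left_face K w a F"
proof -
  from assms have "\<exists>w a b. (e, f) = ({w, b}, {w, a}) \<and> w \<in> verts K \<and> (a, b) \<in> angles K w \<and> left_face K w a F"
    unfolding face_cycle_def by (rule CollectD)
  then show thesis using that by (elim exE conjE Pair_inject)
qed

text \<open>The two dual edges that belong to an angle meet in the face which the angle sees.\<close>

lemma dual_edges_at_angle:
  assumes cd: "(c, d) \<in> angles G v"
  shows "dual_edge G {v, c} = {lface v c, lface c v}" "dual_edge G {v, d} = {lface v c, lface v d}"
    "{lface v c, lface c v} \<noteq> {lface v c, lface v d}" "lface v c \<noteq> lface c v"
proof -
  have n: "{v, c} \<in> edges G" "{v, d} \<in> edges G" using angleD[OF cd] neighboursD by blast+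
  show 1: "dual_edge G {v, c} = {lface v c, lface c v}" by (rule dual_edge_eq[OF n(1)])
  show 2: "dual_edge G {v, d} = {lface v c, lface v d}"
    unfolding dual_edge_eq[OF n(2)] angle_lface[OF cd] by (rule insert_commute)
  show "{lface v c, lface c v} \<noteq> {lface v c, lface v d}"
    using dual_edges_distinct[of c v d] angleD[OF cd] angle_ne[OF cd] unfolding 1 2 by blast
  show "lface v c \<noteq> lface c v" by (rule lface_sides_distinct[OF n(1)])
qed

text \<open>The face seen by the angle \<open>(c, d)\<close> is the only common end of the two dual edges, and so the angle
of the reciprocal that these edges form is located at this face. There is one version for the case
that duality reverses the cycle, and one for the case that it preserves it.\<close>

lemma face_cycleD:
  assumes cd: "(c, d) \<in> angles G v"
    and fc: "(dual_edge G {v, d}, dual_edge G {v, c}) \<in> face_cycle H F"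
  shows "(lface c v, lface v d) \<in> angles H (lface v c)" "left_face H (lface v c) (lface c v) F"
proof -
  obtain w x y where w: "dual_edge G {v, d} = {w, y}" "dual_edge G {v, c} = {w, x}"
    "(x, y) \<in> angles H w" "left_face H w x F"
    using face_cycleE[OF fc] by metis
  note e = dual_edges_at_angle[OF cd]
  have "w = lface v c \<and> x = lface c v \<and> y = lface v d"
    by (rule doubleton_common[OF w(2)[symmetric, unfolded e(1)] w(1)[symmetric, unfolded e(2)] e(3,4)])
  then have "w = lface v c" "x = lface c v" "y = lface v d" by simp_all
  then show "(lface c v, lface v d) \<in> angles H (lface v c)" "left_face H (lface v c) (lface c v) F"
    using w(3,4) by (simp_all only:)
qed

lemma face_cycleD':
  assumes cd: "(c, d) \<in> angles G v"
    and fc: "(dual_edge G {v, c}, dual_edge G {v, d}) \<in> face_cycle H F"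
  shows "(lface v d, lface c v) \<in> angles H (lface v c)" "left_face H (lface v c) (lface v d) F"
proof -
  obtain w x y where w: "dual_edge G {v, c} = {w, y}" "dual_edge G {v, d} = {w, x}"
    "(x, y) \<in> angles H w" "left_face H w x F"
    using face_cycleE[OF fc] by metis
  note e = dual_edges_at_angle[OF cd]
  have "w = lface v c \<and> y = lface c v \<and> x = lface v d"
    by (rule doubleton_common[OF w(1)[symmetric, unfolded e(1)] w(2)[symmetric, unfolded e(2)] e(3,4)])
  then have "w = lface v c" "x = lface v d" "y = lface c v" by simp_all
  then show "(lface v d, lface c v) \<in> angles H (lface v c)" "left_face H (lface v c) (lface v d) F"
    using w(3,4) by (simp_all only:)
qed

lemma vertex_cycle_mem: "(c, d) \<in> angles G v \<Longrightarrow>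
   (dual_edge G {v, c}, dual_edge G {v, d}) \<in> map_prod (dual_edge G) (dual_edge G) ` vertex_cycle G v"
  by (force simp: vertex_cycle_def)

lemma left_dart:
  assumes v: "v \<in> verts G" and l: "left_face H w a (\<Phi> v)"
  obtains c where "c \<in> neighbours G v" "{w, a} = dual_edge G {v, c}"
proof -
  have e: "{w, a} \<in> edges H" using l by (simp add: left_face_def)
  obtain b where b: "(a, b) \<in> angles H w" using H.angle_from[of a w] e by (auto simp: neighbours_def simp del: H_simps)
  have w: "w \<in> verts H" using H.edgeD[OF e] by simp
  have fc: "({w, b}, {w, a}) \<in> face_cycle H (\<Phi> v)" using b l w unfolding face_cycle_def by blast
  have "\<exists>c\<in>neighbours G v. {w, a} = dual_edge G {v, c}"
  proof (cases rule: orientation)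
    case reversed
    have "({w, a}, {w, b}) \<in> map_prod (dual_edge G) (dual_edge G) ` vertex_cycle G v"
      unfolding reversed[OF v] using fc by simp
    then show ?thesis by (auto simp: vertex_cycle_def dest: angleD)
  next
    case preserved
    have "({w, b}, {w, a}) \<in> map_prod (dual_edge G) (dual_edge G) ` vertex_cycle G v"
      unfolding preserved[OF v] by (rule fc)
    then show ?thesis by (auto simp: vertex_cycle_def dest: angleD)
  qed
  then show thesis using that by blast
qed

definition boundary :: "'v \<Rightarrow> complex set" where
  "boundary v = (\<Union>c\<in>neighbours G v. edge_segment H (dual_edge G {v, c}))"

definition corner_points :: "'v \<Rightarrow> complex set" where
  "corner_points v = (\<lambda>c. \<rho>' (lface v c)) ` neighbours G v"

lemma angle_segment:
  assumes cd: "(c, d) \<in> angles G v"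
  shows "edge_segment H (dual_edge G {v, d}) = closed_segment (\<rho>' (lface v c)) (\<rho>' (lface v d))"
proof -
  have n: "{v, d} \<in> edges G" using angleD[OF cd] neighboursD by blast
  show ?thesis
    unfolding dual_edge_eq[OF n] edge_segment_pair angle_lface[OF cd] by (simp add: closed_segment_commute)
qed

text \<open>Consecutive dual edges share an end, these ends are distinct because the faces around \<open>v\<close> are, and
the reciprocal has no crossings. The degree is at least three, because the two dual edges at a
vertex of degree two would be parallel.\<close>

lemma dual_polygon:
  assumes cs: "distinct cs" "set cs = neighbours G v" "v \<in> verts G"
    and ang: "angles G v = (\<lambda>i. (cs ! i, cyc_next cs i)) ` {..<length cs}"
  shows dual_polygon_jordan: "jordan_polygon (map (\<lambda>c. \<rho>' (lface v c)) cs)"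
    and dual_polygon_boundary: "polygon_boundary (map (\<lambda>c. \<rho>' (lface v c)) cs) = boundary v"
proof -
  let ?f = "\<lambda>c. \<rho>' (lface v c)"
  define n where "n = length cs"
  have ne: "cs \<noteq> []" using neighbours_ne[OF cs(3)] cs(2) by auto
  have an: "(cs ! i, cyc_next cs i) \<in> angles G v" if "i < n" for i using that ang by (auto simp: n_def)
  have seg: "closed_segment (map ?f cs ! i) (cyc_next (map ?f cs) i) = edge_segment H (dual_edge G {v, cyc_next cs i})"
    if "i < n" for i
    using angle_segment[OF an[OF that]] that by (simp add: cyc_next_map[OF ne] n_def)
  have n3: "3 \<le> n"
  proof (rule ccontr)
    assume "\<not> 3 \<le> n"
    then have "n = 1 \<or> n = 2" using ne by (cases n) (auto simp: n_def)
    then show False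
    proof
      assume n1: "n = 1"
      then have "cyc_next cs 0 = cs ! 0" by (simp add: cyc_next_def flip: n_def)
      then show False using angle_ne[OF an[of 0]] n1 by simp
    next
      assume n2: "n = 2"
      have nx: "cyc_next cs 0 = cs ! 1" "cyc_next cs 1 = cs ! 0" using n2 by (simp_all add: cyc_next_def flip: n_def)
      have a: "(cs ! 0, cs ! 1) \<in> angles G v" "(cs ! 1, cs ! 0) \<in> angles G v" using an[of 0] an[of 1] n2 nx by simp_all
      have "{v, cs ! 0} \<in> edges G" "{v, cs ! 1} \<in> edges G" using angleD[OF a(1)] neighboursD by blast+
      then have "dual_edge G {v, cs ! 0} = dual_edge G {v, cs ! 1}"
        using angle_lface[OF a(1)] angle_lface[OF a(2)] by (simp add: dual_edge_eq insert_commute)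
      then show False using dual_edges_distinct[of "cs ! 0" v "cs ! 1"] angleD[OF a(1)] angle_ne[OF a(1)] by simp
    qed
  qed
  have "inj_on ?f (set cs)"
  proof (rule inj_onI)
    fix c d assume cd: "c \<in> set cs" "d \<in> set cs" "\<rho>' (lface v c) = \<rho>' (lface v d)"
    then have "lface v c = lface v d"
      using H.inj_pos lface_in_faces cs(2) neighboursD(1) by (auto simp: inj_on_def)
    then show "c = d" using lface_inj cd cs(2) by blast
  qed
  then have dist: "distinct (map ?f cs)" using cs(1) by (simp add: distinct_map)
  have nxt_inj: "cyc_next cs i \<noteq> cyc_next cs j" if "i < n" "j < n" "i \<noteq> j" for i j
    using cyc_next_bij[OF cs(1)] that by (auto simp: bij_betw_def inj_on_def n_def)
  have nxt_in: "cyc_next cs i \<in> neighbours G v" if "i < n" for i using an[OF that] angleD by blast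
  show "jordan_polygon (map ?f cs)"
    unfolding jordan_polygon_def
  proof (intro conjI allI impI)
    fix i j assume ij: "i < length (map ?f cs)" "j < length (map ?f cs)" "i \<noteq> j"
    then have ij': "i < n" "j < n" by (simp_all add: n_def)
    let ?e = "\<lambda>i. dual_edge G {v, cyc_next cs i}"
    have de: "?e i = {lface v (cs ! i), lface v (cyc_next cs i)}" if "i < n" for i
      using dual_edge_eq[OF neighboursD(1)[OF nxt_in[OF that]]] angle_lface[OF an[OF that]]
      by (simp add: insert_commute)
    have "?e i \<noteq> ?e j" using dual_edges_distinct nxt_in nxt_inj ij' ij(3) by blast
    moreover have "?e i \<in> edges H" "?e j \<in> edges H" using nxt_in ij' neighboursD(1) by auto
    ultimately have "edge_segment H (?e i) \<inter> edge_segment H (?e j) \<subseteq> \<rho>' ` (?e i \<inter> ?e j)"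
      using H.edges_meet[of "?e i" "?e j"] by simp
    also have "\<dots> \<subseteq> \<rho>' ` ?e i \<inter> \<rho>' ` ?e j" by blast
    also have "\<dots> = {map ?f cs ! i, cyc_next (map ?f cs) i} \<inter> {map ?f cs ! j, cyc_next (map ?f cs) j}"
      using ij' by (simp add: de cyc_next_map[OF ne] n_def)
    finally show "closed_segment (map ?f cs ! i) (cyc_next (map ?f cs) i) \<inter>
          closed_segment (map ?f cs ! j) (cyc_next (map ?f cs) j)
        \<subseteq> {map ?f cs ! i, cyc_next (map ?f cs) i} \<inter> {map ?f cs ! j, cyc_next (map ?f cs) j}"
      using seg ij' by simp
  qed (use n3 dist in \<open>simp_all add: n_def\<close>)
  have "polygon_boundary (map ?f cs) = (\<Union>i<n. edge_segment H (dual_edge G {v, cyc_next cs i}))"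
    unfolding polygon_boundary_def using seg by (simp add: n_def)
  also have "\<dots> = (\<Union>c\<in>cyc_next cs ` {..<n}. edge_segment H (dual_edge G {v, c}))" by simp
  also have "cyc_next cs ` {..<n} = neighbours G v"
    using cyc_next_bij[OF cs(1)] unfolding cs(2) bij_betw_def n_def by blast
  also have "(\<Union>c\<in>neighbours G v. edge_segment H (dual_edge G {v, c})) = boundary v"
    by (simp add: boundary_def)
  finally show "polygon_boundary (map ?f cs) = boundary v" .
qed

lemma boundary_jordan:
  assumes "v \<in> verts G"
  obtains c where "simple_path c" "pathfinish c = pathstart c" "path_image c = boundary v"
proof -
  obtain cs where cs: "distinct cs" "set cs = neighbours G v"
    "angles G v = (\<lambda>i. (cs ! i, cyc_next cs i)) ` {..<length cs}"
    using rotation_list[OF neighbours_ne[OF assms]] by metis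
  show thesis
    using jordan_polygon_path[OF dual_polygon_jordan[OF cs(1,2) assms cs(3)]] that
    unfolding dual_polygon_boundary[OF cs(1,2) assms cs(3)] by blast
qed

lemma boundary_subset: "boundary v \<subseteq> drawing H"
proof -
  have "edge_segment H (dual_edge G {v, c}) \<subseteq> drawing H" if "c \<in> neighbours G v" for c
    by (rule H.edge_segment_subset) (use neighboursD(1)[OF that] in simp)
  then show ?thesis by (auto simp: boundary_def)
qed

lemma dual_face_component:
  assumes v: "v \<in> verts G" shows "\<Phi> v \<in> components (- boundary v)"
proof (rule H.face_is_component[OF \<Phi>_face[OF v] boundary_subset])
  obtain c where "simple_path c" "path_image c = boundary v" using boundary_jordan[OF v] .
  then show "closed (boundary v)" by (metis closed_path_image simple_path_imp_path)
next
  fix i j assume e: "{i, j} \<in> edges H" "H.lface i j = \<Phi> v"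
  then have "left_face H i j (\<Phi> v)" using H.left_face_lface by metis
  then obtain c where "c \<in> neighbours G v" "{i, j} = dual_edge G {v, c}" using left_dart[OF v] by blast
  then show "edge_segment H {i, j} \<subseteq> boundary v" by (auto simp: boundary_def)
next
  fix w assume "w \<in> verts H"
  then show "neighbours H w \<noteq> {}" using dual_neighbours_ne by simp
qed

text \<open>The face that corresponds to \<open>v\<close> is a component of the complement of a Jordan curve, hence one of
its two sides.\<close>

lemma dual_face_inside_outside:
  assumes v: "v \<in> verts G"
  shows "\<Phi> v = (if bounded (\<Phi> v) then inside (boundary v) else outside (boundary v))"
    and "frontier (\<Phi> v) = boundary v" and "frontier (inside (boundary v)) = boundary v"
    and "inside (boundary v) \<noteq> {}" and "open (inside (boundary v))"
    and "bounded (inside (boundary v))"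
proof -
  obtain c where c: "simple_path c" "pathfinish c = pathstart c" "path_image c = boundary v"
    using boundary_jordan[OF v] .
  note J = Jordan_inside_outside[OF c(1,2), unfolded c(3)]
  note C = dual_face_component[OF v]
  have max: "U = \<Phi> v" if "connected U" "\<Phi> v \<inter> U \<noteq> {}" "U \<inter> boundary v = {}" "\<Phi> v \<subseteq> U" for U
    using components_maximal[OF C that(1)] that by blast
  have ne: "\<Phi> v \<noteq> {}" by (rule in_components_nonempty[OF C])
  have "closed (boundary v)" using closed_path_image[OF simple_path_imp_path[OF c(1)]] c(3) by simp
  then have "\<Phi> v \<subseteq> inside (boundary v) \<or> \<Phi> v \<subseteq> outside (boundary v)"
    using connected_inside_or_outside[OF in_components_connected[OF C]] in_components_subset[OF C] by blast
  then have "\<Phi> v = outside (boundary v) \<or> \<Phi> v = inside (boundary v)"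
  proof
    assume "\<Phi> v \<subseteq> inside (boundary v)"
    then have "inside (boundary v) = \<Phi> v" using J ne by (intro max) auto
    then show ?thesis by simp
  next
    assume "\<Phi> v \<subseteq> outside (boundary v)"
    then have "outside (boundary v) = \<Phi> v" using J ne by (intro max) auto
    then show ?thesis by simp
  qed
  then show "\<Phi> v = (if bounded (\<Phi> v) then inside (boundary v) else outside (boundary v))"
    "frontier (\<Phi> v) = boundary v" using J by auto
  show "frontier (inside (boundary v)) = boundary v" "inside (boundary v) \<noteq> {}" "open (inside (boundary v))"
    "bounded (inside (boundary v))"
    using J by simp_all
qed

lemma finite_corner_points: "finite (corner_points v)"
  by (simp add: corner_points_def finite_neighbours)

lemma lface_corner_point:
  assumes c: "c \<in> neighbours G v"
  shows "\<rho>' (lface v c) \<in> corner_points v" "\<rho>' (lface c v) \<in> corner_points v"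
proof -
  show "\<rho>' (lface v c) \<in> corner_points v" using c by (simp add: corner_points_def)
  obtain b where b: "(b, c) \<in> angles G v" using angle_to[OF c] .
  then show "\<rho>' (lface c v) \<in> corner_points v"
    using imageI[of b "neighbours G v" "\<lambda>c. \<rho>' (lface v c)"] angle_lface[OF b] angleD[OF b]
    unfolding corner_points_def by simp
qed

lemma boundary_hull: "boundary v \<subseteq> convex hull (corner_points v)"
proof -
  have "edge_segment H (dual_edge G {v, c}) \<subseteq> convex hull (corner_points v)" if "c \<in> neighbours G v" for c
    unfolding dual_edge_eq[OF neighboursD(1)[OF that]] edge_segment_def
    using lface_corner_point[OF that] by (intro hull_mono) simp
  then show ?thesis by (auto simp: boundary_def)
qed

lemma inside_boundary_hull: "inside (boundary v) \<subseteq> convex hull (corner_points v)"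
proof -
  have "convex hull (boundary v) \<subseteq> convex hull (corner_points v)"
    by (rule hull_minimal[OF boundary_hull]) simp
  then show ?thesis using inside_subset_convex_hull by blast
qed

lemma bounded_face_closure_hull:
  assumes v: "v \<in> verts G" and b: "bounded (\<Phi> v)"
  shows "closure (\<Phi> v) \<subseteq> convex hull (corner_points v)"
proof (rule closure_minimal)
  show "\<Phi> v \<subseteq> convex hull (corner_points v)"
    using dual_face_inside_outside(1)[OF v] b inside_boundary_hull by simp
  show "closed (convex hull (corner_points v))"
    by (intro compact_imp_closed finite_imp_compact_convex_hull finite_corner_points)
qed

text \<open>Bounded faces lie in the convex hull of their corners, and a corner that is not strictly convex is
the midpoint of a segment in this hull.\<close>

lemma wide_corner:
  assumes v: "v \<in> verts G" and b: "bounded (\<Phi> v)"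
    and ab: "(x, y) \<in> angles H w" and l: "left_face H w x (\<Phi> v)" and wide: "pi \<le> angle_size H w (x, y)"
  obtains t where "0 < t" "\<rho>' w + of_real t * (\<rho>' x - \<rho>' w) \<in> convex hull (corner_points v)"
    "\<rho>' w - of_real t * (\<rho>' x - \<rho>' w) \<in> convex hull (corner_points v)"
proof -
  have "\<Phi> v = H.lface w x" using l H.left_face_iff by blast
  then show thesis
    using H.wide_angle_closure[OF ab wide] bounded_face_closure_hull[OF v b] that by (metis H_simps(3) subsetD)
qed

end

section \<open>Angles of the reciprocal and its orientation\<close>

lemma prod_neg_even:
  fixes g :: "'a \<Rightarrow> real"
  assumes "finite A" "\<And>a. a \<in> A \<Longrightarrow> g a \<noteq> 0"
  shows "0 < prod g A \<longleftrightarrow> even (card {a \<in> A. g a < 0})"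
  using assms
proof (induction A)
  case (insert x A)
  have nz: "prod g A \<noteq> 0" using insert by simp
  have IH: "0 < prod g A \<longleftrightarrow> even (card {a \<in> A. g a < 0})" using insert by simp
  show ?case
  proof (cases "g x < 0")
    case True
    then have "{a \<in> insert x A. g a < 0} = insert x {a \<in> A. g a < 0}" by auto
    moreover have "0 < g x * prod g A \<longleftrightarrow> \<not> 0 < prod g A" using True nz by (auto simp: zero_less_mult_iff)
    ultimately show ?thesis using insert IH by simp
  next
    case False
    then have "{a \<in> insert x A. g a < 0} = {a \<in> A. g a < 0}" by auto
    moreover have "0 < g x" using False insert.prems[of x] by simp
    ultimately show ?thesis using insert IH by (simp add: zero_less_mult_iff)
  qed
qed simp

context reciprocal_pair begin

lemma unbounded_dual_face:
  obtains v\<^sub>0 where "v\<^sub>0 \<in> verts G" "\<not> bounded (\<Phi> v\<^sub>0)" "\<And>v. v \<in> verts G \<Longrightarrow> v \<noteq> v\<^sub>0 \<Longrightarrow> bounded (\<Phi> v)"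
proof -
  have bd: "bounded (- (- drawing H))" using compact_imp_bounded[OF H.drawing_compact] by (simp only: double_complement)
  obtain C where C: "C \<in> faces H" "\<not> bounded C"
    using cobounded_unbounded_components[OF bd] unfolding faces_def by blast
  then obtain v\<^sub>0 where v0: "v\<^sub>0 \<in> verts G" "\<Phi> v\<^sub>0 = C" using bij_betw_imp_surj_on[OF \<Phi>_bij] by (metis imageE)
  show thesis
  proof (rule that[OF v0(1)])
    show "\<not> bounded (\<Phi> v\<^sub>0)" using v0 C by simp
    fix v assume v: "v \<in> verts G" "v \<noteq> v\<^sub>0"
    show "bounded (\<Phi> v)"
    proof (rule ccontr)
      assume "\<not> bounded (\<Phi> v)"
      then have "\<Phi> v = C"
        using cobounded_unique_unbounded_components[OF bd C[unfolded faces_def] \<Phi>_face[OF v(1), unfolded faces_def]] by simp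
      then have "\<Phi> v = \<Phi> v\<^sub>0" using v0 by simp
      then show False using inj_onD[OF bij_betw_imp_inj_on[OF \<Phi>_bij] _ v(1) v0(1)] v(2) by simp
    qed
  qed
qed

lemma dual_edge_vectors:
  assumes cd: "(c, d) \<in> angles G v"
  shows "\<rho>' (lface c v) - \<rho>' (lface v c) = - (\<omega> {v, c} *\<^sub>R (pos G c - pos G v))"
    and "\<rho>' (lface v d) - \<rho>' (lface v c) = \<omega> {v, d} *\<^sub>R (pos G d - pos G v)"
proof -
  have n: "{v, c} \<in> edges G" "{v, d} \<in> edges G" using angleD[OF cd] neighboursD by blast+
  show "\<rho>' (lface c v) - \<rho>' (lface v c) = - (\<omega> {v, c} *\<^sub>R (pos G c - pos G v))"
    using reciprocal_vector[OF n(1)] by (metis minus_diff_eq)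
  show "\<rho>' (lface v d) - \<rho>' (lface v c) = \<omega> {v, d} *\<^sub>R (pos G d - pos G v)"
    using reciprocal_vector[OF n(2)] angle_lface[OF cd] by simp
qed

text \<open>The angle of the reciprocal which the edges dual to \<open>{v, c}\<close> and \<open>{v, d}\<close> form inside the face that
corresponds to \<open>v\<close>, provided that duality reverses orientations. Otherwise that angle is its
complement to \<open>2\<pi>\<close>.\<close>

definition dual_angle :: "'v \<Rightarrow> 'v \<times> 'v \<Rightarrow> real" where
  "dual_angle v = (\<lambda>(c, d). angle_size H (lface v c) (lface c v, lface v d))"

text \<open>The edge vectors of the reciprocal are those of the framework, scaled by the stress. So the angle
depends only on the angle at \<open>v\<close> and on the presence of a sign change.\<close>

lemma dual_angle_eq:
  assumes cd: "(c, d) \<in> angles G v"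
  shows "dual_angle v (c, d) =
    (if \<omega> {v, c} * \<omega> {v, d} < 0 then angle_size G v (c, d)
     else if angle_size G v (c, d) > pi then angle_size G v (c, d) - pi
     else angle_size G v (c, d) + pi)"
proof -
  have n: "c \<in> neighbours G v" "d \<in> neighbours G v" using angleD[OF cd] by auto
  have nz: "\<omega> {v, c} \<noteq> 0" "\<omega> {v, d} \<noteq> 0" using n stress_nz neighboursD(1) by blast+
  show ?thesis
    unfolding dual_angle_def angle_size_def prod.case H_simps dual_edge_vectors[OF cd]
    by (rule ccw_angle_scaled[OF neighboursD(6)[OF n(1)] neighboursD(6)[OF n(2)] nz])
qed

lemma corner_hull_le:
  assumes "\<And>e. e \<in> neighbours G v \<Longrightarrow> D \<bullet> \<rho>' (lface v e) \<le> M" "z \<in> convex hull (corner_points v)"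
  shows "D \<bullet> z \<le> M"
proof -
  have "convex hull (corner_points v) \<subseteq> {z. D \<bullet> z \<le> M}"
    by (rule hull_minimal) (use assms(1) convex_halfspace_le in \<open>auto simp: corner_points_def\<close>)
  then show ?thesis using assms(2) by blast
qed

text \<open>Suppose that \<open>v\<close> is extreme in direction \<open>D\<close> and that duality preserves orientations. All dual edges
are then strictly monotone in direction \<open>D\<close>, and at the corner of the dual face that is highest in
this direction one of them ascends and the other descends. So there is a sign change, the angle
there is \<open>2\<pi>\<close> minus the angle at \<open>v\<close>, and being extreme it is less than \<open>\<pi>\<close>. The factor \<open>s\<close> allows
\<open>D\<close> to be replaced by its opposite.\<close>

lemma preserved_extreme_reflex:
  assumes v: "v \<in> verts G" and b: "bounded (\<Phi> v)"
    and pres: "map_prod (dual_edge G) (dual_edge G) ` vertex_cycle G v = face_cycle H (\<Phi> v)"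
    and D: "\<And>c. c \<in> neighbours G v \<Longrightarrow> s * (D \<bullet> (pos G c - pos G v)) < 0"
  obtains c d where "(c, d) \<in> reflex_angles G v" "s * \<omega> {v, c} < 0"
proof -
  define f where "f c = D \<bullet> \<rho>' (lface v c)" for c
  have fin: "finite (f ` neighbours G v)" "f ` neighbours G v \<noteq> {}"
    using finite_neighbours neighbours_ne[OF v] by auto
  obtain c where c: "c \<in> neighbours G v" "f c = Max (f ` neighbours G v)" using Max_in[OF fin] by auto
  have max: "D \<bullet> z \<le> f c" if "z \<in> convex hull (corner_points v)" for z
    by (rule corner_hull_le[OF _ that]) (use Max_ge[OF fin(1)] c(2) in \<open>auto simp: f_def\<close>)
  obtain d where cd: "(c, d) \<in> angles G v" using angle_from[OF c(1)] .
  have d: "d \<in> neighbours G v" using angleD[OF cd] by simp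
  note vec = dual_edge_vectors[OF cd]
  define X Y where "X = D \<bullet> (pos G c - pos G v)" and "Y = D \<bullet> (pos G d - pos G v)"
  have XY: "s * X < 0" "s * Y < 0" using D c(1) d by (auto simp: X_def Y_def)
  have nz: "\<omega> {v, c} \<noteq> 0" "\<omega> {v, d} \<noteq> 0" using c(1) d stress_nz neighboursD(1) by blast+
  have hull: "\<rho>' (lface v d) \<in> convex hull (corner_points v)" "\<rho>' (lface c v) \<in> convex hull (corner_points v)"
    using lface_corner_point c(1) d by (auto intro: hull_inc)
  have "D \<bullet> (\<rho>' (lface v d) - \<rho>' (lface v c)) \<le> 0" "D \<bullet> (\<rho>' (lface c v) - \<rho>' (lface v c)) \<le> 0"
    using max[OF hull(1)] max[OF hull(2)] by (simp_all add: f_def inner_diff_right)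
  then have le: "\<omega> {v, d} * Y \<le> 0" "0 \<le> \<omega> {v, c} * X"
    unfolding vec by (simp_all add: X_def Y_def)
  have sc: "s * \<omega> {v, c} < 0" using XY(1) le(2) nz by (auto simp: mult_less_0_iff zero_le_mult_iff)
  have sd: "s * \<omega> {v, d} > 0" using XY(2) le(1) nz by (auto simp: mult_less_0_iff mult_le_0_iff zero_less_mult_iff)
  have opp: "\<omega> {v, d} * \<omega> {v, c} < 0" using sc sd by (auto simp: mult_less_0_iff zero_less_mult_iff)
  have fc: "(dual_edge G {v, c}, dual_edge G {v, d}) \<in> face_cycle H (\<Phi> v)"
    using vertex_cycle_mem[OF cd] unfolding pres .
  note corner = face_cycleD'[OF cd fc]
  define \<theta> where "\<theta> = angle_size H (lface v c) (lface v d, lface c v)"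
  have "\<theta> < pi"
  proof (rule ccontr)
    assume "\<not> \<theta> < pi"
    then have "pi \<le> angle_size H (lface v c) (lface v d, lface c v)" by (simp add: \<theta>_def)
    from wide_corner[OF v b corner this] obtain t where t: "0 < t"
      "\<rho>' (lface v c) + of_real t * (\<rho>' (lface v d) - \<rho>' (lface v c)) \<in> convex hull (corner_points v)"
      "\<rho>' (lface v c) - of_real t * (\<rho>' (lface v d) - \<rho>' (lface v c)) \<in> convex hull (corner_points v)" .
    have "D \<bullet> (of_real t * (\<rho>' (lface v d) - \<rho>' (lface v c))) = t * (\<omega> {v, d} * Y)"
      unfolding vec by (simp add: Y_def flip: scaleR_conv_of_real)
    then have "t * (\<omega> {v, d} * Y) \<le> 0" "- (t * (\<omega> {v, d} * Y)) \<le> 0"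
      using max[OF t(2)] max[OF t(3)] by (simp_all add: f_def inner_add_right inner_diff_right)
    then have "\<omega> {v, d} * Y = 0" using t(1) by (auto simp: zero_le_mult_iff mult_le_0_iff)
    then show False using nz XY by auto
  qed
  have zc: "pos G c - pos G v \<noteq> 0" "pos G d - pos G v \<noteq> 0" using neighboursD(6) c(1) d by auto
  have "\<theta> = ccw_angle (- ((- \<omega> {v, d}) *\<^sub>R (pos G d - pos G v))) ((- \<omega> {v, c}) *\<^sub>R (pos G c - pos G v))"
    unfolding \<theta>_def angle_size_def prod.case H_simps vec by simp
  also have "\<dots> = ccw_angle (pos G d - pos G v) (pos G c - pos G v)"
    using ccw_angle_scaled[OF zc(2,1), of "- \<omega> {v, d}" "- \<omega> {v, c}"] nz opp by simp
  finally have "ccw_angle (pos G c - pos G v) (pos G d - pos G v) = 2 * pi - \<theta>"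
    using ccw_angle_swap[OF zc(2,1)] \<open>\<theta> < pi\<close> pi_gt_zero by simp
  then have "(c, d) \<in> reflex_angles G v"
    using cd \<open>\<theta> < pi\<close> by (simp add: reflex_angles_def angle_size_def)
  then show thesis using that sc by blast
qed

text \<open>The neighbours of a vertex farthest from \<open>q\<close> lie in a disc that has this vertex on its boundary.\<close>

lemma farthest_vertex:
  obtains v where "v \<in> verts G" "\<forall>w\<in>verts G. dist q (pos G w) \<le> dist q (pos G v)"
    "\<forall>c\<in>neighbours G v. (pos G v - q) \<bullet> (pos G c - pos G v) < 0"
proof -
  define f where "f v = dist q (pos G v)" for v
  have fin: "finite (f ` verts G)" "f ` verts G \<noteq> {}"
    using finite_verts two_conn by (auto simp: two_connected_def)
  obtain v where v: "v \<in> verts G" "f v = Max (f ` verts G)" using Max_in[OF fin] by auto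
  have max: "f w \<le> f v" if "w \<in> verts G" for w using Max_ge[OF fin(1)] v(2) that by auto
  show thesis
  proof (rule that[OF v(1)])
    show "\<forall>w\<in>verts G. dist q (pos G w) \<le> dist q (pos G v)" using max by (simp add: f_def)
    show "\<forall>c\<in>neighbours G v. (pos G v - q) \<bullet> (pos G c - pos G v) < 0"
    proof
    fix c assume c: "c \<in> neighbours G v"
    define p u where "p = pos G v - q" and "u = pos G c - pos G v"
    have "norm (p + u) \<le> norm p"
      using max[OF neighboursD(4)[OF c]] by (simp add: f_def p_def u_def dist_norm norm_minus_commute)
    then have "(p + u) \<bullet> (p + u) \<le> p \<bullet> p" by (simp add: norm_le)
    then have "2 * (p \<bullet> u) + u \<bullet> u \<le> 0" by (simp add: inner_add_left inner_add_right inner_commute)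
    moreover have "0 < u \<bullet> u" using neighboursD(6)[OF c] by (simp add: u_def)
    ultimately have "p \<bullet> u < 0" by linarith
    then show "(pos G v - q) \<bullet> (pos G c - pos G v) < 0" by (simp add: p_def u_def)
    qed
  qed
qed

text \<open>If duality preserved orientations, take a vertex that is extreme in some direction and whose dual
face is bounded. The highest and the lowest corner of this face come from reflex angles with sign
changes in opposite senses, and hence from different reflex angles at one vertex. Two candidates
for the vertex are considered, because the dual face of one of them could be unbounded.\<close>

lemma reversed:
  assumes v: "v \<in> verts G"
  shows "map_prod (dual_edge G) (dual_edge G) ` vertex_cycle G v = (face_cycle H (\<Phi> v))\<inverse>"
proof (cases rule: orientation)
  case reversed
  then show ?thesis using v by blast
next
  case pres: preserved
  have contra: False if v: "v \<in> verts G" "bounded (\<Phi> v)"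
    and D: "\<And>c. c \<in> neighbours G v \<Longrightarrow> D \<bullet> (pos G c - pos G v) < 0" for v D
  proof -
    obtain c d where cd: "(c, d) \<in> reflex_angles G v" "1 * \<omega> {v, c} < 0"
      by (rule preserved_extreme_reflex[OF v pres[OF v(1)], of 1 D]) (use D in auto)
    obtain c' d' where cd': "(c', d') \<in> reflex_angles G v" "(- 1) * \<omega> {v, c'} < 0"
      by (rule preserved_extreme_reflex[OF v pres[OF v(1)], of "- 1" "- D"]) (use D in auto)
    show False using reflex_angle_unique[OF cd(1) cd'(1)] cd(2) cd'(2) by simp
  qed
  obtain v1 where v1: "v1 \<in> verts G" "\<forall>c\<in>neighbours G v1. (pos G v1 - 0) \<bullet> (pos G c - pos G v1) < 0"
    using farthest_vertex[of 0] by metis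
  obtain v2 where v2: "v2 \<in> verts G" "\<forall>w\<in>verts G. dist (pos G v1) (pos G w) \<le> dist (pos G v1) (pos G v2)"
    "\<forall>c\<in>neighbours G v2. (pos G v2 - pos G v1) \<bullet> (pos G c - pos G v2) < 0"
    using farthest_vertex[of "pos G v1"] .
  have "v1 \<noteq> v2"
  proof
    assume eq: "v1 = v2"
    obtain c where c: "c \<in> neighbours G v1" using neighbours_ne[OF v1(1)] by blast
    then show False using bspec[OF v2(2) neighboursD(4)[OF c]] neighboursD(6)[OF c] eq by simp
  qed
  then have "bounded (\<Phi> v1) \<or> bounded (\<Phi> v2)" using unbounded_dual_face v1(1) v2(1) by metis
  then have False
  proof
    assume "bounded (\<Phi> v1)" then show False using contra[OF v1(1)] v1(2) by blast
  next
    assume "bounded (\<Phi> v2)" then show False using contra[OF v2(1)] v2(3) by blast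
  qed
  then show ?thesis ..
qed

lemma dual_corner:
  assumes cd: "(c, d) \<in> angles G v"
  shows "(lface c v, lface v d) \<in> angles H (lface v c)" "left_face H (lface v c) (lface c v) (\<Phi> v)"
proof -
  have v: "v \<in> verts G" using angleD[OF cd] neighboursD by blast
  have "(dual_edge G {v, d}, dual_edge G {v, c}) \<in> face_cycle H (\<Phi> v)"
    using vertex_cycle_mem[OF cd] unfolding reversed[OF v] by simp
  from face_cycleD[OF cd this] show "(lface c v, lface v d) \<in> angles H (lface v c)"
    "left_face H (lface v c) (lface c v) (\<Phi> v)" by auto
qed

text \<open>Every extreme point of the convex hull of the face is a strictly convex corner, and a hull with
nonempty interior has at least three extreme points.\<close>

lemma three_convex_corners:
  assumes v: "v \<in> verts G" and b: "bounded (\<Phi> v)"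
  shows "3 \<le> card {\<alpha> \<in> angles G v. dual_angle v \<alpha> < pi}"
proof (rule ccontr)
  assume neg: "\<not> ?thesis"
  define A where "A = {\<alpha> \<in> angles G v. dual_angle v \<alpha> < pi}"
  define K where "K = convex hull (corner_points v)"
  define X where "X = {x. x extreme_point_of K}"
  have finA: "finite A" by (simp add: A_def finite_angles)
  have X: "X \<subseteq> (\<lambda>\<alpha>. \<rho>' (lface v (fst \<alpha>))) ` A"
  proof
    fix x assume "x \<in> X"
    then have ext: "x extreme_point_of K" by (simp add: X_def)
    then have "x \<in> corner_points v" unfolding K_def by (rule extreme_point_of_convex_hull)
    then obtain c where c: "c \<in> neighbours G v" "x = \<rho>' (lface v c)" by (auto simp: corner_points_def)
    obtain d where cd: "(c, d) \<in> angles G v" using angle_from[OF c(1)] .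
    have "dual_angle v (c, d) < pi"
    proof (rule ccontr)
      assume "\<not> dual_angle v (c, d) < pi"
      then have "pi \<le> angle_size H (lface v c) (lface c v, lface v d)" by (simp add: dual_angle_def)
      from wide_corner[OF v b dual_corner[OF cd] this] obtain t where t: "0 < t"
        "x + of_real t * (\<rho>' (lface c v) - x) \<in> K" "x - of_real t * (\<rho>' (lface c v) - x) \<in> K"
        unfolding c(2) K_def .
      \<comment> \<open>the corner is the midpoint of \<open>x + y\<close> and \<open>x - y\<close>, both in the hull\<close>
      define y where "y = of_real t * (\<rho>' (lface c v) - x)"
      have "\<rho>' (lface c v) \<noteq> x" using H.edgeD(4)[OF dual_edge_in[OF neighboursD(1)[OF c(1)]]] c(2) by simp
      then have y: "y \<noteq> 0" using t(1) by (simp add: y_def)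
      have "x = midpoint (x + y) (x - y)" by (simp add: midpoint_def scaleR_2[symmetric])
      moreover have "x + y \<noteq> x - y"
      proof
        assume "x + y = x - y"
        then have "2 *\<^sub>R y = 0" by (simp add: scaleR_2 algebra_simps)
        then show False using y by simp
      qed
      ultimately have "x \<in> open_segment (x + y) (x - y)" using midpoint_in_open_segment by metis
      then show False using ext t(2,3) unfolding y_def extreme_point_of_def by blast
    qed
    then have "(c, d) \<in> A" using cd by (simp add: A_def)
    then show "x \<in> (\<lambda>\<alpha>. \<rho>' (lface v (fst \<alpha>))) ` A" using c(2) by force
  qed
  have finX: "finite X" using finite_subset[OF X] finA by simp
  have "card X \<le> card ((\<lambda>\<alpha>. \<rho>' (lface v (fst \<alpha>))) ` A)" using finA by (intro card_mono X) simp
  also have "\<dots> \<le> card A" by (rule card_image_le[OF finA])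
  also have "\<dots> \<le> 2" using neg by (simp add: A_def)
  finally have "interior (convex hull X) = {}" using finX by (intro empty_interior_convex_hull) auto
  moreover have "K = convex hull X" unfolding X_def
    by (rule Krein_Milman_Minkowski) (simp_all add: K_def finite_imp_compact_convex_hull finite_corner_points)
  moreover have "\<Phi> v \<subseteq> interior K"
    using bounded_face_closure_hull[OF v b] closure_subset[of "\<Phi> v"] H.face_open[OF \<Phi>_face[OF v]]
    unfolding K_def by (intro interior_maximal) blast
  ultimately show False using H.face_nonempty[OF \<Phi>_face[OF v]] by auto
qed

section \<open>Counting sign changes\<close>

text \<open>In the product of \<open>\<omega> {v, c} * \<omega> {v, d}\<close> over all angles \<open>(c, d)\<close> at \<open>v\<close> each stress occurs twice,
and the negative factors are those at the sign changes.\<close>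

lemma sign_changes_even:
  assumes v: "v \<in> verts G"
  shows "even (card (sign_changes G \<omega> v))"
proof -
  define g where "g c = \<omega> {v, c}" for c
  have nz: "g c \<noteq> 0" if "c \<in> neighbours G v" for c using stress_nz neighboursD(1)[OF that] by (simp add: g_def)
  note bij = angles_bij_fst[OF neighbours_ne[OF v]] angles_bij_snd[OF neighbours_ne[OF v]]
  have "(\<Prod>\<alpha>\<in>angles G v. g (fst \<alpha>) * g (snd \<alpha>)) = (\<Prod>c\<in>neighbours G v. g c) * (\<Prod>c\<in>neighbours G v. g c)"
    using prod.reindex_bij_betw[OF bij(1), of g] prod.reindex_bij_betw[OF bij(2), of g] by (simp add: prod.distrib)
  also have "\<dots> > 0" using nz finite_neighbours by (simp add: zero_less_mult_iff not_less_iff_gr_or_eq flip: power2_eq_square)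
  finally have "even (card {\<alpha> \<in> angles G v. g (fst \<alpha>) * g (snd \<alpha>) < 0})"
    using prod_neg_even[OF finite_angles, of v "\<lambda>\<alpha>. g (fst \<alpha>) * g (snd \<alpha>)"] nz angleD by fastforce
  moreover have "{\<alpha> \<in> angles G v. g (fst \<alpha>) * g (snd \<alpha>) < 0} = sign_changes G \<omega> v"
    by (auto simp: sign_changes_def g_def)
  ultimately show ?thesis by simp
qed

definition changes :: "'v \<Rightarrow> nat" where
  "changes v = card (sign_changes G \<omega> v)"

definition plain_reflex :: "'v \<Rightarrow> nat" where
  "plain_reflex v = card (reflex_angles G v - sign_changes G \<omega> v)"

lemma sign_changes_subset: "sign_changes G \<omega> v \<subseteq> angles G v"
  by (auto simp: sign_changes_def)

lemma reflex_angles_subset: "reflex_angles G v \<subseteq> angles G v"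
  by (auto simp: reflex_angles_def)

lemma finite_sign_changes: "finite (sign_changes G \<omega> v)"
  by (rule finite_subset[OF sign_changes_subset finite_angles])

lemma finite_reflex_angles: "finite (reflex_angles G v)"
  by (rule finite_subset[OF reflex_angles_subset finite_angles])

text \<open>For a simple polygon with interior angles \<open>dual_angle\<close>, the sum would be \<open>\<pi> * (deg v - 2)\<close>; for its
exterior it would be \<open>\<pi> * (deg v + 2)\<close>. Accordingly twice the number of reflex angles without sign
change plus the number of sign changes should be \<open>4\<close> or \<open>0\<close>.\<close>

lemma dual_angle_sum:
  assumes v: "v \<in> verts G"
  shows "(\<Sum>\<alpha>\<in>angles G v. dual_angle v \<alpha>) =
     pi * (real (card (neighbours G v)) + 2 - 2 * real (plain_reflex v) - real (changes v))"
proof -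
  let ?S = "sign_changes G \<omega> v" and ?R = "reflex_angles G v - sign_changes G \<omega> v" and ?A = "angles G v"
  have "dual_angle v \<alpha> = angle_size G v \<alpha> + pi - pi * indicator ?S \<alpha> - 2 * pi * indicator ?R \<alpha>" if "\<alpha> \<in> ?A" for \<alpha>
    using that dual_angle_eq[of "fst \<alpha>" "snd \<alpha>" v]
    by (cases \<alpha>) (auto simp: indicator_def sign_changes_def reflex_angles_def split: if_splits)
  then have "(\<Sum>\<alpha>\<in>?A. dual_angle v \<alpha>) =
      (\<Sum>\<alpha>\<in>?A. angle_size G v \<alpha> + pi - pi * indicator ?S \<alpha> - 2 * pi * indicator ?R \<alpha>)" by simp
  also have "\<dots> = 2 * pi + pi * real (card ?A) - pi * (\<Sum>\<alpha>\<in>?A. indicator ?S \<alpha>) - 2 * pi * (\<Sum>\<alpha>\<in>?A. indicator ?R \<alpha>)"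
    using angles_sum[OF neighbours_ne[OF v]]
    by (simp add: sum.distrib sum_subtractf flip: sum_distrib_left)
  also have "(\<Sum>\<alpha>\<in>?A. indicator ?S \<alpha>) = real (changes v)"
    using sign_changes_subset[of v] by (simp add: changes_def indicator_def sum_of_bool_eq finite_angles Int_absorb1)
  also have "(\<Sum>\<alpha>\<in>?A. indicator ?R \<alpha>) = real (plain_reflex v)"
  proof -
    have "?A \<inter> {\<alpha>. \<alpha> \<in> ?R} = ?R" using reflex_angles_subset[of v] by blast
    then have "card (?A \<inter> {\<alpha>. \<alpha> \<in> ?R}) = plain_reflex v" unfolding plain_reflex_def by (rule arg_cong)
    moreover have "(\<Sum>\<alpha>\<in>?A. of_bool (\<alpha> \<in> ?R)) = real (card (?A \<inter> {\<alpha>. \<alpha> \<in> ?R}))"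
      by (rule sum_of_bool_eq) (rule finite_angles)+
    ultimately show ?thesis unfolding indicator_def by (simp only:)
  qed
  also have "card ?A = card (neighbours G v)"
    by (rule bij_betw_same_card[OF angles_bij_fst[OF neighbours_ne[OF v]]])
  finally show ?thesis by (simp add: algebra_simps)
qed

text \<open>Every angle of the reciprocal comes from exactly one angle of the framework, and the angles around
each of its vertices, which are the faces of \<open>G\<close>, add up to \<open>2\<pi>\<close>.\<close>

lemma total_dual_angle:
  "(\<Sum>v\<in>verts G. \<Sum>\<alpha>\<in>angles G v. dual_angle v \<alpha>) = 2 * pi * real (card (faces G))"
proof -
  define f where "f = (\<lambda>(v, c, d). (lface v c, lface c v, lface v d))"
  have "bij_betw f (SIGMA v:verts G. angles G v) (SIGMA w:faces G. angles H w)"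
  proof (rule bij_betw_imageI)
    show "inj_on f (SIGMA v:verts G. angles G v)"
    proof (rule inj_onI)
      fix x y assume x: "x \<in> (SIGMA v:verts G. angles G v)" and y: "y \<in> (SIGMA v:verts G. angles G v)"
        and fxy: "f x = f y"
      obtain v c d where x: "x = (v, c, d)" "(c, d) \<in> angles G v" using x by auto
      obtain v' c' d' where y: "y = (v', c', d')" "(c', d') \<in> angles G v'" using y by auto
      note cd = x(2) y(2)
      have eq: "lface v c = lface v' c'" "lface c v = lface c' v'" using fxy by (auto simp: f_def x(1) y(1))
      have e: "{v, c} \<in> edges G" "{v', c'} \<in> edges G" using angleD cd neighboursD(1) by blast+
      have "dual_edge G {v, c} = dual_edge G {v', c'}" using eq by (simp add: dual_edge_eq e)
      then have "{v, c} = {v', c'}" using inj_onD[OF dual_edge_inj] e by blast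
      moreover have "\<not> (v = c' \<and> c = v')" using eq lface_sides_distinct[OF e(1)] by auto
      ultimately have "v = v'" "c = c'" by (auto simp: doubleton_eq_iff)
      then show "x = y" using cd angle_from_unique unfolding x(1) y(1) by auto
    qed
    show "f ` (SIGMA v:verts G. angles G v) = (SIGMA w:faces G. angles H w)"
    proof (intro equalityI subsetI)
      fix x assume "x \<in> f ` (SIGMA v:verts G. angles G v)"
      then obtain v c d where x: "x = f (v, c, d)" "(c, d) \<in> angles G v" by auto
      then show "x \<in> (SIGMA w:faces G. angles H w)"
        using dual_corner[OF x(2)] lface_in_faces neighboursD(1) angleD[OF x(2)] by (simp add: f_def)
    next
      fix x assume "x \<in> (SIGMA w:faces G. angles H w)"
      then obtain w a b where x: "x = (w, a, b)" "w \<in> faces G" "(a, b) \<in> angles H w" by auto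
      have "{w, a} \<in> edges H" using H.angleD[OF x(3)] H.neighboursD(1) by blast
      then obtain e where e: "e \<in> edges G" "{w, a} = dual_edge G e" by auto
      obtain i j where "e = {i, j}" using edgeE[OF e(1)] by blast
      then have ij: "{i, j} \<in> edges G" "{w, a} = {lface i j, lface j i}" using e dual_edge_eq by auto
      have "\<exists>v c. {v, c} \<in> edges G \<and> w = lface v c \<and> a = lface c v"
        using ij unfolding doubleton_eq_iff by (metis insert_commute)
      then obtain v c where vc: "{v, c} \<in> edges G" "w = lface v c" "a = lface c v" by blast
      then obtain d where cd: "(c, d) \<in> angles G v" using angle_from[of c v] by (auto simp: neighbours_def)
      have "b = lface v d" using H.angle_from_unique dual_corner(1)[OF cd] x(3) vc by blast
      then have "x = f (v, c, d)" using x vc by (simp add: f_def)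
      moreover have "v \<in> verts G" using edgeD[OF vc(1)] by simp
      ultimately show "x \<in> f ` (SIGMA v:verts G. angles G v)" using cd by blast
    qed
  qed
  then have "(\<Sum>x\<in>(SIGMA v:verts G. angles G v). (\<lambda>(w, \<beta>). angle_size H w \<beta>) (f x)) =
      (\<Sum>(w, \<beta>)\<in>(SIGMA w:faces G. angles H w). angle_size H w \<beta>)"
    by (rule sum.reindex_bij_betw)
  also have "\<dots> = (\<Sum>w\<in>faces G. \<Sum>\<beta>\<in>angles H w. angle_size H w \<beta>)"
    by (rule sum.Sigma[symmetric]) (simp_all add: finite_faces H.finite_angles)
  also have "\<dots> = (\<Sum>w\<in>faces G. 2 * pi)"
    by (rule sum.cong[OF refl]) (rule H.angles_sum[OF dual_neighbours_ne])
  also have "\<dots> = 2 * pi * real (card (faces G))" by simp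
  also have "(\<Sum>x\<in>(SIGMA v:verts G. angles G v). (\<lambda>(w, \<beta>). angle_size H w \<beta>) (f x)) =
      (\<Sum>(v, \<alpha>)\<in>(SIGMA v:verts G. angles G v). dual_angle v \<alpha>)"
    by (rule sum.cong) (auto simp: f_def dual_angle_def)
  also have "\<dots> = (\<Sum>v\<in>verts G. \<Sum>\<alpha>\<in>angles G v. dual_angle v \<alpha>)"
    by (rule sum.Sigma[symmetric]) (simp_all add: finite_verts finite_angles)
  finally show ?thesis .
qed

lemma plain_reflex_le: "plain_reflex v + card (sign_changes G \<omega> v \<inter> reflex_angles G v) = card (reflex_angles G v)"
  "card (reflex_angles G v) \<le> 1"
proof -
  note fin = finite_reflex_angles[of v]
  show "plain_reflex v + card (sign_changes G \<omega> v \<inter> reflex_angles G v) = card (reflex_angles G v)"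
    unfolding plain_reflex_def using card_Diff_subset_Int[of "reflex_angles G v" "sign_changes G \<omega> v"]
      card_mono[OF fin, of "reflex_angles G v \<inter> sign_changes G \<omega> v"] fin
    by (simp add: Int_commute)
  show "card (reflex_angles G v) \<le> 1"
    using reflex_angle_unique fin by (auto simp: card_le_Suc0_iff_eq)
qed

text \<open>A strictly convex corner comes from a sign change at an angle that is not reflex, or from a reflex
angle without sign change. There are at least three of them, and parity rules out the value
three.\<close>

lemma turning_lower_bound:
  assumes v: "v \<in> verts G" and b: "bounded (\<Phi> v)"
  shows "4 \<le> 2 * plain_reflex v + changes v"
proof -
  let ?S = "sign_changes G \<omega> v" and ?R = "reflex_angles G v"
  note finS = finite_sign_changes[of v] and finR = finite_reflex_angles[of v]
  have "{\<alpha> \<in> angles G v. dual_angle v \<alpha> < pi} \<subseteq> (?S - ?R) \<union> (?R - ?S)"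
  proof
    fix \<alpha> assume "\<alpha> \<in> {\<alpha> \<in> angles G v. dual_angle v \<alpha> < pi}"
    then show "\<alpha> \<in> (?S - ?R) \<union> (?R - ?S)"
      using dual_angle_eq[of "fst \<alpha>" "snd \<alpha>" v] angle_pos[of v \<alpha>]
      by (cases \<alpha>) (auto simp: sign_changes_def reflex_angles_def split: if_splits)
  qed
  then have "3 \<le> card ((?S - ?R) \<union> (?R - ?S))"
    using three_convex_corners[OF v b] card_mono[of "(?S - ?R) \<union> (?R - ?S)"] finS finR
    by (meson finite_Diff finite_UnI order_trans)
  also have "\<dots> \<le> card (?S - ?R) + card (?R - ?S)" by (rule card_Un_le)
  also have "card (?S - ?R) = changes v - card (?S \<inter> ?R)"
    unfolding changes_def using finS by (simp add: card_Diff_subset_Int)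
  finally have "3 \<le> changes v - card (?S \<inter> ?R) + plain_reflex v" by (simp add: plain_reflex_def)
  moreover have "card (?S \<inter> ?R) \<le> changes v" unfolding changes_def by (intro card_mono finS) auto
  ultimately have "3 \<le> 2 * plain_reflex v + changes v" by linarith
  moreover have "even (2 * plain_reflex v + changes v)" using sign_changes_even[OF v] by (simp add: changes_def)
  moreover have "4 \<le> m" if "3 \<le> m" "even m" for m :: nat using that by presburger
  ultimately show ?thesis by blast
qed

text \<open>The lower bounds for the single vertices add up to \<open>4 * (|V| - 1)\<close>. By the total of the angles of the
reciprocal and Euler's inequality this is also an upper bound for the sum, so that equality holds
at every vertex.\<close>

lemma vertex_turning:
  assumes v0: "v\<^sub>0 \<in> verts G" and b: "\<And>v. v \<in> verts G \<Longrightarrow> v \<noteq> v\<^sub>0 \<Longrightarrow> bounded (\<Phi> v)"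
    and v: "v \<in> verts G"
  shows "2 * plain_reflex v + changes v = (if v = v\<^sub>0 then 0 else 4)"
proof -
  define t where "t v = 2 * plain_reflex v + changes v" for v
  define m where "m v = (if v = v\<^sub>0 then 0 else 4::nat)" for v
  have le: "m v \<le> t v" if "v \<in> verts G" for v
    using turning_lower_bound[OF that b[OF that]] by (auto simp: m_def t_def)
  have "2 * pi * real (card (faces G)) = (\<Sum>v\<in>verts G. pi * (real (card (neighbours G v)) + 2 - real (t v)))"
    using total_dual_angle by (simp add: dual_angle_sum t_def algebra_simps)
  also have "\<dots> = pi * (real (\<Sum>v\<in>verts G. card (neighbours G v)) + 2 * real (card (verts G)) - real (\<Sum>v\<in>verts G. t v))"
    by (simp add: sum_distrib_left[symmetric] sum.distrib sum_subtractf)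
  finally have "pi * (2 * real (card (faces G))) =
      pi * (real (\<Sum>v\<in>verts G. card (neighbours G v)) + 2 * real (card (verts G)) - real (\<Sum>v\<in>verts G. t v))"
    by simp
  then have "2 * real (card (faces G)) =
      real (\<Sum>v\<in>verts G. card (neighbours G v)) + 2 * real (card (verts G)) - real (\<Sum>v\<in>verts G. t v)" by simp
  then have "2 * card (faces G) + (\<Sum>v\<in>verts G. t v) = 2 * card (edges G) + 2 * card (verts G)"
    unfolding sum_degrees by linarith
  moreover have "card (edges G) + 2 \<le> card (verts G) + card (faces G)"
    using euler_inequality[OF finite_faces] v0 by blast
  ultimately have tle: "(\<Sum>v\<in>verts G. t v) + 4 \<le> 4 * card (verts G)" by linarith
  have "(\<Sum>v\<in>verts G. m v) = (\<Sum>v\<in>verts G - {v\<^sub>0}. 4)"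
    using finite_verts v0 by (simp add: m_def sum.remove)
  also have "\<dots> = 4 * (card (verts G) - 1)" using finite_verts v0 by simp
  finally have "(\<Sum>v\<in>verts G. t v) \<le> (\<Sum>v\<in>verts G. m v)"
    using tle finite_verts v0 by (simp add: diff_mult_distrib2)
  moreover have "(\<Sum>v\<in>verts G. m v) \<le> (\<Sum>v\<in>verts G. t v)" by (rule sum_mono[OF le])
  ultimately have "(\<Sum>v\<in>verts G. m v) = (\<Sum>v\<in>verts G. t v)" by linarith
  then have "m v = t v" using sum_mono_inv[of m "verts G" t] le v finite_verts by blast
  then show ?thesis by (simp add: m_def t_def)
qed

text \<open>As there is at most one reflex angle, the equations leave only the listed possibilities.\<close>

lemma vertex_types:
  assumes v: "v \<in> verts G"
  shows vertex_type_unbounded: "2 * plain_reflex v + changes v = 0 \<Longrightarrow> vertex_1 G \<omega> v"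
    and vertex_type_bounded: "2 * plain_reflex v + changes v = 4 \<Longrightarrow>
      vertex_2a G \<omega> v \<or> vertex_2b G \<omega> v \<or> vertex_2c G \<omega> v"
proof -
  let ?S = "sign_changes G \<omega> v" and ?R = "reflex_angles G v"
  note finS = finite_sign_changes[of v] and finR = finite_reflex_angles[of v]
  note r = plain_reflex_le[of v]
  {
    assume "2 * plain_reflex v + changes v = 0"
    then have S: "?S = {}" and p: "plain_reflex v = 0" using finS by (auto simp: changes_def)
    then have "card ?R = 0" using r by simp
    then show "vertex_1 G \<omega> v" using S finR by (simp add: vertex_1_def pointed_def)
  next
    assume eq: "2 * plain_reflex v + changes v = 4"
    consider "plain_reflex v = 1" | "plain_reflex v = 0" "?R = {}" | "plain_reflex v = 0" "?R \<noteq> {}"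
      using r by fastforce
    then show "vertex_2a G \<omega> v \<or> vertex_2b G \<omega> v \<or> vertex_2c G \<omega> v"
    proof cases
      case 1
      then have "card (?S \<inter> ?R) = 0" "card ?R = 1" using r by auto
      then have "vertex_2a G \<omega> v" using 1 eq finS by (auto simp: vertex_2a_def pointed_def changes_def)
      then show ?thesis ..
    next
      case 2
      then have "vertex_2c G \<omega> v" using eq by (simp add: vertex_2c_def pointed_def changes_def)
      then show ?thesis by simp
    next
      case 3
      then have "card ?R \<noteq> 0" using finR by simp
      then have "card (?S \<inter> ?R) = 1" using r 3 by linarith
      then have "vertex_2b G \<omega> v" using 3 eq by (simp add: vertex_2b_def pointed_def changes_def)
      then show ?thesis by simp
    qed
  }
qed

end

section \<open>Faces of the reciprocal as polygons\<close>

lemma cyc_prev_map: "xs \<noteq> [] \<Longrightarrow> cyc_prev (map f xs) i = f (cyc_prev xs i)"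
  by (simp add: cyc_prev_def)

lemma cyc_prev_index:
  assumes "i < length xs"
  obtains k where "k < length xs" "cyc_prev xs i = xs ! k" "cyc_next xs k = xs ! i"
proof -
  define n where "n = length xs"
  define k where "k = (i + n - 1) mod n"
  have n: "i < n" using assms by (simp add: n_def)
  have "Suc k mod n = Suc (i + n - 1) mod n" unfolding k_def by (rule mod_Suc_eq)
  also have "Suc (i + n - 1) = i + n" using n by simp
  finally have "Suc k mod n = i" using n by simp
  moreover have "k < n" using n by (simp add: k_def)
  ultimately show thesis using that[of k] by (simp add: cyc_next_def cyc_prev_def k_def n_def)
qed

lemma cyc_next_rev:
  obtains \<sigma> where "bij_betw \<sigma> {..<length xs} {..<length xs}"
    "\<forall>i<length xs. cyc_next (rev xs) i = xs ! \<sigma> i \<and> rev xs ! i = cyc_next xs (\<sigma> i)"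
proof -
  define n where "n = length xs"
  define \<sigma> where "\<sigma> i = n - 1 - Suc i mod n" for i
  have s: "Suc i mod n = (if Suc i = n then 0 else Suc i)" if "i < n" for i using that by auto
  have "inj_on \<sigma> {..<n}"
  proof (rule inj_onI)
    fix i j assume "i \<in> {..<n}" "j \<in> {..<n}" "\<sigma> i = \<sigma> j"
    then show "i = j" using s[of i] s[of j] by (auto simp: \<sigma>_def split: if_splits)
  qed
  moreover have "\<sigma> ` {..<n} \<subseteq> {..<n}" by (auto simp: \<sigma>_def)
  ultimately have bij: "bij_betw \<sigma> {..<n} {..<n}" by (simp add: bij_betw_def endo_inj_surj)
  have "cyc_next (rev xs) i = xs ! \<sigma> i \<and> rev xs ! i = cyc_next xs (\<sigma> i)" if i: "i < n" for i
  proof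
    have "Suc i mod n < n" using i by simp
    then show "cyc_next (rev xs) i = xs ! \<sigma> i"
      by (simp add: cyc_next_def rev_nth \<sigma>_def n_def)
    have "Suc (\<sigma> i) mod n = n - Suc i" using i s[OF i] by (auto simp: \<sigma>_def)
    then show "rev xs ! i = cyc_next xs (\<sigma> i)" using i by (simp add: cyc_next_def rev_nth n_def)
  qed
  then show thesis using that[of \<sigma>] bij by (simp add: n_def)
qed

lemma jordan_polygon_rev:
  assumes "jordan_polygon ps"
  shows "jordan_polygon (rev ps)" and "polygon_boundary (rev ps) = polygon_boundary ps"
proof -
  define seg where "seg i = closed_segment (ps ! i) (cyc_next ps i)" for i
  define ends where "ends i = {ps ! i, cyc_next ps i}" for i
  obtain \<sigma> where \<sigma>: "bij_betw \<sigma> {..<length ps} {..<length ps}"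
    "\<forall>i<length ps. cyc_next (rev ps) i = ps ! \<sigma> i \<and> rev ps ! i = cyc_next ps (\<sigma> i)"
    by (rule cyc_next_rev)
  have seg: "closed_segment (rev ps ! i) (cyc_next (rev ps) i) = seg (\<sigma> i)"
    and ends: "{rev ps ! i, cyc_next (rev ps) i} = ends (\<sigma> i)" if "i < length ps" for i
    using \<sigma>(2)[rule_format, OF that] by (simp_all add: seg_def ends_def closed_segment_commute insert_commute)
  have img: "\<sigma> ` {..<length ps} = {..<length ps}" using \<sigma>(1) by (rule bij_betw_imp_surj_on)
  have lt: "\<sigma> i < length ps" if "i < length ps" for i using img that by blast
  have inj: "\<sigma> i \<noteq> \<sigma> j" if "i < length ps" "j < length ps" "i \<noteq> j" for i j
    using inj_onD[OF bij_betw_imp_inj_on[OF \<sigma>(1)], of i j] that by auto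
  have meet: "seg i \<inter> seg j \<subseteq> ends i \<inter> ends j" if "i < length ps" "j < length ps" "i \<noteq> j" for i j
    using assms that unfolding jordan_polygon_def seg_def ends_def by metis
  show "jordan_polygon (rev ps)"
    unfolding jordan_polygon_def length_rev
  proof (intro conjI allI impI)
    fix i j assume ij: "i < length ps" "j < length ps" "i \<noteq> j"
    show "closed_segment (rev ps ! i) (cyc_next (rev ps) i) \<inter> closed_segment (rev ps ! j) (cyc_next (rev ps) j)
          \<subseteq> {rev ps ! i, cyc_next (rev ps) i} \<inter> {rev ps ! j, cyc_next (rev ps) j}"
      unfolding seg[OF ij(1)] seg[OF ij(2)] ends[OF ij(1)] ends[OF ij(2)]
      by (rule meet) (use ij lt inj in blast)+
  qed (use assms in \<open>simp_all add: jordan_polygon_def\<close>)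
  have "polygon_boundary (rev ps) = (\<Union>i<length ps. seg (\<sigma> i))"
    unfolding polygon_boundary_def length_rev using seg by simp
  also have "\<dots> = (\<Union>k\<in>\<sigma> ` {..<length ps}. seg k)" by simp
  also have "\<dots> = polygon_boundary ps" unfolding img by (simp add: polygon_boundary_def seg_def)
  finally show "polygon_boundary (rev ps) = polygon_boundary ps" .
qed

lemma simple_polygon_iff:
  "simple_polygon ps \<longleftrightarrow> jordan_polygon ps \<and>
     (\<forall>i<length ps. on_left (ps ! i) (cyc_next ps i) (inside (polygon_boundary ps)))"
  by (simp add: simple_polygon_def jordan_polygon_def)

lemma bij_betw_card_filter:
  assumes "bij_betw g I X"
  shows "card {i \<in> I. P (g i)} = card {x \<in> X. P x}"
proof -
  have "g ` {i \<in> I. P (g i)} = {x \<in> X. P x}" using bij_betw_imp_surj_on[OF assms] by auto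
  moreover have "inj_on g {i \<in> I. P (g i)}" using bij_betw_imp_inj_on[OF assms] by (rule inj_on_subset) auto
  ultimately show ?thesis using card_image by metis
qed

lemma on_left_mono: "on_left a b F \<Longrightarrow> F \<subseteq> F' \<Longrightarrow> on_left a b F'"
  unfolding on_left_def by (auto elim: eventually_mono)

context reciprocal_pair begin

lemma dual_stress_eq:
  "{v, c} \<in> edges G \<Longrightarrow> dual_stress G \<omega> {lface v c, lface c v} = 1 / \<omega> {v, c}"
  using the_inv_into_f_f[OF dual_edge_inj, of "{v, c}"] by (simp add: dual_stress_def dual_edge_eq)

text \<open>The face corresponding to \<open>v\<close> is to the left of its edges when these are directed from the face left
of \<open>v\<close> to \<open>c\<close> to the face on its right.\<close>

lemma oriented_dart:
  assumes v: "v \<in> verts G" and l: "left_face H w a (\<Phi> v)"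
  obtains c where "c \<in> neighbours G v" "w = lface v c" "a = lface c v"
proof -
  have e: "{w, a} \<in> edges H" using l by (simp add: left_face_def)
  obtain b where b: "(a, b) \<in> angles H w" using H.angle_from[of a w] e by (auto simp: neighbours_def simp del: H_simps)
  have w: "w \<in> verts H" using H.edgeD[OF e] by simp
  have fc: "({w, b}, {w, a}) \<in> face_cycle H (\<Phi> v)" using b l w unfolding face_cycle_def by blast
  have "({w, a}, {w, b}) \<in> map_prod (dual_edge G) (dual_edge G) ` vertex_cycle G v"
    unfolding reversed[OF v] using fc by simp
  then obtain c d where cd: "(c, d) \<in> angles G v" "{w, a} = dual_edge G {v, c}" "{w, b} = dual_edge G {v, d}"
    by (auto simp: vertex_cycle_def)
  note e = dual_edges_at_angle[OF cd(1)]
  have "w = lface v c \<and> a = lface c v \<and> b = lface v d"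
    by (rule doubleton_common[OF cd(2)[unfolded e(1)] cd(3)[unfolded e(2)] e(3,4)])
  then show thesis using that[of c] angleD[OF cd(1)] by simp
qed

lemma rface_inj:
  assumes "c \<in> neighbours G v" "d \<in> neighbours G v" "lface c v = lface d v"
  shows "c = d"
proof -
  obtain c' where c': "(c', c) \<in> angles G v" using angle_to[OF assms(1)] .
  obtain d' where d': "(d', d) \<in> angles G v" using angle_to[OF assms(2)] .
  have "lface v c' = lface v d'" using angle_lface[OF c'] angle_lface[OF d'] assms(3) by simp
  then have "c' = d'" using lface_inj angleD[OF c'] angleD[OF d'] by blast
  then show ?thesis using angle_from_unique c' d' by blast
qed

definition convex_corners :: "'v \<Rightarrow> ('v \<times> 'v) set" where
  "convex_corners v = {\<alpha> \<in> angles G v. dual_angle v \<alpha> \<le> pi}"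

text \<open>This holds for every list of vertices that traces the face. So the number of corners and of sign
changes does not depend on the choice of the list, which makes the types of faces exclude each
other.\<close>

lemma internal_face_corners:
  assumes v: "v \<in> verts G" and fc: "internal_face_cycle H (\<Phi> v) vs" and sp: "simple_polygon (map \<rho>' vs)"
  obtains g where "bij_betw g {..<length vs} (angles G v)"
    "corners (map \<rho>' vs) = {i \<in> {..<length vs}. g i \<in> convex_corners v}"
    "cycle_sign_changes (dual_stress G \<omega>) vs = {i \<in> {..<length vs}. g i \<in> sign_changes G \<omega> v}"
proof -
  define n where "n = length vs"
  let ?ps = "map \<rho>' vs"
  have jp: "jordan_polygon ?ps"
    and onl: "\<And>i. i < n \<Longrightarrow> on_left (?ps ! i) (cyc_next ?ps i) (inside (polygon_boundary ?ps))"
    using sp by (auto simp: simple_polygon_iff n_def)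
  have ins: "\<Phi> v = inside (polygon_boundary ?ps)" and cw: "closed_walk H vs" and bdd: "bounded (\<Phi> v)"
    using fc by (auto simp: internal_face_cycle_def)
  have n3: "3 \<le> n" and "distinct ?ps" using jp by (auto simp: jordan_polygon_def n_def)
  then have dvs: "distinct vs" by (simp add: distinct_map)
  have ne: "vs \<noteq> []" using n3 by (auto simp: n_def)
  have dart: "\<exists>c. c \<in> neighbours G v \<and> vs ! i = lface v c \<and> cyc_next vs i = lface c v" if i: "i < n" for i
  proof -
    have "{vs ! i, cyc_next vs i} \<in> edges H" using cw i by (simp add: closed_walk_def n_def)
    moreover have "on_left (pos H (vs ! i)) (pos H (cyc_next vs i)) (\<Phi> v)"
      using onl[OF i] i ne by (simp add: ins cyc_next_map n_def)
    ultimately have "left_face H (vs ! i) (cyc_next vs i) (\<Phi> v)"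
      using \<Phi>_face[OF v] by (simp add: left_face_def)
    then show ?thesis using oriented_dart[OF v] by metis
  qed
  then obtain \<gamma> where \<gamma>: "\<And>i. i < n \<Longrightarrow> \<gamma> i \<in> neighbours G v"
    "\<And>i. i < n \<Longrightarrow> vs ! i = lface v (\<gamma> i)" "\<And>i. i < n \<Longrightarrow> cyc_next vs i = lface (\<gamma> i) v" by metis
  have prev: "\<exists>d. (\<gamma> i, d) \<in> angles G v \<and> cyc_prev vs i = lface v d" if i: "i < n" for i
  proof -
    obtain k where k: "k < n" "cyc_prev vs i = vs ! k" "cyc_next vs k = vs ! i"
      using cyc_prev_index[of i vs] i unfolding n_def by blast
    obtain d where d: "(\<gamma> i, d) \<in> angles G v" using angle_from[OF \<gamma>(1)[OF i]] .
    have "lface (\<gamma> k) v = lface d v"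
      using \<gamma>(3)[OF k(1)] k(3) \<gamma>(2)[OF i] angle_lface[OF d] by simp
    then have "\<gamma> k = d" using rface_inj \<gamma>(1)[OF k(1)] angleD[OF d] by blast
    then show ?thesis using d k(2) \<gamma>(2)[OF k(1)] by auto
  qed
  then obtain \<delta> where \<delta>: "\<And>i. i < n \<Longrightarrow> (\<gamma> i, \<delta> i) \<in> angles G v"
    "\<And>i. i < n \<Longrightarrow> cyc_prev vs i = lface v (\<delta> i)" by metis
  define g where "g i = (\<gamma> i, \<delta> i)" for i
  have bij: "bij_betw g {..<n} (angles G v)"
  proof (rule bij_betw_imageI)
    show "inj_on g {..<n}"
    proof (rule inj_onI)
      fix i j assume ij: "i \<in> {..<n}" "j \<in> {..<n}" "g i = g j"
      then have "vs ! i = vs ! j" using \<gamma>(2)[of i] \<gamma>(2)[of j] by (simp add: g_def)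
      then show "i = j" using dvs ij by (simp add: nth_eq_iff_index_eq n_def)
    qed
    show "g ` {..<n} = angles G v"
    proof (intro equalityI subsetI)
      fix x assume "x \<in> angles G v"
      then obtain c d where cd: "x = (c, d)" "(c, d) \<in> angles G v" by (cases x) auto
      have c: "c \<in> neighbours G v" using angleD[OF cd(2)] by simp
      note e = neighboursD(1)[OF c]
      \<comment> \<open>the midpoint of an edge belongs to no other edge and so identifies it\<close>
      define m where "m = midpoint (\<rho>' (lface v c)) (\<rho>' (lface c v))"
      have pne: "\<rho>' (lface v c) \<noteq> \<rho>' (lface c v)" using H.edgeD(4)[OF dual_edge_in[OF e]] by simp
      obtain p where p: "simple_path p" "pathfinish p = pathstart p" "path_image p = polygon_boundary ?ps"
        using jordan_polygon_path[OF jp] .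
      have "boundary v = polygon_boundary ?ps"
        using dual_face_inside_outside(2)[OF v] Jordan_inside_outside[OF p(1,2)] unfolding p(3) ins by simp
      moreover have "m \<in> edge_segment H (dual_edge G {v, c})"
        unfolding dual_edge_eq[OF e] edge_segment_pair by (simp add: m_def)
      then have "m \<in> boundary v" using c by (auto simp: boundary_def)
      ultimately obtain i where i: "i < n" "m \<in> closed_segment (?ps ! i) (cyc_next ?ps i)"
        by (auto simp: polygon_boundary_def n_def)
      then have mi: "m \<in> edge_segment H (dual_edge G {v, \<gamma> i})"
        using \<gamma>[OF i(1)] ne neighboursD(1)[OF \<gamma>(1)[OF i(1)]]
        by (simp add: dual_edge_eq edge_segment_pair cyc_next_map n_def)
      have "\<gamma> i = c"
      proof (rule ccontr)
        assume "\<gamma> i \<noteq> c"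
        then have "dual_edge G {v, \<gamma> i} \<noteq> dual_edge G {v, c}" using dual_edges_distinct \<gamma>(1)[OF i(1)] c by blast
        then have "m \<in> \<rho>' ` (dual_edge G {v, \<gamma> i} \<inter> dual_edge G {v, c})"
          using H.edges_meet[of "dual_edge G {v, \<gamma> i}" "dual_edge G {v, c}"] mi
            \<open>m \<in> edge_segment H (dual_edge G {v, c})\<close> e neighboursD(1)[OF \<gamma>(1)[OF i(1)]] by auto
        then have "m = \<rho>' (lface v c) \<or> m = \<rho>' (lface c v)" unfolding dual_edge_eq[OF e] by blast
        then show False using pne by (simp add: m_def)
      qed
      then have "x = g i" using \<delta>(1)[OF i(1)] angle_from_unique[OF cd(2)] by (simp add: g_def cd(1))
      then show "x \<in> g ` {..<n}" using i(1) by blast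
    qed (use \<delta>(1) in \<open>auto simp: g_def\<close>)
  qed
  have ang: "interior_angle ?ps i = dual_angle v (g i)" if i: "i < n" for i
  proof -
    have "cyc_prev ?ps i = \<rho>' (cyc_prev vs i)" by (rule cyc_prev_map[OF ne])
    then show ?thesis
      using i \<gamma>[OF i] \<delta>[OF i] ne
      by (simp add: interior_angle_def cyc_next_map n_def dual_angle_def g_def angle_size_def)
  qed
  have sc: "dual_stress G \<omega> {cyc_prev vs i, vs ! i} * dual_stress G \<omega> {vs ! i, cyc_next vs i} < 0
      \<longleftrightarrow> g i \<in> sign_changes G \<omega> v" if i: "i < n" for i
  proof -
    have e: "{v, \<gamma> i} \<in> edges G" "{v, \<delta> i} \<in> edges G" using angleD[OF \<delta>(1)[OF i]] neighboursD(1) by blast+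
    have "vs ! i = lface (\<delta> i) v" using \<gamma>(2)[OF i] angle_lface[OF \<delta>(1)[OF i]] by simp
    then have "dual_stress G \<omega> {cyc_prev vs i, vs ! i} = 1 / \<omega> {v, \<delta> i}"
      using \<delta>(2)[OF i] dual_stress_eq[OF e(2)] by simp
    moreover have "dual_stress G \<omega> {vs ! i, cyc_next vs i} = 1 / \<omega> {v, \<gamma> i}"
      using \<gamma>(2,3)[OF i] dual_stress_eq[OF e(1)] by simp
    ultimately show ?thesis
      using \<delta>(1)[OF i] by (auto simp: sign_changes_def g_def mult_less_0_iff)
  qed
  show thesis
  proof (rule that[of g])
    show "bij_betw g {..<length vs} (angles G v)" using bij by (simp add: n_def)
    show "corners ?ps = {i \<in> {..<length vs}. g i \<in> convex_corners v}"
      using ang \<delta>(1) by (auto simp: corners_def convex_corners_def n_def g_def)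
    show "cycle_sign_changes (dual_stress G \<omega>) vs = {i \<in> {..<length vs}. g i \<in> sign_changes G \<omega> v}"
      using sc by (auto simp: cycle_sign_changes_def n_def)
  qed
qed

lemma convex_corners_eq:
  "convex_corners v = (sign_changes G \<omega> v - reflex_angles G v) \<union> (reflex_angles G v - sign_changes G \<omega> v)"
proof -
  have "(c, d) \<in> convex_corners v \<longleftrightarrow>
      (c, d) \<in> (sign_changes G \<omega> v - reflex_angles G v) \<union> (reflex_angles G v - sign_changes G \<omega> v)" for c d
  proof (cases "(c, d) \<in> angles G v")
    case True
    have "angle_size G v (c, d) \<le> 2 * pi" by (simp add: angle_size_def ccw_angle_le)
    then show ?thesis using True dual_angle_eq[OF True] angle_pos[of v "(c, d)"]
      by (auto simp: convex_corners_def sign_changes_def reflex_angles_def)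
  qed (auto simp: convex_corners_def sign_changes_def reflex_angles_def)
  then show ?thesis by auto
qed

lemma internal_face_counts:
  assumes v: "v \<in> verts G" and fc: "internal_face_cycle H (\<Phi> v) vs" and sp: "simple_polygon (map \<rho>' vs)"
  shows "card (corners (map \<rho>' vs)) = card (convex_corners v)"
    and "card (cycle_sign_changes (dual_stress G \<omega>) vs) = card (sign_changes G \<omega> v)"
    and "card (cycle_sign_changes (dual_stress G \<omega>) vs \<inter> corners (map \<rho>' vs)) =
         card (sign_changes G \<omega> v \<inter> convex_corners v)"
    and "sign_changes G \<omega> v \<subseteq> convex_corners v \<Longrightarrow>
         cycle_sign_changes (dual_stress G \<omega>) vs \<subseteq> corners (map \<rho>' vs)"
proof -
  obtain g where g: "bij_betw g {..<length vs} (angles G v)"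
    "corners (map \<rho>' vs) = {i \<in> {..<length vs}. g i \<in> convex_corners v}"
    "cycle_sign_changes (dual_stress G \<omega>) vs = {i \<in> {..<length vs}. g i \<in> sign_changes G \<omega> v}"
    using internal_face_corners[OF v fc sp] .
  have sub: "{\<alpha> \<in> angles G v. \<alpha> \<in> convex_corners v} = convex_corners v"
    "{\<alpha> \<in> angles G v. \<alpha> \<in> sign_changes G \<omega> v} = sign_changes G \<omega> v"
    "{\<alpha> \<in> angles G v. \<alpha> \<in> sign_changes G \<omega> v \<and> \<alpha> \<in> convex_corners v} = sign_changes G \<omega> v \<inter> convex_corners v"
    by (auto simp: convex_corners_def sign_changes_def)
  show "card (corners (map \<rho>' vs)) = card (convex_corners v)"
    unfolding g(2) bij_betw_card_filter[OF g(1), of "\<lambda>\<alpha>. \<alpha> \<in> convex_corners v"] sub ..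
  show "card (cycle_sign_changes (dual_stress G \<omega>) vs) = card (sign_changes G \<omega> v)"
    unfolding g(3) bij_betw_card_filter[OF g(1), of "\<lambda>\<alpha>. \<alpha> \<in> sign_changes G \<omega> v"] sub ..
  have "cycle_sign_changes (dual_stress G \<omega>) vs \<inter> corners (map \<rho>' vs) =
      {i \<in> {..<length vs}. g i \<in> sign_changes G \<omega> v \<and> g i \<in> convex_corners v}"
    unfolding g(2,3) by blast
  then show "card (cycle_sign_changes (dual_stress G \<omega>) vs \<inter> corners (map \<rho>' vs)) =
         card (sign_changes G \<omega> v \<inter> convex_corners v)"
    using bij_betw_card_filter[OF g(1), of "\<lambda>\<alpha>. \<alpha> \<in> sign_changes G \<omega> v \<and> \<alpha> \<in> convex_corners v"] sub(3) by simp
  show "cycle_sign_changes (dual_stress G \<omega>) vs \<subseteq> corners (map \<rho>' vs)"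
    if "sign_changes G \<omega> v \<subseteq> convex_corners v"
    unfolding g(2,3) using that by blast
qed

text \<open>Since duality reverses orientations, the list runs clockwise around \<open>v\<close>.\<close>

lemma internal_face_polygon:
  assumes v: "v \<in> verts G" and b: "bounded (\<Phi> v)"
  obtains vs where "internal_face_cycle H (\<Phi> v) vs" "simple_polygon (map \<rho>' vs)"
proof -
  obtain cs where cs: "distinct cs" "set cs = neighbours G v"
    "angles G v = (\<lambda>i. (cs ! i, cyc_next cs i)) ` {..<length cs}"
    using rotation_list[OF neighbours_ne[OF v]] by metis
  define n where "n = length cs"
  define vs where "vs = map (lface v) (rev cs)"
  have ps: "map \<rho>' vs = rev (map (\<lambda>c. \<rho>' (lface v c)) cs)" by (simp add: vs_def rev_map)
  note jp = dual_polygon_jordan[OF cs(1,2) v cs(3)]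
  have J: "jordan_polygon (map \<rho>' vs)" unfolding ps by (rule jordan_polygon_rev(1)[OF jp])
  have B: "polygon_boundary (map \<rho>' vs) = boundary v"
    unfolding ps jordan_polygon_rev(2)[OF jp] by (rule dual_polygon_boundary[OF cs(1,2) v cs(3)])
  have ins: "\<Phi> v = inside (boundary v)" using dual_face_inside_outside(1)[OF v] b by simp
  have len: "length vs = n" by (simp add: vs_def n_def)
  have ne: "rev cs \<noteq> []" "vs \<noteq> []" using neighbours_ne[OF v] cs(2) by (auto simp: vs_def)
  obtain \<sigma> where \<sigma>: "bij_betw \<sigma> {..<n} {..<n}"
    "\<forall>i<n. cyc_next (rev cs) i = cs ! \<sigma> i \<and> rev cs ! i = cyc_next cs (\<sigma> i)"
    unfolding n_def by (rule cyc_next_rev)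
  have side: "left_face H (vs ! i) (cyc_next vs i) (\<Phi> v)" if i: "i < n" for i
  proof -
    have "\<sigma> i < n" using bij_betw_imp_surj_on[OF \<sigma>(1)] i by blast
    then have a: "(cyc_next (rev cs) i, rev cs ! i) \<in> angles G v" using cs(3) \<sigma>(2)[rule_format, OF i] by (auto simp: n_def)
    obtain e where "(rev cs ! i, e) \<in> angles G v" using angle_from angleD[OF a] by blast
    then have "left_face H (lface v (rev cs ! i)) (lface (rev cs ! i) v) (\<Phi> v)" by (rule dual_corner(2))
    moreover have "vs ! i = lface v (rev cs ! i)" using i by (simp add: vs_def n_def)
    moreover have "cyc_next vs i = lface (rev cs ! i) v"
      unfolding vs_def cyc_next_map[OF ne(1)] by (rule angle_lface[OF a])
    ultimately show ?thesis by simp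
  qed
  have "set vs \<subseteq> faces G" using lface_in_faces neighboursD(1) cs(2) by (auto simp: vs_def)
  then have "closed_walk H vs"
    using side by (auto simp: closed_walk_def len left_face_def)
  then have "internal_face_cycle H (\<Phi> v) vs"
    using \<Phi>_face[OF v] b B ins by (simp add: internal_face_cycle_def)
  moreover have "on_left (map \<rho>' vs ! i) (cyc_next (map \<rho>' vs) i) (inside (polygon_boundary (map \<rho>' vs)))"
    if "i < n" for i
    using side[OF that] that len ne ins by (simp add: left_face_def B cyc_next_map)
  then have "simple_polygon (map \<rho>' vs)" using J len by (simp add: simple_polygon_iff)
  ultimately show thesis by (rule that)
qed

lemma same_sign:
  assumes v: "v \<in> verts G" and S: "sign_changes G \<omega> v = {}"
    and cd: "c \<in> neighbours G v" "d \<in> neighbours G v"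
  shows "0 < \<omega> {v, c} * \<omega> {v, d}"
proof -
  obtain cs where cs: "distinct cs" "set cs = neighbours G v"
    "angles G v = (\<lambda>i. (cs ! i, cyc_next cs i)) ` {..<length cs}"
    using rotation_list[OF neighbours_ne[OF v]] by metis
  have step: "0 < \<omega> {v, x} * \<omega> {v, y}" if "(x, y) \<in> angles G v" for x y
  proof -
    have "\<not> \<omega> {v, x} * \<omega> {v, y} < 0" using S that by (auto simp: sign_changes_def)
    moreover have "\<omega> {v, x} \<noteq> 0" "\<omega> {v, y} \<noteq> 0" using angleD[OF that] neighboursD(1) stress_nz by blast+
    ultimately show ?thesis by (metis linorder_neqE_linordered_idom mult_eq_0_iff)
  qed
  have "0 < \<omega> {v, cs ! 0} * \<omega> {v, cs ! i}" if "i < length cs" for i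
    using that
  proof (induction i)
    case 0
    then have "\<omega> {v, cs ! 0} \<noteq> 0" using cs(2) neighboursD(1) stress_nz by (metis nth_mem)
    then show ?case by (simp add: zero_less_mult_iff) linarith
  next
    case (Suc i)
    have "cyc_next cs i = cs ! Suc i" using Suc.prems by (simp add: cyc_next_def)
    then have "(cs ! i, cs ! Suc i) \<in> angles G v" using cs(3) Suc.prems by force
    then show ?case using step Suc by (fastforce simp: zero_less_mult_iff)
  qed
  then have all: "0 < \<omega> {v, cs ! 0} * \<omega> {v, x}" if "x \<in> neighbours G v" for x
    using that cs(2) by (metis in_set_conv_nth)
  show ?thesis using all[OF cd(1)] all[OF cd(2)] by (auto simp: zero_less_mult_iff)
qed

text \<open>Multiplication by \<open>\<i>\<close> turns a direction into its left normal, so this inner product says on which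
side of one direction another one lies.\<close>

lemma inner_i_cis: "(\<i> * (of_real r * cis \<beta> * u)) \<bullet> (of_real q * cis \<alpha> * u) = r * q * (norm u)\<^sup>2 * sin (\<alpha> - \<beta>)"
proof -
  have "(\<i> * (of_real r * cis \<beta> * u)) \<bullet> (of_real q * cis \<alpha> * u) =
      r * q * ((Re u)\<^sup>2 + (Im u)\<^sup>2) * (sin \<alpha> * cos \<beta> - cos \<alpha> * sin \<beta>)"
    by (simp add: inner_complex_def power2_eq_square algebra_simps)
  then show ?thesis by (simp add: sin_diff cmod_power2)
qed

text \<open>All stresses at \<open>v\<close> have the same sign, so the edges of the boundary of the face are ordered by
direction. Along the boundary the distance from the line of one edge, measured to the left,
decreases up to a corner \<open>c\<close> and then increases. At such a minimum the direction of this edge lies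
in the angle \<open>(c, d)\<close>; as no edge lies strictly inside an angle, the edge is one of the two edges
at this corner.\<close>

lemma supporting_line:
  assumes v: "v \<in> verts G" and S: "sign_changes G \<omega> v = {}" and R: "reflex_angles G v = {}"
    and b: "b \<in> neighbours G v" and e: "e \<in> neighbours G v"
  defines "D \<equiv> \<i> * (\<rho>' (lface v b) - \<rho>' (lface b v))"
  shows "D \<bullet> \<rho>' (lface v b) \<le> D \<bullet> \<rho>' (lface v e)"
proof -
  define f where "f c = D \<bullet> \<rho>' (lface v c)" for c
  let ?u = "\<lambda>c. pos G c - pos G v"
  have fin: "finite (f ` neighbours G v)" "f ` neighbours G v \<noteq> {}"
    using finite_neighbours neighbours_ne[OF v] by auto
  obtain c where c: "c \<in> neighbours G v" "f c = Min (f ` neighbours G v)" using Min_in[OF fin] by auto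
  have min: "f c \<le> D \<bullet> z" if "z \<in> corner_points v" for z
    using that Min_le[OF fin(1)] c(2) by (auto simp: corner_points_def f_def)
  obtain d where cd: "(c, d) \<in> angles G v" using angle_from[OF c(1)] .
  have d: "d \<in> neighbours G v" using angleD[OF cd] by simp
  note vec = dual_edge_vectors[OF cd]
  have Dw: "D = \<omega> {v, b} *\<^sub>R (\<i> * ?u b)"
    unfolding D_def reciprocal_vector[OF neighboursD(1)[OF b]] by simp
  have "0 \<le> D \<bullet> (\<rho>' (lface c v) - \<rho>' (lface v c))" "0 \<le> D \<bullet> (\<rho>' (lface v d) - \<rho>' (lface v c))"
    using min lface_corner_point c(1) d by (simp_all add: f_def inner_diff_right)
  then have sgn: "\<omega> {v, b} * \<omega> {v, c} * ((\<i> * ?u b) \<bullet> ?u c) \<le> 0" "0 \<le> \<omega> {v, b} * \<omega> {v, d} * ((\<i> * ?u b) \<bullet> ?u d)"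
    unfolding vec Dw by (simp_all add: mult_ac)
  have sb: "(\<i> * ?u b) \<bullet> ?u c \<le> 0" "0 \<le> (\<i> * ?u b) \<bullet> ?u d"
    using sgn mult_le_cancel_left_pos[OF same_sign[OF v S b c(1)], of _ 0]
      mult_le_cancel_left_pos[OF same_sign[OF v S b d], of 0] by simp_all
  have "f b = f c"
  proof (cases "c = b \<or> d = b")
    case True
    then show ?thesis
    proof
      assume "d = b"
      then have "lface v c = lface b v" using angle_lface[OF cd] by simp
      moreover have "D \<bullet> (\<rho>' (lface v b) - \<rho>' (lface b v)) = 0"
        unfolding D_def by (simp add: inner_complex_def algebra_simps)
      ultimately show ?thesis by (simp add: f_def inner_diff_right)
    qed simp
  next
    case False
    define \<alpha> \<beta> where "\<alpha> = ccw_angle (?u c) (?u d)" and "\<beta> = ccw_angle (?u c) (?u b)"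
    have "angle_size G v (c, d) \<le> angle_size G v (c, b)" using cd b by (auto simp: angles_def)
    moreover have "angle_size G v (c, d) \<noteq> angle_size G v (c, b)"
      using ccw_angle_eq_imp_eq[OF c(1) d b] False by blast
    ultimately have ab: "\<alpha> < \<beta>" by (simp add: \<alpha>_def \<beta>_def angle_size_def)
    have \<alpha>: "0 < \<alpha>" by (simp add: \<alpha>_def ccw_angle_pos)
    have \<beta>: "\<beta> < 2 * pi" using angle_size_lt_2pi[OF c(1) b] False by (auto simp: \<beta>_def angle_size_def)
    have zc: "?u c \<noteq> 0" using neighboursD(6)[OF c(1)] .
    obtain r where r: "0 < r" "?u b = of_real r * cis \<beta> * ?u c"
      using ccw_angle_polarE[OF zc neighboursD(6)[OF b]] unfolding \<beta>_def .
    obtain q where q: "0 < q" "?u d = of_real q * cis \<alpha> * ?u c"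
      using ccw_angle_polarE[OF zc neighboursD(6)[OF d]] unfolding \<alpha>_def .
    have pos: "0 < r * (norm (?u c))\<^sup>2" "0 < r * q * (norm (?u c))\<^sup>2" using r q zc by simp_all
    have "(\<i> * ?u b) \<bullet> ?u c = r * (norm (?u c))\<^sup>2 * sin (0 - \<beta>)"
      using inner_i_cis[of r \<beta> "?u c" 1 0] unfolding r(2) by simp
    then have "0 \<le> sin \<beta>" using sb(1) pos(1) by (simp add: zero_le_mult_iff)
    have "\<beta> \<le> pi"
    proof (rule ccontr)
      assume "\<not> \<beta> \<le> pi"
      then have "sin \<beta> < 0" using \<beta> by (intro sin_lt_zero) auto
      then show False using \<open>0 \<le> sin \<beta>\<close> by simp
    qed
    have "(\<i> * ?u b) \<bullet> ?u d = r * q * (norm (?u c))\<^sup>2 * sin (\<alpha> - \<beta>)"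
      using inner_i_cis[of r \<beta> "?u c" q \<alpha>] unfolding r(2) q(2) by simp
    then have "0 \<le> sin (\<alpha> - \<beta>)" using sb(2) pos(2) by (auto simp: zero_le_mult_iff)
    moreover have "0 < sin (\<beta> - \<alpha>)" using ab \<alpha> \<open>\<beta> \<le> pi\<close> by (intro sin_gt_zero) auto
    moreover have "sin (\<alpha> - \<beta>) = - sin (\<beta> - \<alpha>)" by (simp add: sin_diff)
    ultimately show ?thesis by simp
  qed
  then show ?thesis using min lface_corner_point(1)[OF e] by (simp add: f_def)
qed

text \<open>The lines of all edges support the polygon. So its inside is the intersection of the open half
planes to the left of the edges: it is contained in this intersection, which is connected and
disjoint from the boundary.\<close>

lemma convex_exterior:
  assumes v: "v \<in> verts G" and S: "sign_changes G \<omega> v = {}" and R: "reflex_angles G v = {}"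
  shows "convex (boundary v \<union> inside (boundary v))"
proof -
  let ?I = "inside (boundary v)"
  note J = dual_face_inside_outside(3,4,5)[OF v]
  define D where "D b = \<i> * (\<rho>' (lface v b) - \<rho>' (lface b v))" for b
  define Q where "Q = (\<Inter>b\<in>neighbours G v. {z. D b \<bullet> z > D b \<bullet> \<rho>' (lface v b)})"
  have D0: "D b \<noteq> 0" if "b \<in> neighbours G v" for b
    using H.edgeD(4)[OF dual_edge_in[OF neighboursD(1)[OF that]]] by (simp add: D_def)
  have "?I \<subseteq> {z. D b \<bullet> z > D b \<bullet> \<rho>' (lface v b)}" if b: "b \<in> neighbours G v" for b
  proof -
    have "convex hull (corner_points v) \<subseteq> {z. D b \<bullet> z \<ge> D b \<bullet> \<rho>' (lface v b)}"
    proof (rule hull_minimal)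
      show "corner_points v \<subseteq> {z. D b \<bullet> z \<ge> D b \<bullet> \<rho>' (lface v b)}"
        using supporting_line[OF v S R b] by (auto simp: corner_points_def D_def)
    qed (rule convex_halfspace_ge)
    then have "?I \<subseteq> interior {z. D b \<bullet> z \<ge> D b \<bullet> \<rho>' (lface v b)}"
      using inside_boundary_hull[of v] J(3) by (intro interior_maximal) auto
    then show ?thesis using D0[OF b] by simp
  qed
  then have IQ: "?I \<subseteq> Q" by (auto simp: Q_def)
  have QB: "Q \<inter> boundary v = {}"
  proof (rule equals0I)
    fix z assume z: "z \<in> Q \<inter> boundary v"
    then obtain b where b: "b \<in> neighbours G v" "z \<in> edge_segment H (dual_edge G {v, b})"
      by (auto simp: boundary_def)
    then obtain t where t: "z = (1 - t) *\<^sub>R \<rho>' (lface v b) + t *\<^sub>R \<rho>' (lface b v)"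
      unfolding dual_edge_eq[OF neighboursD(1)[OF b(1)]] edge_segment_pair by (auto simp: in_segment)
    have "D b \<bullet> (\<rho>' (lface v b) - \<rho>' (lface b v)) = 0"
      unfolding D_def by (simp add: inner_complex_def algebra_simps)
    then have "D b \<bullet> \<rho>' (lface b v) = D b \<bullet> \<rho>' (lface v b)" by (simp add: inner_diff_right)
    then have "D b \<bullet> z = D b \<bullet> \<rho>' (lface v b)" unfolding t by (simp add: inner_add_right algebra_simps)
    then show False using z b(1) by (auto simp: Q_def)
  qed
  have cQ: "convex Q" unfolding Q_def by (intro convex_INT convex_halfspace_gt)
  have "closed (boundary v)" using J(1) by (metis frontier_closed)
  then have "Q \<subseteq> ?I \<or> Q \<subseteq> outside (boundary v)"
    by (rule connected_inside_or_outside[OF convex_connected[OF cQ] QB])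
  moreover have "?I \<inter> outside (boundary v) = {}" by simp
  ultimately have "Q \<subseteq> ?I" using IQ J(2) by blast
  then have "?I = Q" using IQ by blast
  then have "convex (closure ?I)" using cQ by (simp add: convex_closure)
  moreover have "closure ?I = boundary v \<union> ?I" using closure_Un_frontier[of ?I] J(1) by (simp add: Un_commute)
  ultimately show ?thesis by simp
qed

text \<open>Here the list runs counterclockwise around \<open>v\<close>: the unbounded face is to the right of the polygon
that bounds it.\<close>

lemma exterior_face:
  assumes v: "v \<in> verts G" and b: "\<not> bounded (\<Phi> v)" and v1: "vertex_1 G \<omega> v"
  shows "face_1 H (dual_stress G \<omega>) (\<Phi> v)"
proof -
  have S: "sign_changes G \<omega> v = {}" and R: "reflex_angles G v = {}"
    using v1 by (auto simp: vertex_1_def pointed_def)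
  obtain cs where cs: "distinct cs" "set cs = neighbours G v"
    "angles G v = (\<lambda>i. (cs ! i, cyc_next cs i)) ` {..<length cs}"
    using rotation_list[OF neighbours_ne[OF v]] by metis
  define n where "n = length cs"
  define vs where "vs = map (lface v) cs"
  have ps: "map \<rho>' vs = map (\<lambda>c. \<rho>' (lface v c)) cs" by (simp add: vs_def)
  have J: "jordan_polygon (map \<rho>' vs)" unfolding ps by (rule dual_polygon_jordan[OF cs(1,2) v cs(3)])
  have B: "polygon_boundary (map \<rho>' vs) = boundary v"
    unfolding ps by (rule dual_polygon_boundary[OF cs(1,2) v cs(3)])
  have out: "\<Phi> v = outside (boundary v)" using dual_face_inside_outside(1)[OF v] b by simp
  have len: "length vs = n" by (simp add: vs_def n_def)
  have ne: "cs \<noteq> []" "vs \<noteq> []" using neighbours_ne[OF v] cs(2) by (auto simp: vs_def)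
  have an: "(cs ! i, cyc_next cs i) \<in> angles G v" if "i < n" for i using that cs(3) by (auto simp: n_def)
  have vsi: "vs ! i = lface v (cs ! i)" "vs ! i = lface (cyc_next cs i) v"
    "cyc_next vs i = lface v (cyc_next cs i)" if i: "i < n" for i
  proof -
    show 1: "vs ! i = lface v (cs ! i)" using i by (simp add: vs_def n_def)
    then show "vs ! i = lface (cyc_next cs i) v" using angle_lface[OF an[OF i]] by simp
    show "cyc_next vs i = lface v (cyc_next cs i)" unfolding vs_def by (rule cyc_next_map[OF ne(1)])
  qed
  have edge: "{v, cyc_next cs i} \<in> edges G" if "i < n" for i using angleD[OF an[OF that]] neighboursD(1) by blast
  obtain p where p: "simple_path p" "pathfinish p = pathstart p" "path_image p = boundary v"
    using boundary_jordan[OF v] .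
  have left: "on_left (\<rho>' (vs ! i)) (\<rho>' (cyc_next vs i)) (inside (boundary v))" if i: "i < n" for i
  proof -
    let ?d = "cyc_next cs i"
    have d: "?d \<in> neighbours G v" using angleD[OF an[OF i]] by simp
    have e: "{lface ?d v, lface v ?d} \<in> edges H" using dual_edge_in[OF edge[OF i]] by (simp add: insert_commute)
    have seg: "edge_segment H {lface ?d v, lface v ?d} \<subseteq> boundary v"
      using d dual_edge_eq[OF edge[OF i]] unfolding boundary_def by (auto simp: insert_commute)
    obtain d' where "(?d, d') \<in> angles G v" using angle_from[OF d] .
    then have "left_face H (lface v ?d) (lface ?d v) (\<Phi> v)" by (rule dual_corner(2))
    then have L: "H.lface (lface v ?d) (lface ?d v) = outside (boundary v)"
      unfolding H.left_face_iff out by (rule conjunct2[THEN sym])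
    have "outside (boundary v) \<noteq> {}" using H.face_nonempty[OF \<Phi>_face[OF v]] out by simp
    moreover have "inside (boundary v) \<inter> outside (boundary v) = {}" by simp
    ultimately have "\<not> outside (boundary v) \<subseteq> inside (boundary v)" by blast
    then have "H.lface (lface ?d v) (lface v ?d) \<subseteq> inside (boundary v)"
      using H.jordan_edge_sides[OF e p(1,2), unfolded p(3), OF seg boundary_subset] unfolding L by simp
    moreover have "on_left (\<rho>' (lface ?d v)) (\<rho>' (lface v ?d)) (H.lface (lface ?d v) (lface v ?d))"
      using H.left_face_lface[OF e] by (simp add: left_face_def)
    ultimately show ?thesis using on_left_mono vsi[OF i] by simp
  qed
  have sp: "simple_polygon (map \<rho>' vs)"
    using J left len ne by (simp add: simple_polygon_iff B cyc_next_map)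
  have prev: "cyc_prev vs i = lface (cs ! i) v" if i: "i < n" for i
  proof -
    obtain k where k: "k < length vs" "cyc_prev vs i = vs ! k" "cyc_next vs k = vs ! i"
      using cyc_prev_index[of i vs] i len by metis
    have kn: "k < n" using k(1) len by simp
    have "cyc_next cs k = cs ! i"
      using k(3) vsi(3)[OF kn] vsi(1)[OF i] lface_inj[of "cyc_next cs k" v "cs ! i"] angleD an kn i by metis
    then show ?thesis using k(2) vsi(2)[OF kn] by simp
  qed
  have "cycle_sign_changes (dual_stress G \<omega>) vs = {}"
  proof (rule equals0I)
    fix i assume "i \<in> cycle_sign_changes (dual_stress G \<omega>) vs"
    then have i: "i < n" and neg: "dual_stress G \<omega> {cyc_prev vs i, vs ! i} * dual_stress G \<omega> {vs ! i, cyc_next vs i} < 0"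
      by (auto simp: cycle_sign_changes_def len)
    have c: "{v, cs ! i} \<in> edges G" using angleD[OF an[OF i]] neighboursD(1) by blast
    have "{cyc_prev vs i, vs ! i} = {lface v (cs ! i), lface (cs ! i) v}"
      unfolding prev[OF i] vsi(1)[OF i] by (rule insert_commute)
    moreover have "{vs ! i, cyc_next vs i} = {lface v (cyc_next cs i), lface (cyc_next cs i) v}"
      unfolding vsi(2,3)[OF i] by (rule insert_commute)
    ultimately have "(1 / \<omega> {v, cs ! i}) * (1 / \<omega> {v, cyc_next cs i}) < 0"
      using neg dual_stress_eq[OF c] dual_stress_eq[OF edge[OF i]] by simp
    then have "\<omega> {v, cs ! i} * \<omega> {v, cyc_next cs i} < 0" by (auto simp: mult_less_0_iff)
    then show False using S an[OF i] by (auto simp: sign_changes_def)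
  qed
  moreover have "interior_angle (map \<rho>' vs) i < pi" if i: "i < n" for i
  proof -
    let ?c = "cs ! i" and ?d = "cyc_next cs i"
    note cd = an[OF i]
    have "\<not> \<omega> {v, ?c} * \<omega> {v, ?d} < 0" "\<not> angle_size G v (?c, ?d) > pi"
      using S R cd by (auto simp: sign_changes_def reflex_angles_def)
    then have th: "dual_angle v (?c, ?d) = angle_size G v (?c, ?d) + pi" using dual_angle_eq[OF cd] by simp
    have nb: "lface ?c v \<in> neighbours H (lface v ?c)" "lface v ?d \<in> neighbours H (lface v ?c)"
      using H.angleD[OF dual_corner(1)[OF cd]] by auto
    have "lface ?c v \<noteq> lface v ?d"
    proof
      assume eq: "lface ?c v = lface v ?d"
      have "{v, ?c} \<in> edges G" using angleD[OF cd] neighboursD(1) by blast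
      then have "dual_edge G {v, ?c} = dual_edge G {v, ?d}"
        using eq angle_lface[OF cd] edge[OF i] by (simp add: dual_edge_eq insert_commute)
      then show False using dual_edges_distinct angleD[OF cd] angle_ne[OF cd] by blast
    qed
    then have lt: "dual_angle v (?c, ?d) < 2 * pi"
      using H.angle_size_lt_2pi[OF nb] by (simp add: dual_angle_def)
    have "cyc_prev (map \<rho>' vs) i = \<rho>' (cyc_prev vs i)" by (rule cyc_prev_map[OF ne(2)])
    then have "interior_angle (map \<rho>' vs) i =
        ccw_angle (\<rho>' (lface v ?d) - \<rho>' (lface v ?c)) (\<rho>' (lface ?c v) - \<rho>' (lface v ?c))"
      using i len ne by (simp add: interior_angle_def cyc_next_map prev[OF i] vsi[OF i])
    also have "\<dots> = 2 * pi - dual_angle v (?c, ?d)"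
      using ccw_angle_swap[of "\<rho>' (lface ?c v) - \<rho>' (lface v ?c)" "\<rho>' (lface v ?d) - \<rho>' (lface v ?c)"]
        H.neighboursD(6)[OF nb(1)] H.neighboursD(6)[OF nb(2)] lt
      by (simp add: dual_angle_def angle_size_def)
    finally show ?thesis using th angle_pos[of v "(?c, ?d)"] by simp
  qed
  moreover have "convex (polygon_region (map \<rho>' vs))"
    unfolding polygon_region_def B by (rule convex_exterior[OF v S R])
  ultimately have strict: "strictly_convex_polygon (map \<rho>' vs)" "cycle_sign_changes (dual_stress G \<omega>) vs = {}"
    using sp len by (simp_all add: strictly_convex_polygon_def)
  have "set vs \<subseteq> faces G" using lface_in_faces neighboursD(1) cs(2) by (auto simp: vs_def)
  moreover have "{vs ! i, cyc_next vs i} \<in> edges H" if i: "i < n" for i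
    using dual_edge_in[OF edge[OF i]] unfolding vsi(2,3)[OF i] by (metis insert_commute)
  ultimately have "closed_walk H vs" by (simp add: closed_walk_def len)
  moreover have "- \<Phi> v = polygon_region (map \<rho>' vs)"
    unfolding polygon_region_def B out by (simp add: union_with_inside)
  ultimately have "exterior_face_cycle H (\<Phi> v) vs"
    using \<Phi>_face[OF v] b by (simp add: exterior_face_cycle_def)
  then show ?thesis using strict unfolding face_1_def by auto
qed

text \<open>The values of the corner and sign change counts tell the three types apart.\<close>

lemma corner_counts:
  "vertex_2a G \<omega> v \<Longrightarrow> card (convex_corners v) = 3 \<and> card (sign_changes G \<omega> v) = 2 \<and> sign_changes G \<omega> v \<subseteq> convex_corners v"
  "vertex_2b G \<omega> v \<Longrightarrow> card (convex_corners v) = 3 \<and> card (sign_changes G \<omega> v) = 4 \<and>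
     card (sign_changes G \<omega> v \<inter> convex_corners v) = 3"
  "vertex_2c G \<omega> v \<Longrightarrow> card (convex_corners v) = 4 \<and> card (sign_changes G \<omega> v) = 4 \<and> sign_changes G \<omega> v \<subseteq> convex_corners v"
proof -
  let ?S = "sign_changes G \<omega> v" and ?R = "reflex_angles G v"
  note finS = finite_sign_changes[of v] and finR = finite_reflex_angles[of v]
  have R1: "card ?R = 1" if "?R \<noteq> {}"
  proof -
    have "card ?R \<noteq> 0" using that finR by simp
    then show ?thesis using plain_reflex_le(2)[of v] by linarith
  qed
  {
    assume "vertex_2a G \<omega> v"
    then have a: "?R \<noteq> {}" "card ?S = 2" "?S \<inter> ?R = {}" by (auto simp: vertex_2a_def pointed_def)
    have "convex_corners v = ?S \<union> ?R" unfolding convex_corners_eq using a(3) by blast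
    then show "card (convex_corners v) = 3 \<and> card ?S = 2 \<and> ?S \<subseteq> convex_corners v"
      using card_Un_disjoint[OF finS finR a(3)] R1[OF a(1)] a(2) by simp
  next
    assume "vertex_2b G \<omega> v"
    then have a: "?R \<noteq> {}" "card ?S = 4" "card (?S \<inter> ?R) = 1" by (auto simp: vertex_2b_def pointed_def)
    have "?S \<inter> ?R = ?R" using card_subset_eq[OF finR, of "?S \<inter> ?R"] a(3) R1[OF a(1)] by auto
    then have eq: "convex_corners v = ?S - ?R" "?S \<inter> convex_corners v = ?S - ?R" "?R \<subseteq> ?S"
      unfolding convex_corners_eq by blast+
    have "card (?S - ?R) = 3" using card_Diff_subset[OF finR eq(3)] R1[OF a(1)] a(2) by simp
    then show "card (convex_corners v) = 3 \<and> card ?S = 4 \<and> card (?S \<inter> convex_corners v) = 3"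
      using eq a(2) by simp
  next
    assume "vertex_2c G \<omega> v"
    then have a: "?R = {}" "card ?S = 4" by (auto simp: vertex_2c_def pointed_def)
    have "convex_corners v = ?S" unfolding convex_corners_eq using a(1) by blast
    then show "card (convex_corners v) = 4 \<and> card ?S = 4 \<and> ?S \<subseteq> convex_corners v" using a(2) by simp
  }
qed

lemma vertex_face_correspondence:
  "(\<exists>v\<^sub>0\<in>verts G. vertex_1 G \<omega> v\<^sub>0 \<and>
      (\<forall>v\<in>verts G - {v\<^sub>0}. vertex_2a G \<omega> v \<or> vertex_2b G \<omega> v \<or> vertex_2c G \<omega> v))
   \<and> (\<forall>v\<in>verts G.
      (vertex_1 G \<omega> v \<longleftrightarrow> face_1 H (dual_stress G \<omega>) (\<Phi> v)) \<and>
      (vertex_2a G \<omega> v \<longleftrightarrow> face_2a H (dual_stress G \<omega>) (\<Phi> v)) \<and>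
      (vertex_2b G \<omega> v \<longleftrightarrow> face_2b H (dual_stress G \<omega>) (\<Phi> v)) \<and>
      (vertex_2c G \<omega> v \<longleftrightarrow> face_2c H (dual_stress G \<omega>) (\<Phi> v)))"
proof -
  obtain v\<^sub>0 where v0: "v\<^sub>0 \<in> verts G" "\<not> bounded (\<Phi> v\<^sub>0)"
    and bdd: "\<And>v. v \<in> verts G \<Longrightarrow> v \<noteq> v\<^sub>0 \<Longrightarrow> bounded (\<Phi> v)"
    using unbounded_dual_face by metis
  have turn: "2 * plain_reflex v + changes v = (if v = v\<^sub>0 then 0 else 4)" if "v \<in> verts G" for v
    by (rule vertex_turning[OF v0(1) _ that]) (rule bdd)
  have type0: "vertex_1 G \<omega> v\<^sub>0" using vertex_type_unbounded turn v0(1) by simp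
  have type: "vertex_2a G \<omega> v \<or> vertex_2b G \<omega> v \<or> vertex_2c G \<omega> v" if "v \<in> verts G" "v \<noteq> v\<^sub>0" for v
    using vertex_type_bounded[OF that(1)] turn[OF that(1)] that(2) by simp
  have no_change: "card (sign_changes G \<omega> v) = 0" if "vertex_1 G \<omega> v" for v
    using that by (simp add: vertex_1_def)
  have iffs: "(vertex_1 G \<omega> v \<longleftrightarrow> face_1 H (dual_stress G \<omega>) (\<Phi> v)) \<and>
      (vertex_2a G \<omega> v \<longleftrightarrow> face_2a H (dual_stress G \<omega>) (\<Phi> v)) \<and>
      (vertex_2b G \<omega> v \<longleftrightarrow> face_2b H (dual_stress G \<omega>) (\<Phi> v)) \<and>
      (vertex_2c G \<omega> v \<longleftrightarrow> face_2c H (dual_stress G \<omega>) (\<Phi> v))" if v: "v \<in> verts G" for v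
  proof (cases "v = v\<^sub>0")
    case True
    have "\<not> vertex_2a G \<omega> v" "\<not> vertex_2b G \<omega> v" "\<not> vertex_2c G \<omega> v"
      using no_change[OF type0] True by (auto simp: vertex_2a_def vertex_2b_def vertex_2c_def)
    moreover have "\<not> face_2a H (dual_stress G \<omega>) (\<Phi> v)" "\<not> face_2b H (dual_stress G \<omega>) (\<Phi> v)"
      "\<not> face_2c H (dual_stress G \<omega>) (\<Phi> v)"
      using v0(2) True by (auto simp: face_2a_def face_2b_def face_2c_def internal_face_cycle_def)
    moreover have "face_1 H (dual_stress G \<omega>) (\<Phi> v)" "vertex_1 G \<omega> v"
      using exterior_face[OF v0 type0] type0 True by simp_all
    ultimately show ?thesis by blast
  next
    case False
    have b: "bounded (\<Phi> v)" using bdd[OF v False] .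
    obtain vs where vs: "internal_face_cycle H (\<Phi> v) vs" "simple_polygon (map \<rho>' vs)"
      using internal_face_polygon[OF v b] .
    note counts = internal_face_counts[OF v]
    note here = counts[OF vs]
    have n1: "\<not> vertex_1 G \<omega> v"
      using type[OF v False] no_change[of v] by (auto simp: vertex_2a_def vertex_2b_def vertex_2c_def)
    have f1: "\<not> face_1 H (dual_stress G \<omega>) (\<Phi> v)" using b by (auto simp: face_1_def exterior_face_cycle_def)
    have a: "face_2a H (dual_stress G \<omega>) (\<Phi> v)" if "vertex_2a G \<omega> v"
      using corner_counts(1)[OF that] here vs unfolding face_2a_def pseudo_triangle_def H_simps by metis
    have b: "face_2b H (dual_stress G \<omega>) (\<Phi> v)" if "vertex_2b G \<omega> v"
      using corner_counts(2)[OF that] here vs unfolding face_2b_def pseudo_triangle_def H_simps by metis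
    have c: "face_2c H (dual_stress G \<omega>) (\<Phi> v)" if "vertex_2c G \<omega> v"
      using corner_counts(3)[OF that] here vs unfolding face_2c_def pseudo_quadrangle_def H_simps by metis
    have a': "card (sign_changes G \<omega> v) = 2" if f: "face_2a H (dual_stress G \<omega>) (\<Phi> v)"
    proof -
      obtain us where "internal_face_cycle H (\<Phi> v) us" "simple_polygon (map \<rho>' us)"
        "card (cycle_sign_changes (dual_stress G \<omega>) us) = 2"
        using f unfolding face_2a_def pseudo_triangle_def H_simps by blast
      then show ?thesis using counts(2)[of us] by simp
    qed
    have b': "card (sign_changes G \<omega> v) = 4 \<and> card (convex_corners v) = 3" if f: "face_2b H (dual_stress G \<omega>) (\<Phi> v)"
    proof -
      obtain us where "internal_face_cycle H (\<Phi> v) us" "simple_polygon (map \<rho>' us)"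
        "card (cycle_sign_changes (dual_stress G \<omega>) us) = 4" "card (corners (map \<rho>' us)) = 3"
        using f unfolding face_2b_def pseudo_triangle_def H_simps by blast
      then show ?thesis using counts(1,2)[of us] by simp
    qed
    have c': "card (convex_corners v) = 4" if f: "face_2c H (dual_stress G \<omega>) (\<Phi> v)"
    proof -
      obtain us where "internal_face_cycle H (\<Phi> v) us" "simple_polygon (map \<rho>' us)"
        "card (corners (map \<rho>' us)) = 4"
        using f unfolding face_2c_def pseudo_quadrangle_def H_simps by blast
      then show ?thesis using counts(1)[of us] by simp
    qed
    have "vertex_2a G \<omega> v" if "face_2a H (dual_stress G \<omega>) (\<Phi> v)"
      using type[OF v False] corner_counts(2,3)[of v] a'[OF that] by auto
    moreover have "vertex_2b G \<omega> v" if "face_2b H (dual_stress G \<omega>) (\<Phi> v)"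
      using type[OF v False] corner_counts(1,3)[of v] b'[OF that] by auto
    moreover have "vertex_2c G \<omega> v" if "face_2c H (dual_stress G \<omega>) (\<Phi> v)"
      using type[OF v False] corner_counts(1,2)[of v] c'[OF that] by auto
    ultimately show ?thesis using n1 f1 a b c by blast
  qed
  show ?thesis using v0(1) type0 type iffs by blast
qed

end

theorem theorem4:
  fixes G :: "'v framework" and \<omega> :: "'v set \<Rightarrow> real"
    and \<rho>' :: "complex set \<Rightarrow> complex" and \<Phi> :: "'v \<Rightarrow> complex set"
  assumes "noncrossing G" and "two_connected G"
    and "self_stress G \<omega>" and "\<forall>e\<in>edges G. \<omega> e \<noteq> 0"
    and "reciprocal G \<omega> \<rho>'" and "noncrossing_reciprocal G \<rho>' \<Phi>"
  shows "(\<exists>v\<^sub>0\<in>verts G. vertex_1 G \<omega> v\<^sub>0 \<and>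
            (\<forall>v\<in>verts G - {v\<^sub>0}. vertex_2a G \<omega> v \<or> vertex_2b G \<omega> v \<or> vertex_2c G \<omega> v))
       \<and> (\<forall>v\<in>verts G.
            (vertex_1 G \<omega> v \<longleftrightarrow> face_1 (dual_framework G \<rho>') (dual_stress G \<omega>) (\<Phi> v)) \<and>
            (vertex_2a G \<omega> v \<longleftrightarrow> face_2a (dual_framework G \<rho>') (dual_stress G \<omega>) (\<Phi> v)) \<and>
            (vertex_2b G \<omega> v \<longleftrightarrow> face_2b (dual_framework G \<rho>') (dual_stress G \<omega>) (\<Phi> v)) \<and>
            (vertex_2c G \<omega> v \<longleftrightarrow> face_2c (dual_framework G \<rho>') (dual_stress G \<omega>) (\<Phi> v)))"
proof -
  interpret plane_drawing G by (rule noncrossing_imp_plane_drawing[OF assms(1)])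
  interpret reciprocal_pair G \<omega> \<rho>' \<Phi>
    by unfold_locales (use assms in auto)
  show ?thesis by (rule vertex_face_correspondence)
qed

end
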